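(* Let $2\mathcal{C}$ be a topological $2$-category such that: 1. the source map $s_1\colon2\mathcal{C}_1\to2\mathcal{C}_0$ from $1$-morphisms to objects is a Hurewicz fibration; 2. the target map $t_2\colon2\mathcal{C}_2\to2\mathcal{C}_1$ from $2$-morphisms to $1$-morphisms is a Hurewicz fibration; 3. the space $2\mathcal{C}_2$ of $2$-morphisms is locally equiconnected; 4. all $2$-morphisms are isomorphisms for vertical composition, and the map $(-)^{-1}\colon2\mathcal{C}_2\to2\mathcal{C}_2$ sending a $2$-morphism to its vertical inverse is continuous. Then $2\mathcal{C}$ is good, i.e. the geometric nerve $\Delta2\mathcal{C}$ is a good simplicial space.
   Context: A $2$-category here means a bicategory. It is topological if it is internal to topological spaces: there are spaces $2\mathcal{C}_0,2\mathcal{C}_1,2\mathcal{C}_2$ of objects, $1$-morphisms and $2$-morphisms, with all structure maps continuous. Horizontal composition is $*$, and $\underline{\alpha}$ is the associativity isomorphism. A space $X$ is locally equiconnected (LEC) if the diagonal $X\to X\times X$ is a closed cofibration. A simplicial space is good if all its degeneracy maps are closed cofibrations. The geometric nerve $\Delta2\mathcal{C}$ is the simplicial space whose $n$-simplices consist of objects $x_i$ ($0\le i\le n$), $1$-morphisms $x_{ij}\colon x_i\to x_j$ ($i<j$) and $2$-morphisms $x_{ijk}\colon x_{ik}\Rightarrow x_{jk}*x_{ij}$ ($i<j<k$) such that $\underline{\alpha}(x_{kl}*x_{ijk})x_{ikl}=(x_{jkl}*x_{ij})x_{ijl}$ for all $i<j<k<l$. It has the subspace topology from the product of copies of $2\mathcal{C}_0,2\mathcal{C}_1,2\mathcal{C}_2$;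 degeneracies insert identities and unit coherence isomorphisms. *)

theory Defs
  imports "HOL-Analysis.Analysis"
begin

section \<open>Hurewicz fibrations\<close>

abbreviation unit_interval :: "real topology"
  where "unit_interval \<equiv> top_of_set {0..1}"

definition homotopy_lifting :: "'x topology \<Rightarrow> 'e topology \<Rightarrow> 'b topology \<Rightarrow> ('e \<Rightarrow> 'b) \<Rightarrow> bool"
  where "homotopy_lifting X E B p \<longleftrightarrow>
    (\<forall>f H. continuous_map X E f \<and> continuous_map (prod_topology X unit_interval) B H \<and>
           (\<forall>x\<in>topspace X. H (x, 0) = p (f x)) \<longrightarrow>
       (\<exists>K. continuous_map (prod_topology X unit_interval) E K \<and>
            (\<forall>x\<in>topspace X. K (x, 0) = f x) \<and>
            (\<forall>x\<in>topspace X. \<forall>t\<in>{0..1}. p (K (x, t)) = H (x, t))))"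

text \<open>
  A Hurewicz fibration has the homotopy lifting property for all spaces. HOL cannot quantify over
  types inside a formula, so the test spaces are the topologies on one type, large enough to carry
  the universal test space \<open>E \<times>\<^sub>B B\<^sup>I\<close>. This is no restriction: lemma
  \<open>hurewicz_fibration_lifting\<close> yields the property for spaces of every type.
\<close>

definition hurewicz_fibration :: "'e topology \<Rightarrow> 'b topology \<Rightarrow> ('e \<Rightarrow> 'b) \<Rightarrow> bool"
  where "hurewicz_fibration E B p \<longleftrightarrow> continuous_map E B p \<and>
    (\<forall>X :: ('e \<times> (real \<Rightarrow> 'b)) topology. homotopy_lifting X E B p)"

lemma quotient_map_exists:
  fixes q :: "'x \<Rightarrow> 'y"
  obtains Q where "quotient_map X Q q" "topspace Q = q ` topspace X"
proof -
  let ?L = "\<lambda>U. U \<subseteq> q ` topspace X \<and> openin X {x \<in> topspace X. q x \<in> U}"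
  have "istopology ?L"
    unfolding istopology_def
  proof (intro conjI allI impI)
    fix S T assume "?L S" "?L T"
    moreover have "{x \<in> topspace X. q x \<in> S \<inter> T} =
        {x \<in> topspace X. q x \<in> S} \<inter> {x \<in> topspace X. q x \<in> T}" by auto
    ultimately show "S \<inter> T \<subseteq> q ` topspace X" "openin X {x \<in> topspace X. q x \<in> S \<inter> T}"
      by auto
  next
    fix \<K> assume "\<forall>K\<in>\<K>. ?L K"
    moreover have "{x \<in> topspace X. q x \<in> \<Union>\<K>} = (\<Union>K\<in>\<K>. {x \<in> topspace X. q x \<in> K})" by auto
    ultimately show "\<Union>\<K> \<subseteq> q ` topspace X" "openin X {x \<in> topspace X. q x \<in> \<Union>\<K>}"
      by (auto intro!: openin_Union)
  qed
  define Q where "Q = topology ?L"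
  have op: "openin Q U \<longleftrightarrow> U \<subseteq> q ` topspace X \<and> openin X {x \<in> topspace X. q x \<in> U}" for U
    unfolding Q_def topology_inverse'[OF \<open>istopology ?L\<close>] ..
  have "{x \<in> topspace X. q x \<in> q ` topspace X} = topspace X" by blast
  then have "openin Q (q ` topspace X)" by (simp add: op)
  moreover have "topspace Q \<subseteq> q ` topspace X" using op[of "topspace Q"] by simp
  ultimately have ts: "topspace Q = q ` topspace X" by (meson openin_subset subset_antisym)
  have "quotient_map X Q q"
    unfolding quotient_map_def ts by (simp add: op)
  then show thesis using ts by (rule that)
qed

lemma hurewicz_fibration_lifting:
  fixes X :: "'x topology"
  assumes "hurewicz_fibration E B p"
  shows "homotopy_lifting X E B p"
  unfolding homotopy_lifting_def
proof (intro allI impI, elim conjE)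
  fix f H
  assume f: "continuous_map X E f" and H: "continuous_map (prod_topology X unit_interval) B H"
    and H0: "\<forall>x\<in>topspace X. H (x, 0) = p (f x)"
  define q where "q x = (f x, \<lambda>t::real. if t \<in> {0..1} then H (x, t) else undefined)" for x
  obtain Q where Q: "quotient_map X Q q" and tQ: "topspace Q = q ` topspace X"
    by (rule quotient_map_exists)
  have qI: "quotient_map (prod_topology X unit_interval) (prod_topology Q unit_interval)
      (\<lambda>(x,t). (q x, t))"
    by (rule quotient_map_prod_left[OF _ _ Q])
       (auto simp: compact_imp_locally_compact_space compact_space_subtopology
          Hausdorff_space_subtopology)
  define H' where "H' = (\<lambda>(z :: 'a \<times> (real \<Rightarrow> 'b), t). snd z t)"
  have "continuous_map Q E fst"
    by (rule continuous_compose_quotient_map[OF Q]) (simp add: q_def o_def f)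
  moreover have "continuous_map (prod_topology Q unit_interval) B H'"
    by (rule continuous_compose_quotient_map[OF qI], rule continuous_map_eq[OF H])
       (auto simp: H'_def q_def)
  moreover have "\<forall>z\<in>topspace Q. H' (z, 0) = p (fst z)"
    using H0 by (auto simp: tQ H'_def q_def)
  moreover have "homotopy_lifting Q E B p"
    using assms unfolding hurewicz_fibration_def by blast
  ultimately obtain K where K: "continuous_map (prod_topology Q unit_interval) E K"
    and K0: "\<forall>z\<in>topspace Q. K (z, 0) = fst z"
    and pK: "\<forall>z\<in>topspace Q. \<forall>t\<in>{0..1}. p (K (z, t)) = H' (z, t)"
    unfolding homotopy_lifting_def by blast
  have "continuous_map (prod_topology X unit_interval) E (K \<circ> (\<lambda>(x,t). (q x, t)))"
    using quotient_imp_continuous_map[OF qI] K by (rule continuous_map_compose)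
  moreover have "\<forall>x\<in>topspace X. (K \<circ> (\<lambda>(x,t). (q x, t))) (x, 0) = f x"
    using K0 by (auto simp: tQ q_def)
  moreover have "\<forall>x\<in>topspace X. \<forall>t\<in>{0..1}. p ((K \<circ> (\<lambda>(x,t). (q x, t))) (x, t)) = H (x, t)"
    using pK by (auto simp: tQ q_def H'_def)
  ultimately show "\<exists>K. continuous_map (prod_topology X unit_interval) E K \<and>
            (\<forall>x\<in>topspace X. K (x, 0) = f x) \<and>
            (\<forall>x\<in>topspace X. \<forall>t\<in>{0..1}. p (K (x, t)) = H (x, t))"
    by blast
qed


section \<open>Closed cofibrations and locally equiconnected spaces\<close>

definition homotopy_extension :: "'a topology \<Rightarrow> 'x topology \<Rightarrow> ('a \<Rightarrow> 'x) \<Rightarrow> 'y topology \<Rightarrow> bool"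
  where "homotopy_extension A X i Y \<longleftrightarrow>
    (\<forall>f H. continuous_map X Y f \<and> continuous_map (prod_topology A unit_interval) Y H \<and>
           (\<forall>a\<in>topspace A. H (a, 0) = f (i a)) \<longrightarrow>
       (\<exists>K. continuous_map (prod_topology X unit_interval) Y K \<and>
            (\<forall>x\<in>topspace X. K (x, 0) = f x) \<and>
            (\<forall>a\<in>topspace A. \<forall>t\<in>{0..1}. K (i a, t) = H (a, t))))"

text \<open>
  As for fibrations, the target spaces range over the topologies on one type, which carries the
  mapping cylinder of \<open>i\<close>; lemma \<open>cofibration_extension\<close> yields the homotopy extension property
  for target spaces of every type.
\<close>

definition cofibration :: "'a topology \<Rightarrow> 'x topology \<Rightarrow> ('a \<Rightarrow> 'x) \<Rightarrow> bool"
  where "cofibration A X i \<longleftrightarrow> continuous_map A X i \<and>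
    (\<forall>Y :: ('x + 'a \<times> real) topology. homotopy_extension A X i Y)"

lemma cofibration_extension:
  fixes Y :: "'y topology"
  assumes "cofibration A X i"
  shows "homotopy_extension A X i Y"
  unfolding homotopy_extension_def
proof (intro allI impI, elim conjE)
  fix f H
  assume f: "continuous_map X Y f" and H: "continuous_map (prod_topology A unit_interval) Y H"
    and H0: "\<forall>a\<in>topspace A. H (a, 0) = f (i a)"
  have i: "continuous_map A X i" using assms by (simp add: cofibration_def)
  define c where "c = (\<lambda>(a, t::real). if t = 0 then Inl (i a) else Inr (a, t))"
  let ?AI = "prod_topology A unit_interval"
  let ?C = "Inl ` topspace X \<union> c ` topspace ?AI"
  let ?L = "\<lambda>U. U \<subseteq> ?C \<and> openin X {x \<in> topspace X. Inl x \<in> U} \<and>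
                openin ?AI {z \<in> topspace ?AI. c z \<in> U}"
  have ist: "istopology ?L"
    unfolding istopology_def
  proof (intro allI impI conjI)
    fix S T assume "?L S" "?L T"
    moreover have "{x \<in> topspace X. Inl x \<in> S \<inter> T} =
        {x \<in> topspace X. Inl x \<in> S} \<inter> {x \<in> topspace X. Inl x \<in> T}"
      "{x \<in> topspace ?AI. c x \<in> S \<inter> T} =
        {x \<in> topspace ?AI. c x \<in> S} \<inter> {x \<in> topspace ?AI. c x \<in> T}" by blast+
    ultimately show "S \<inter> T \<subseteq> ?C" "openin X {x \<in> topspace X. Inl x \<in> S \<inter> T}"
      "openin ?AI {z \<in> topspace ?AI. c z \<in> S \<inter> T}"
      by (auto simp del: topspace_prod_topology)
  next
    fix \<K> assume "\<forall>K\<in>\<K>. ?L K"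
    moreover have "{x \<in> topspace X. Inl x \<in> \<Union>\<K>} = (\<Union>K\<in>\<K>. {x \<in> topspace X. Inl x \<in> K})"
      "{x \<in> topspace ?AI. c x \<in> \<Union>\<K>} = (\<Union>K\<in>\<K>. {x \<in> topspace ?AI. c x \<in> K})" by blast+
    ultimately show "\<Union>\<K> \<subseteq> ?C" "openin X {x \<in> topspace X. Inl x \<in> \<Union>\<K>}"
      "openin ?AI {z \<in> topspace ?AI. c z \<in> \<Union>\<K>}"
      by (auto simp del: topspace_prod_topology intro!: openin_Union)
  qed
  define M where "M = topology ?L"
  have op: "openin M U \<longleftrightarrow> U \<subseteq> ?C \<and> openin X {x \<in> topspace X. Inl x \<in> U} \<and>
                openin ?AI {z \<in> topspace ?AI. c z \<in> U}" for U
    unfolding M_def topology_inverse'[OF ist] ..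
  have CX: "{x \<in> topspace X. Inl x \<in> ?C} = topspace X" by blast
  have CA: "{z \<in> topspace ?AI. c z \<in> ?C} = topspace ?AI" by blast
  have "openin M ?C" unfolding op CX CA by (intro conjI order_refl openin_topspace)
  then have "?C \<subseteq> topspace M" by (rule openin_subset)
  moreover have "topspace M \<subseteq> ?C"
    by (rule conjunct1[OF iffD1[OF op]]) (rule openin_topspace)
  ultimately have ts: "topspace M = ?C" by (rule equalityI[rotated])
  have inl: "continuous_map X M Inl"
    unfolding continuous_map_def op ts by (intro conjI allI impI; (elim conjE)?) (blast, assumption)
  have c: "continuous_map ?AI M c"
    unfolding continuous_map_def op ts by (intro conjI allI impI; (elim conjE)?) (blast, assumption)
  have "homotopy_extension A X i M"
    using assms by (simp add: cofibration_def)
  moreover have "\<forall>a\<in>topspace A. c (a, 0) = Inl (i a)" by (simp add: c_def)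
  ultimately obtain R where R: "continuous_map (prod_topology X unit_interval) M R"
    and R0: "\<forall>x\<in>topspace X. R (x, 0) = Inl x"
    and Ri: "\<forall>a\<in>topspace A. \<forall>t\<in>{0..1}. R (i a, t) = c (a, t)"
    using inl c unfolding homotopy_extension_def by blast
  define g where "g = case_sum f H"
  have gc: "g (c z) = H z" if "z \<in> topspace ?AI" for z
    using that H0 by (cases z) (auto simp: g_def c_def)
  have g: "continuous_map M Y g"
    unfolding continuous_map_def
  proof (intro conjI allI impI)
    show "g \<in> topspace M \<rightarrow> topspace Y"
    proof
      fix m assume "m \<in> topspace M"
      then consider x where "x \<in> topspace X" "m = Inl x" | z where "z \<in> topspace ?AI" "m = c z"
        unfolding ts by blast
      then show "g m \<in> topspace Y"
      proof cases
        case 1 then show ?thesis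
          using continuous_map_funspace[OF f] by (auto simp: g_def)
      next
        case 2 then show ?thesis
          using continuous_map_funspace[OF H] gc by (metis Pi_mem)
      qed
    qed
    fix U assume U: "openin Y U"
    define P where "P = {m \<in> topspace M. g m \<in> U}"
    have "Inl x \<in> P \<longleftrightarrow> f x \<in> U" if "x \<in> topspace X" for x
      using that by (simp add: P_def ts g_def)
    then have "{x \<in> topspace X. Inl x \<in> P} = {x \<in> topspace X. f x \<in> U}"
      by blast
    then have PX: "openin X {x \<in> topspace X. Inl x \<in> P}"
      using openin_continuous_map_preimage[OF f U] by simp
    have "c z \<in> P \<longleftrightarrow> H z \<in> U" if "z \<in> topspace ?AI" for z
    proof -
      have "c z \<in> topspace M" unfolding ts using that by (intro UnI2 imageI)
      then show ?thesis by (simp add: P_def gc[OF that])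
    qed
    then have "{z \<in> topspace ?AI. c z \<in> P} = {z \<in> topspace ?AI. H z \<in> U}"
      by (intro Collect_cong conj_cong refl)
    then have PA: "openin ?AI {z \<in> topspace ?AI. c z \<in> P}"
      using openin_continuous_map_preimage[OF H U] by simp
    have "P \<subseteq> ?C" unfolding P_def ts by (rule Collect_restrict)
    with PX PA have "openin M P" unfolding op by (intro conjI)
    then show "openin M {m \<in> topspace M. g m \<in> U}" by (simp only: P_def)
  qed
  have "continuous_map (prod_topology X unit_interval) Y (g \<circ> R)"
    using R g by (rule continuous_map_compose)
  moreover have "\<forall>x\<in>topspace X. (g \<circ> R) (x, 0) = f x"
    using R0 by (simp add: g_def)
  moreover have "\<forall>a\<in>topspace A. \<forall>t\<in>{0..1}. (g \<circ> R) (i a, t) = H (a, t)"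
    using Ri gc by simp
  ultimately show "\<exists>K. continuous_map (prod_topology X unit_interval) Y K \<and>
            (\<forall>x\<in>topspace X. K (x, 0) = f x) \<and>
            (\<forall>a\<in>topspace A. \<forall>t\<in>{0..1}. K (i a, t) = H (a, t))"
    by blast
qed

definition closed_cofibration :: "'a topology \<Rightarrow> 'x topology \<Rightarrow> ('a \<Rightarrow> 'x) \<Rightarrow> bool"
  where "closed_cofibration A X i \<longleftrightarrow> cofibration A X i \<and> closedin X (i ` topspace A)"

definition locally_equiconnected :: "'a topology \<Rightarrow> bool"
  where "locally_equiconnected X \<longleftrightarrow> closed_cofibration X (prod_topology X X) (\<lambda>x. (x, x))"


section \<open>Good simplicial spaces\<close>

text \<open>
  The simplex category has objects \<open>{..n}\<close> and monotone maps as morphisms. A simplicial space is a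
  contravariant functor from it to spaces; \<open>F m n \<phi> : X n \<rightarrow> X m\<close> is the map induced by
  \<open>\<phi> : {..m} \<rightarrow> {..n}\<close>. Values of \<open>\<phi>\<close> outside \<open>{..m}\<close> are irrelevant.
\<close>

definition simplex_map :: "nat \<Rightarrow> nat \<Rightarrow> (nat \<Rightarrow> nat) \<Rightarrow> bool"
  where "simplex_map m n \<phi> \<longleftrightarrow> mono_on {..m} \<phi> \<and> \<phi> ` {..m} \<subseteq> {..n}"

locale simplicial_space =
  fixes X :: "nat \<Rightarrow> 'a topology"
    and F :: "nat \<Rightarrow> nat \<Rightarrow> (nat \<Rightarrow> nat) \<Rightarrow> 'a \<Rightarrow> 'a"
  assumes continuous:
      "simplex_map m n \<phi> \<Longrightarrow> continuous_map (X n) (X m) (F m n \<phi>)"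
    and restrict_cong:
      "\<lbrakk>simplex_map m n \<phi>; \<And>i. i \<le> m \<Longrightarrow> \<phi> i = \<psi> i; x \<in> topspace (X n)\<rbrakk>
        \<Longrightarrow> F m n \<phi> x = F m n \<psi> x"
    and identity: "x \<in> topspace (X n) \<Longrightarrow> F n n id x = x"
    and composite:
      "\<lbrakk>simplex_map l m \<psi>; simplex_map m n \<phi>; x \<in> topspace (X n)\<rbrakk>
        \<Longrightarrow> F l n (\<phi> \<circ> \<psi>) x = F l m \<psi> (F m n \<phi> x)"

definition codegeneracy :: "nat \<Rightarrow> nat \<Rightarrow> nat"
  where "codegeneracy i j = (if j \<le> i then j else j - 1)"

definition good_simplicial_space ::
    "(nat \<Rightarrow> 'a topology) \<Rightarrow> (nat \<Rightarrow> nat \<Rightarrow> (nat \<Rightarrow> nat) \<Rightarrow> 'a \<Rightarrow> 'a) \<Rightarrow> bool"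
  where "good_simplicial_space X F \<longleftrightarrow> simplicial_space X F \<and>
    (\<forall>n. \<forall>i\<le>n. closed_cofibration (X n) (X (Suc n)) (F (Suc n) n (codegeneracy i)))"


section \<open>Topological bicategories\<close>

record ('o, 'm, 'c) bicat =
  Obj :: "'o topology"
  Mor :: "'m topology"
  Cell :: "'c topology"
  src1 :: "'m \<Rightarrow> 'o"
  tgt1 :: "'m \<Rightarrow> 'o"
  src2 :: "'c \<Rightarrow> 'm"
  tgt2 :: "'c \<Rightarrow> 'm"
  id1 :: "'o \<Rightarrow> 'm"
  id2 :: "'m \<Rightarrow> 'c"
  vcomp :: "'c \<Rightarrow> 'c \<Rightarrow> 'c" (infixl "\<cdot>\<index>" 65)
  hcomp1 :: "'m \<Rightarrow> 'm \<Rightarrow> 'm" (infixl "\<star>\<index>" 70)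
  hcomp2 :: "'c \<Rightarrow> 'c \<Rightarrow> 'c" (infixl "\<diamondop>\<index>" 70)
  associator :: "'m \<Rightarrow> 'm \<Rightarrow> 'm \<Rightarrow> 'c"
  lunitor :: "'m \<Rightarrow> 'c"
  runitor :: "'m \<Rightarrow> 'c"

text \<open>
  All compositions are written in the order of functions: \<open>g \<star> f\<close> needs \<open>src1 g = tgt1 f\<close>,
  \<open>b \<cdot> a\<close> (vertical) needs \<open>src2 b = tgt2 a\<close>, and \<open>b \<diamondop> a\<close> (horizontal) needs
  \<open>src1 (src2 b) = tgt1 (src2 a)\<close>. Operations are unconstrained outside these domains. Horizontal
  composition of a 2-morphism with a 1-morphism \<open>f\<close> is horizontal composition with \<open>id2 f\<close>.
\<close>

definition is_vinverse :: "('o, 'm, 'c, 'z) bicat_scheme \<Rightarrow> 'c \<Rightarrow> 'c \<Rightarrow> bool"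
  where "is_vinverse C a b \<longleftrightarrow> b \<in> topspace (Cell C) \<and>
    src2 C b = tgt2 C a \<and> tgt2 C b = src2 C a \<and>
    b \<cdot>\<^bsub>C\<^esub> a = id2 C (src2 C a) \<and> a \<cdot>\<^bsub>C\<^esub> b = id2 C (tgt2 C a)"

definition vinvertible :: "('o, 'm, 'c, 'z) bicat_scheme \<Rightarrow> 'c \<Rightarrow> bool"
  where "vinvertible C a \<longleftrightarrow> (\<exists>b. is_vinverse C a b)"

definition vinv :: "('o, 'm, 'c, 'z) bicat_scheme \<Rightarrow> 'c \<Rightarrow> 'c"
  where "vinv C a = (THE b. is_vinverse C a b)"

locale bicategory =
  fixes C :: "('o, 'm, 'c, 'z) bicat_scheme" (structure)
  assumes src1: "f \<in> topspace (Mor C) \<Longrightarrow> src1 C f \<in> topspace (Obj C)"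
    and tgt1: "f \<in> topspace (Mor C) \<Longrightarrow> tgt1 C f \<in> topspace (Obj C)"
    and src2: "a \<in> topspace (Cell C) \<Longrightarrow> src2 C a \<in> topspace (Mor C)"
    and tgt2: "a \<in> topspace (Cell C) \<Longrightarrow> tgt2 C a \<in> topspace (Mor C)"
    and globular_src: "a \<in> topspace (Cell C) \<Longrightarrow> src1 C (tgt2 C a) = src1 C (src2 C a)"
    and globular_tgt: "a \<in> topspace (Cell C) \<Longrightarrow> tgt1 C (tgt2 C a) = tgt1 C (src2 C a)"
    and id1: "x \<in> topspace (Obj C) \<Longrightarrow>
      id1 C x \<in> topspace (Mor C) \<and> src1 C (id1 C x) = x \<and> tgt1 C (id1 C x) = x"
    and id2: "f \<in> topspace (Mor C) \<Longrightarrow>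
      id2 C f \<in> topspace (Cell C) \<and> src2 C (id2 C f) = f \<and> tgt2 C (id2 C f) = f"
    and vcomp: "\<lbrakk>a \<in> topspace (Cell C); b \<in> topspace (Cell C); src2 C b = tgt2 C a\<rbrakk> \<Longrightarrow>
      b \<cdot> a \<in> topspace (Cell C) \<and> src2 C (b \<cdot> a) = src2 C a \<and> tgt2 C (b \<cdot> a) = tgt2 C b"
    and vcomp_assoc: "\<lbrakk>a \<in> topspace (Cell C); b \<in> topspace (Cell C); c \<in> topspace (Cell C);
        src2 C b = tgt2 C a; src2 C c = tgt2 C b\<rbrakk> \<Longrightarrow> (c \<cdot> b) \<cdot> a = c \<cdot> (b \<cdot> a)"
    and vcomp_id_left: "a \<in> topspace (Cell C) \<Longrightarrow> id2 C (tgt2 C a) \<cdot> a = a"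
    and vcomp_id_right: "a \<in> topspace (Cell C) \<Longrightarrow> a \<cdot> id2 C (src2 C a) = a"
    and hcomp1: "\<lbrakk>f \<in> topspace (Mor C); g \<in> topspace (Mor C); src1 C g = tgt1 C f\<rbrakk> \<Longrightarrow>
      g \<star> f \<in> topspace (Mor C) \<and> src1 C (g \<star> f) = src1 C f \<and> tgt1 C (g \<star> f) = tgt1 C g"
    and hcomp2: "\<lbrakk>a \<in> topspace (Cell C); b \<in> topspace (Cell C);
        src1 C (src2 C b) = tgt1 C (src2 C a)\<rbrakk> \<Longrightarrow>
      b \<diamondop> a \<in> topspace (Cell C) \<and> src2 C (b \<diamondop> a) = src2 C b \<star> src2 C a \<and>
      tgt2 C (b \<diamondop> a) = tgt2 C b \<star> tgt2 C a"
    and hcomp_id: "\<lbrakk>f \<in> topspace (Mor C); g \<in> topspace (Mor C); src1 C g = tgt1 C f\<rbrakk> \<Longrightarrow>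
      id2 C g \<diamondop> id2 C f = id2 C (g \<star> f)"
    and interchange: "\<lbrakk>a \<in> topspace (Cell C); a' \<in> topspace (Cell C);
        b \<in> topspace (Cell C); b' \<in> topspace (Cell C);
        src2 C a' = tgt2 C a; src2 C b' = tgt2 C b;
        src1 C (src2 C b) = tgt1 C (src2 C a)\<rbrakk> \<Longrightarrow>
      (b' \<cdot> b) \<diamondop> (a' \<cdot> a) = (b' \<diamondop> a') \<cdot> (b \<diamondop> a)"
    and associator: "\<lbrakk>f \<in> topspace (Mor C); g \<in> topspace (Mor C); h \<in> topspace (Mor C);
        src1 C g = tgt1 C f; src1 C h = tgt1 C g\<rbrakk> \<Longrightarrow>
      associator C h g f \<in> topspace (Cell C) \<and>
      src2 C (associator C h g f) = h \<star> (g \<star> f) \<and>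
      tgt2 C (associator C h g f) = (h \<star> g) \<star> f \<and>
      vinvertible C (associator C h g f)"
    and lunitor: "f \<in> topspace (Mor C) \<Longrightarrow>
      lunitor C f \<in> topspace (Cell C) \<and> src2 C (lunitor C f) = id1 C (tgt1 C f) \<star> f \<and>
      tgt2 C (lunitor C f) = f \<and> vinvertible C (lunitor C f)"
    and runitor: "f \<in> topspace (Mor C) \<Longrightarrow>
      runitor C f \<in> topspace (Cell C) \<and> src2 C (runitor C f) = f \<star> id1 C (src1 C f) \<and>
      tgt2 C (runitor C f) = f \<and> vinvertible C (runitor C f)"
    and associator_natural: "\<lbrakk>a \<in> topspace (Cell C); b \<in> topspace (Cell C);
        c \<in> topspace (Cell C); src1 C (src2 C b) = tgt1 C (src2 C a);
        src1 C (src2 C c) = tgt1 C (src2 C b)\<rbrakk> \<Longrightarrow>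
      associator C (tgt2 C c) (tgt2 C b) (tgt2 C a) \<cdot> (c \<diamondop> (b \<diamondop> a)) =
      ((c \<diamondop> b) \<diamondop> a) \<cdot> associator C (src2 C c) (src2 C b) (src2 C a)"
    and lunitor_natural: "a \<in> topspace (Cell C) \<Longrightarrow>
      lunitor C (tgt2 C a) \<cdot> (id2 C (id1 C (tgt1 C (src2 C a))) \<diamondop> a) = a \<cdot> lunitor C (src2 C a)"
    and runitor_natural: "a \<in> topspace (Cell C) \<Longrightarrow>
      runitor C (tgt2 C a) \<cdot> (a \<diamondop> id2 C (id1 C (src1 C (src2 C a)))) = a \<cdot> runitor C (src2 C a)"
    and pentagon: "\<lbrakk>f \<in> topspace (Mor C); g \<in> topspace (Mor C); h \<in> topspace (Mor C);
        k \<in> topspace (Mor C); src1 C g = tgt1 C f; src1 C h = tgt1 C g; src1 C k = tgt1 C h\<rbrakk> \<Longrightarrow>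
      associator C (k \<star> h) g f \<cdot> associator C k h (g \<star> f) =
      (associator C k h g \<diamondop> id2 C f) \<cdot> associator C k (h \<star> g) f \<cdot>
        (id2 C k \<diamondop> associator C h g f)"
    and triangle: "\<lbrakk>f \<in> topspace (Mor C); g \<in> topspace (Mor C); src1 C g = tgt1 C f\<rbrakk> \<Longrightarrow>
      (runitor C g \<diamondop> id2 C f) \<cdot> associator C g (id1 C (tgt1 C f)) f =
      id2 C g \<diamondop> lunitor C f"

definition composable_mors :: "('o, 'm, 'c, 'z) bicat_scheme \<Rightarrow> ('m \<times> 'm) topology"
  where "composable_mors C =
    subtopology (prod_topology (Mor C) (Mor C)) {(g, f). src1 C g = tgt1 C f}"

definition composable_mor_triples :: "('o, 'm, 'c, 'z) bicat_scheme \<Rightarrow> ('m \<times> 'm \<times> 'm) topology"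
  where "composable_mor_triples C =
    subtopology (prod_topology (Mor C) (prod_topology (Mor C) (Mor C)))
      {(h, g, f). src1 C h = tgt1 C g \<and> src1 C g = tgt1 C f}"

definition vcomposable_cells :: "('o, 'm, 'c, 'z) bicat_scheme \<Rightarrow> ('c \<times> 'c) topology"
  where "vcomposable_cells C =
    subtopology (prod_topology (Cell C) (Cell C)) {(b, a). src2 C b = tgt2 C a}"

definition hcomposable_cells :: "('o, 'm, 'c, 'z) bicat_scheme \<Rightarrow> ('c \<times> 'c) topology"
  where "hcomposable_cells C =
    subtopology (prod_topology (Cell C) (Cell C)) {(b, a). src1 C (src2 C b) = tgt1 C (src2 C a)}"

text \<open>
  The coherence maps of a bicategory internal to spaces are isomorphisms internally, that is, their
  inverses are continuous as well.
\<close>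

locale topological_bicategory = bicategory +
  assumes continuous_src1: "continuous_map (Mor C) (Obj C) (src1 C)"
    and continuous_tgt1: "continuous_map (Mor C) (Obj C) (tgt1 C)"
    and continuous_src2: "continuous_map (Cell C) (Mor C) (src2 C)"
    and continuous_tgt2: "continuous_map (Cell C) (Mor C) (tgt2 C)"
    and continuous_id1: "continuous_map (Obj C) (Mor C) (id1 C)"
    and continuous_id2: "continuous_map (Mor C) (Cell C) (id2 C)"
    and continuous_vcomp: "continuous_map (vcomposable_cells C) (Cell C) (\<lambda>(b, a). b \<cdot> a)"
    and continuous_hcomp1: "continuous_map (composable_mors C) (Mor C) (\<lambda>(g, f). g \<star> f)"
    and continuous_hcomp2: "continuous_map (hcomposable_cells C) (Cell C) (\<lambda>(b, a). b \<diamondop> a)"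
    and continuous_associator:
      "continuous_map (composable_mor_triples C) (Cell C) (\<lambda>(h, g, f). associator C h g f)"
    and continuous_lunitor: "continuous_map (Mor C) (Cell C) (lunitor C)"
    and continuous_runitor: "continuous_map (Mor C) (Cell C) (runitor C)"
    and continuous_associator_inv:
      "continuous_map (composable_mor_triples C) (Cell C) (\<lambda>(h, g, f). vinv C (associator C h g f))"
    and continuous_lunitor_inv: "continuous_map (Mor C) (Cell C) (\<lambda>f. vinv C (lunitor C f))"
    and continuous_runitor_inv: "continuous_map (Mor C) (Cell C) (\<lambda>f. vinv C (runitor C f))"


section \<open>The geometric nerve\<close>

text \<open>
  An \<open>n\<close>-simplex is a triple of families \<open>(x\<^sub>i)\<close>, \<open>(x\<^sub>i\<^sub>j)\<close>, \<open>(x\<^sub>i\<^sub>j\<^sub>k)\<close>, indexed by the strictly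
  increasing tuples in \<open>{..n}\<close>.
\<close>

type_synonym ('o, 'm, 'c) nerve_simplex =
  "(nat \<Rightarrow> 'o) \<times> (nat \<times> nat \<Rightarrow> 'm) \<times> (nat \<times> nat \<times> nat \<Rightarrow> 'c)"

definition edges :: "nat \<Rightarrow> (nat \<times> nat) set"
  where "edges n = {(i, j). i < j \<and> j \<le> n}"

definition triangles :: "nat \<Rightarrow> (nat \<times> nat \<times> nat) set"
  where "triangles n = {(i, j, k). i < j \<and> j < k \<and> k \<le> n}"

definition nerve_simplices ::
    "('o, 'm, 'c, 'z) bicat_scheme \<Rightarrow> nat \<Rightarrow> ('o, 'm, 'c) nerve_simplex set"
  where "nerve_simplices C n = {(x, y, z).
    (\<forall>i j. i < j \<and> j \<le> n \<longrightarrow> src1 C (y (i, j)) = x i \<and> tgt1 C (y (i, j)) = x j) \<and>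
    (\<forall>i j k. i < j \<and> j < k \<and> k \<le> n \<longrightarrow>
      src2 C (z (i, j, k)) = y (i, k) \<and> tgt2 C (z (i, j, k)) = y (j, k) \<star>\<^bsub>C\<^esub> y (i, j)) \<and>
    (\<forall>i j k l. i < j \<and> j < k \<and> k < l \<and> l \<le> n \<longrightarrow>
      associator C (y (k, l)) (y (j, k)) (y (i, j)) \<cdot>\<^bsub>C\<^esub> (id2 C (y (k, l)) \<diamondop>\<^bsub>C\<^esub> z (i, j, k))
        \<cdot>\<^bsub>C\<^esub> z (i, k, l) =
      (z (j, k, l) \<diamondop>\<^bsub>C\<^esub> id2 C (y (i, j))) \<cdot>\<^bsub>C\<^esub> z (i, j, l))}"

definition nerve :: "('o, 'm, 'c, 'z) bicat_scheme \<Rightarrow> nat \<Rightarrow> ('o, 'm, 'c) nerve_simplex topology"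
  where "nerve C n =
    subtopology
      (prod_topology (product_topology (\<lambda>_. Obj C) {..n})
        (prod_topology (product_topology (\<lambda>_. Mor C) (edges n))
          (product_topology (\<lambda>_. Cell C) (triangles n))))
      (nerve_simplices C n)"

text \<open>
  The data of a simplex at weakly increasing indices: identities and unit isomorphisms are inserted
  where indices coincide. For \<open>i = j = k\<close> the two unit isomorphisms agree in every bicategory.
\<close>

definition edge_at ::
    "('o, 'm, 'c, 'z) bicat_scheme \<Rightarrow> ('o, 'm, 'c) nerve_simplex \<Rightarrow> nat \<Rightarrow> nat \<Rightarrow> 'm"
  where "edge_at C = (\<lambda>(x, y, z) i j. if i = j then id1 C (x i) else y (i, j))"

definition triangle_at ::
    "('o, 'm, 'c, 'z) bicat_scheme \<Rightarrow> ('o, 'm, 'c) nerve_simplex \<Rightarrow> nat \<Rightarrow> nat \<Rightarrow> nat \<Rightarrow> 'c"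
  where "triangle_at C = (\<lambda>(x, y, z) i j k.
    if i = j then vinv C (runitor C (edge_at C (x, y, z) i k))
    else if j = k then vinv C (lunitor C (edge_at C (x, y, z) i j))
    else z (i, j, k))"

definition nerve_map :: "('o, 'm, 'c, 'z) bicat_scheme \<Rightarrow> nat \<Rightarrow> nat \<Rightarrow> (nat \<Rightarrow> nat) \<Rightarrow>
    ('o, 'm, 'c) nerve_simplex \<Rightarrow> ('o, 'm, 'c) nerve_simplex"
  where "nerve_map C m n \<phi> s =
    (restrict (\<lambda>i. fst s (\<phi> i)) {..m},
     restrict (\<lambda>(i, j). edge_at C s (\<phi> i) (\<phi> j)) (edges m),
     restrict (\<lambda>(i, j, k). triangle_at C s (\<phi> i) (\<phi> j) (\<phi> k)) (triangles m))"

definition good_topological_bicategory :: "('o, 'm, 'c, 'z) bicat_scheme \<Rightarrow> bool"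
  where "good_topological_bicategory C \<longleftrightarrow> good_simplicial_space (nerve C) (nerve_map C)"

end

theory Submission
  imports Defs
begin

text \<open>
  A space that is locally equiconnected has the property that the inclusion of every retract is a
  closed cofibration. A degeneracy of a simplicial space is split by a face, so it suffices to show
  that each space \<open>\<Delta>2\<C>\<^sub>n\<close> of the nerve is locally equiconnected. This goes by induction on \<open>n\<close>:
  since 2-morphisms are invertible, the tetrahedron equations determine an \<open>(n+1)\<close>-simplex from its
  face on \<open>0, \<dots>, n\<close>, the edge \<open>x\<^sub>n\<^sub>,\<^sub>n\<^sub>+\<^sub>1\<close> and the triangles \<open>x\<^sub>i\<^sub>,\<^sub>n\<^sub>,\<^sub>n\<^sub>+\<^sub>1\<close>, and by the pentagon these
  data are subject to no further equations. Hence \<open>\<Delta>2\<C>\<^sub>n\<^sub>+\<^sub>1\<close> arises from \<open>\<Delta>2\<C>\<^sub>n\<close> by a pullback of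
  \<open>s\<^sub>1\<close> followed by a pullback of a power of \<open>t\<^sub>2\<close>, and locally equiconnected spaces are closed under
  pullback along Hurewicz fibrations.
\<close>

section \<open>Reparametrized homotopies\<close>

text \<open>A closed cofibration is unwieldy under pullback, so local equiconnectedness is traded
  for explicit data: a function \<open>u\<close> vanishing exactly on the diagonal, and paths
  \<open>L\<close> from x that reach y wherever \<open>u (x, y) < 1\<close> and are constant when x
  = y. Such data pass to retracts by a formula, and the same data turn retracts into closed
  cofibrations. The obstacle is the pullback: lifted paths must stay constant over constant paths,
  or points of the diagonal would move. This forces regular lifts, and the equiconnection of the
  base supplies the measure of length on which they depend.

  The two fibrations match the way a simplex grows. Once an edge f starting at the last vertex is
  chosen, a triangle on i, n, n+1 has a prescribed target, the composite of f with the edge from i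
  to n. Its source is free up to globularity and becomes the edge from i to n+1. Local
  equiconnectedness of \<open>Mor C\<close> and \<open>Obj C\<close> is inherited from
  \<open>Cell C\<close>, of which they are retracts through identities.\<close>

lemma continuous_map_prod_apply:
  assumes "continuous_map (prod_topology A B) Y F" "continuous_map X A f" "continuous_map X B g"
  shows "continuous_map X Y (\<lambda>x. F (f x, g x))"
  using continuous_map_compose[OF continuous_map_pairedI[OF assms(2,3)] assms(1)]
  by (simp add: o_def)

section \<open>Suprema over the unit interval\<close>

text \<open>Compactness of the interval. Since the supremum is attained, the comparisons below
  reduce to comparisons of single values of \<open>g\<close>, and boundedness never has to be
  discussed again.\<close>

lemma SUP_unit_interval_attained:
  fixes g :: "'a \<times> real \<Rightarrow> real"
  assumes g: "continuous_map (prod_topology X unit_interval) euclideanreal g" and x: "x \<in> topspace X"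
  obtains s where "s \<in> {0..1}" "(SUP t\<in>{0..1}. g (x, t)) = g (x, s)"
    "\<And>t. t \<in> {0..1} \<Longrightarrow> g (x, t) \<le> g (x, s)"
proof -
  have "continuous_map unit_interval euclideanreal (\<lambda>t. g (x, t))"
    using x by (intro continuous_map_prod_apply[OF g]) auto
  then have "continuous_on {0..1} (\<lambda>t. g (x, t))" by simp
  then have "\<exists>s\<in>{0..1}. \<forall>t\<in>{0..1}. g (x, t) \<le> g (x, s)"
    by (intro continuous_attains_sup) auto
  then obtain s where s: "s \<in> {0..1}" "\<And>t. t \<in> {0..1} \<Longrightarrow> g (x, t) \<le> g (x, s)"
    by blast
  moreover have "(SUP t\<in>{0..1}. g (x, t)) = g (x, s)"
    using s by (intro cSup_eq_maximum) auto
  ultimately show thesis using that by blast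
qed

lemma SUP_unit_interval_less_iff:
  fixes g :: "'a \<times> real \<Rightarrow> real"
  assumes "continuous_map (prod_topology X unit_interval) euclideanreal g" "x \<in> topspace X"
  shows "(SUP t\<in>{0..1}. g (x, t)) < a \<longleftrightarrow> (\<forall>t\<in>{0..1}. g (x, t) < a)"
  by (rule SUP_unit_interval_attained[OF assms]) (metis le_less_trans)

lemma SUP_unit_interval_eq_0_iff:
  fixes g :: "'a \<times> real \<Rightarrow> real"
  assumes "continuous_map (prod_topology X unit_interval) euclideanreal g" "x \<in> topspace X"
    and "\<And>t. t \<in> {0..1} \<Longrightarrow> 0 \<le> g (x, t)"
  shows "(SUP t\<in>{0..1}. g (x, t)) = 0 \<longleftrightarrow> (\<forall>t\<in>{0..1}. g (x, t) = 0)"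
  by (rule SUP_unit_interval_attained[OF assms(1,2)]) (metis assms(3) order_antisym)

lemma SUP_unit_interval_nonneg:
  fixes g :: "'a \<times> real \<Rightarrow> real"
  assumes "continuous_map (prod_topology X unit_interval) euclideanreal g" "x \<in> topspace X"
    and "\<And>t. t \<in> {0..1} \<Longrightarrow> 0 \<le> g (x, t)"
  shows "0 \<le> (SUP t\<in>{0..1}. g (x, t))"
  by (rule SUP_unit_interval_attained[OF assms(1,2)]) (metis assms(3))

text \<open>The two semicontinuities hold for different reasons. The set where the supremum exceeds
  a is the projection of an open set. The set where it is at least a is the projection of a closed
  set, and projecting along a compact factor is a closed map.\<close>

lemma continuous_map_SUP_unit_interval:
  fixes g :: "'a \<times> real \<Rightarrow> real"
  assumes g: "continuous_map (prod_topology X unit_interval) euclideanreal g"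
  shows "continuous_map X euclideanreal (\<lambda>x. SUP t\<in>{0..1}. g (x, t))"
proof -
  note SUP_lt = SUP_unit_interval_less_iff[OF g]
  have SUP_gt: "a < (SUP t\<in>{0..1}. g (x, t)) \<longleftrightarrow> (\<exists>t\<in>{0..1}. a < g (x, t))"
    if "x \<in> topspace X" for a x
    by (rule SUP_unit_interval_attained[OF g that]) (metis less_le_trans)
  show ?thesis
    unfolding continuous_map_upper_lower_semicontinuous_lt
  proof (intro conjI allI)
    fix a
    let ?G = "{z \<in> topspace (prod_topology X unit_interval). g z \<in> {a<..}}"
    have "openin (prod_topology X unit_interval) ?G"
      by (rule openin_continuous_map_preimage[OF g]) auto
    then have "openin X (fst ` ?G)" by (rule open_map_fst[unfolded open_map_def, rule_format])
    moreover have "fst ` ?G = {x \<in> topspace X. a < (SUP t\<in>{0..1}. g (x, t))}"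
      by (force simp: SUP_gt image_iff)
    ultimately show "openin X {x \<in> topspace X. a < (SUP t\<in>{0..1}. g (x, t))}" by simp
  next
    fix a
    let ?G = "{z \<in> topspace (prod_topology X unit_interval). g z \<in> {a..}}"
    have "closedin (prod_topology X unit_interval) ?G"
      by (rule closedin_continuous_map_preimage[OF g]) auto
    moreover have "closed_map (prod_topology X unit_interval) X fst"
      by (rule closed_map_fst) (simp add: compact_space_subtopology)
    ultimately have "closedin X (fst ` ?G)" by (simp add: closed_map_def)
    then have "openin X (topspace X - fst ` ?G)" by blast
    moreover have "topspace X - fst ` ?G = {x \<in> topspace X. (SUP t\<in>{0..1}. g (x, t)) < a}"
      by (force simp: SUP_lt image_iff not_less)
    ultimately show "openin X {x \<in> topspace X. (SUP t\<in>{0..1}. g (x, t)) < a}" by simp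
  qed
qed

text \<open>The tube lemma, read off from closedness of the projection along the interval.\<close>

lemma tube_unit_interval:
  assumes "openin (prod_topology X unit_interval) W" "x \<in> topspace X" "\<And>t. t \<in> {0..1} \<Longrightarrow> (x, t) \<in> W"
  obtains U where "openin X U" "x \<in> U" "U \<times> {0..1} \<subseteq> W"
proof -
  have "closedin (prod_topology X unit_interval) (topspace (prod_topology X unit_interval) - W)"
    using assms by blast
  moreover have "closed_map (prod_topology X unit_interval) X fst"
    by (rule closed_map_fst) (simp add: compact_space_subtopology)
  ultimately have "closedin X (fst ` (topspace (prod_topology X unit_interval) - W))"
    by (simp add: closed_map_def)
  then have "openin X (topspace X - fst ` (topspace (prod_topology X unit_interval) - W))" by blast
  moreover have "x \<in> topspace X - fst ` (topspace (prod_topology X unit_interval) - W)"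
    using assms by auto
  moreover have "(topspace X - fst ` (topspace (prod_topology X unit_interval) - W)) \<times> {0..1} \<subseteq> W"
    by (force simp: image_iff)
  ultimately show thesis by (rule that)
qed

lemma continuous_map_unit_interval_iff:
  "continuous_map X unit_interval f \<longleftrightarrow>
    continuous_map X euclideanreal f \<and> (\<forall>x\<in>topspace X. 0 \<le> f x \<and> f x \<le> 1)"
  by (auto simp: continuous_map_in_subtopology)

lemma continuous_map_unit_interval_real:
  assumes "continuous_map X unit_interval f"
  shows "continuous_map X euclideanreal f"
  using assms by (simp add: continuous_map_in_subtopology)

text \<open>The quotient \<open>t / d x\<close> need not extend continuously to the zeros of
  \<open>d\<close>. At such a zero, however, \<open>H (x, _)\<close> is constant, so by the tube
  lemma the whole of \<open>H (y, _)\<close> stays in a given neighbourhood of its value for y near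
  x, whichever parameter the quotient selects. At the zero itself, division by zero gives parameter
  0.\<close>

lemma continuous_map_reparametrization:
  assumes H: "continuous_map (prod_topology X unit_interval) Y H"
    and d: "continuous_map X euclideanreal d"
    and nonneg: "\<And>x. x \<in> topspace X \<Longrightarrow> 0 \<le> d x"
    and const: "\<And>x t. x \<in> topspace X \<Longrightarrow> d x = 0 \<Longrightarrow> t \<in> {0..1} \<Longrightarrow> H (x, t) = H (x, 0)"
  shows "continuous_map (prod_topology X unit_interval) Y (\<lambda>(x, t). H (x, min 1 (t / d x)))"
proof -
  let ?P = "prod_topology X unit_interval"
  have r: "min 1 (t / d x) \<in> {0..1}" if "x \<in> topspace X" "t \<in> {0..1}" for x t
    using that nonneg by auto
  have open_pos: "openin ?P ({x \<in> topspace X. d x \<in> {0<..}} \<times> {0..1})"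
    using openin_continuous_map_preimage[OF d, of "{0<..}"]
    by (simp add: openin_prod_Times_iff openin_subtopology_self)
  let ?O = "{x \<in> topspace X. d x \<in> {0<..}} \<times> {0..1::real}"
  have "continuous_map (subtopology ?P ?O) euclideanreal (\<lambda>z. snd z / d (fst z))"
    by (intro continuous_map_real_divide continuous_map_from_subtopology
        continuous_map_compose[OF continuous_map_fst d, unfolded o_def]
        continuous_map_unit_interval_real[OF continuous_map_snd]) auto
  then have "continuous_map (subtopology ?P ?O) unit_interval (\<lambda>z. min 1 (snd z / d (fst z)))"
    using r by (auto simp: continuous_map_unit_interval_iff intro!: continuous_map_real_min)
  then have "continuous_map (subtopology ?P ?O) ?P (\<lambda>z. (fst z, min 1 (snd z / d (fst z))))"
    by (rule continuous_map_pairedI[OF continuous_map_from_subtopology[OF continuous_map_fst]])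
  from continuous_map_compose[OF this H]
  have cO: "continuous_map (subtopology ?P ?O) Y (\<lambda>(x, t). H (x, min 1 (t / d x)))"
    by (simp add: o_def case_prod_unfold)
  show ?thesis
    unfolding continuous_map_def
  proof (intro conjI allI impI)
    show "(\<lambda>(x, t). H (x, min 1 (t / d x))) \<in> topspace ?P \<rightarrow> topspace Y"
      using r continuous_map_funspace[OF H] by (auto simp: Pi_iff)
    fix V assume V: "openin Y V"
    let ?S = "{z \<in> topspace ?P. (case z of (x, t) \<Rightarrow> H (x, min 1 (t / d x))) \<in> V}"
    have "\<exists>T. openin ?P T \<and> z \<in> T \<and> T \<subseteq> ?S" if z: "z \<in> ?S" for z
    proof -
      obtain x t where xt: "z = (x, t)" "x \<in> topspace X" "t \<in> {0..1}" "H (x, min 1 (t / d x)) \<in> V"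
        using z by auto
      show ?thesis
      proof (cases "d x = 0")
        case True
        define W where "W = {z \<in> topspace ?P. H z \<in> V}"
        have "openin ?P W" unfolding W_def by (rule openin_continuous_map_preimage[OF H V])
        moreover have "(x, s) \<in> W" if "s \<in> {0..1}" for s :: real
          using const[OF xt(2) True that] xt True that by (auto simp: W_def)
        ultimately obtain U where U: "openin X U" "x \<in> U" "U \<times> {0..1} \<subseteq> W"
          using tube_unit_interval xt(2) by metis
        have "openin ?P (U \<times> {0..1})"
          using U by (simp add: openin_prod_Times_iff openin_subtopology_self)
        moreover have "U \<times> {0..1} \<subseteq> ?S"
        proof
          fix w assume "w \<in> U \<times> {0..1::real}"
          then obtain y s where w: "w = (y, s)" "y \<in> U" "s \<in> {0..1}" by blast
          then have "y \<in> topspace X" using openin_subset[OF U(1)] by blast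
          then have "(y, min 1 (s / d y)) \<in> W" using r[OF _ w(3)] w(2) U(3) by blast
          then show "w \<in> ?S" using \<open>y \<in> topspace X\<close> w by (simp add: W_def)
        qed
        ultimately show ?thesis using xt U by blast
      next
        case False
        let ?T = "{z \<in> topspace (subtopology ?P ?O). (case z of (x, t) \<Rightarrow> H (x, min 1 (t / d x))) \<in> V}"
        have "openin (subtopology ?P ?O) ?T"
          by (rule openin_continuous_map_preimage[OF cO V])
        then have "openin ?P ?T" using open_pos by (simp add: openin_open_subtopology)
        moreover have "z \<in> ?T" using xt nonneg[OF xt(2)] False by auto
        ultimately show ?thesis by (intro exI[of _ ?T]) auto
      qed
    qed
    then show "openin ?P ?S" by (subst openin_subopen) blast
  qed
qed

section \<open>Equiconnections\<close>

text \<open>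
  Both functions are total: \<open>L ((x, y), _)\<close> is a path starting at \<open>x\<close>, but it needs to arrive at \<open>y\<close> only
  where \<open>u < 1\<close>. This avoids working on a neighbourhood of the diagonal.
\<close>

definition equiconnection :: "'a topology \<Rightarrow> ('a \<times> 'a \<Rightarrow> real) \<Rightarrow> (('a \<times> 'a) \<times> real \<Rightarrow> 'a) \<Rightarrow> bool"
  where "equiconnection X u L \<longleftrightarrow>
    continuous_map (prod_topology X X) euclideanreal u \<and>
    continuous_map (prod_topology (prod_topology X X) unit_interval) X L \<and>
    (\<forall>x\<in>topspace X. \<forall>y\<in>topspace X.
      0 \<le> u (x, y) \<and> (u (x, y) = 0 \<longleftrightarrow> x = y) \<and> L ((x, y), 0) = x \<and>
      (u (x, y) < 1 \<longrightarrow> L ((x, y), 1) = y)) \<and>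
    (\<forall>x\<in>topspace X. \<forall>t\<in>{0..1}. L ((x, x), t) = x)"

text \<open>
  The concatenation of the paths \<open>a (z, _)\<close> and \<open>b (z, _)\<close>, which need to be composable only where
  \<open>u z < 1\<close>; where \<open>u z \<ge> 2 / 3\<close> the damping factor stops the path at its starting point.
\<close>

definition damped_join ::
    "('z \<Rightarrow> real) \<Rightarrow> ('z \<times> real \<Rightarrow> 'w) \<Rightarrow> ('z \<times> real \<Rightarrow> 'w) \<Rightarrow> 'z \<times> real \<Rightarrow> 'w"
  where "damped_join u a b = (\<lambda>(z, t). let s = t * max 0 (min 1 (2 - 3 * u z)) in
    if s \<le> 1 / 2 then a (z, min 1 (2 * s)) else b (z, max 0 (2 * s - 1)))"

lemma damped_join_0: "damped_join u a b (z, 0) = a (z, 0)"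
  by (simp add: damped_join_def)

text \<open>For u \<le> 1/3 the damping factor is 1. This is why equiconnections built from a join
  carry \<open>3 * u\<close>: wherever that function is below 1, the joined path is run to its
  end.\<close>

lemma damped_join_1: "u z \<le> 1 / 3 \<Longrightarrow> damped_join u a b (z, 1) = b (z, 1)"
  by (simp add: damped_join_def)

text \<open>Serves to check properties of all points of a joined path, such as lying in a subspace
  or being constant, without unfolding the reparametrization.\<close>

lemma damped_join_cases:
  assumes "t \<in> {0..1}"
  obtains s where "s \<in> {0..1}" "damped_join u a b (z, t) = a (z, s)"
  | s where "s \<in> {0..1}" "u z < 1" "damped_join u a b (z, t) = b (z, s)"
proof -
  define s where "s = t * max 0 (min 1 (2 - 3 * u z))"
  have s: "0 \<le> s" "s \<le> 1"
    using assms by (auto simp: s_def intro!: mult_le_one)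
  show thesis
  proof (cases "s \<le> 1 / 2")
    case True
    then show ?thesis
      using s by (intro that(1)[of "min 1 (2 * s)"]) (auto simp: damped_join_def Let_def s_def)
  next
    case False
    moreover have "u z < 1"
    proof (rule ccontr)
      assume "\<not> u z < 1"
      then have "s = 0" by (simp add: s_def max_def)
      with False show False by simp
    qed
    ultimately show ?thesis
      using s by (intro that(2)[of "max 0 (2 * s - 1)"]) (auto simp: damped_join_def Let_def s_def)
  qed
qed

lemma continuous_map_damped_join:
  assumes u: "continuous_map Z euclideanreal u"
    and a: "continuous_map (prod_topology Z unit_interval) W a"
    and b: "continuous_map (prod_topology Z unit_interval) W b"
    and ab: "\<And>z. z \<in> topspace Z \<Longrightarrow> u z < 1 \<Longrightarrow> a (z, 1) = b (z, 0)"
  shows "continuous_map (prod_topology Z unit_interval) W (damped_join u a b)"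
proof -
  let ?P = "prod_topology Z unit_interval"
  define s where "s z = snd z * max 0 (min 1 (2 - 3 * u (fst z)))" for z :: "'a \<times> real"
  have cu: "continuous_map ?P euclideanreal (\<lambda>z. u (fst z))"
    by (rule continuous_map_compose[OF continuous_map_fst u, unfolded o_def])
  have ct: "continuous_map ?P euclideanreal snd"
    by (rule continuous_map_unit_interval_real[OF continuous_map_snd])
  have s: "continuous_map ?P euclideanreal s"
    unfolding s_def by (intro continuous_intros cu ct)
  have sI: "0 \<le> s z" "s z \<le> 1" if "z \<in> topspace ?P" for z
    using that by (auto simp: s_def intro!: mult_le_one)
  have 1: "continuous_map ?P unit_interval (\<lambda>z. min 1 (2 * s z))"
    using sI unfolding continuous_map_unit_interval_iff
    by (auto intro!: continuous_map_real_min continuous_map_real_mult s)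
  have 2: "continuous_map ?P unit_interval (\<lambda>z. max 0 (2 * s z - 1))"
    using sI unfolding continuous_map_unit_interval_iff
    by (auto intro!: continuous_map_real_max continuous_map_real_mult continuous_map_diff s)
  have "continuous_map ?P W (\<lambda>z. if s z \<le> 1 / 2 then a (fst z, min 1 (2 * s z))
      else b (fst z, max 0 (2 * s z - 1)))"
  proof (rule continuous_map_cases_le[OF s _
        continuous_map_from_subtopology[OF continuous_map_prod_apply[OF a continuous_map_fst 1]]
        continuous_map_from_subtopology[OF continuous_map_prod_apply[OF b continuous_map_fst 2]]])
    fix z assume z: "z \<in> topspace ?P" and eq: "s z = 1 / 2"
    \<comment> \<open>Time 1/2, where the halves meet, is reached only if the damping factor is
      nonzero. So the paths have to match only where \<open>ab\<close> makes them match.\<close>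
    have "u (fst z) < 1"
    proof (rule ccontr)
      assume "\<not> u (fst z) < 1"
      then have "s z = 0" by (simp add: s_def max_def)
      with eq show False by simp
    qed
    then show "a (fst z, min 1 (2 * s z)) = b (fst z, max 0 (2 * s z - 1))" using ab z eq by auto
  qed simp
  then show ?thesis
    by (rule continuous_map_eq) (auto simp: damped_join_def s_def Let_def)
qed

text \<open>Strom's argument. Homotopy extension into \<open>?Y\<close>, the union of the bottom of
  the cylinder over X x X and the cylinder over the diagonal, yields a map \<open>R\<close> from the
  whole cylinder to \<open>?Y\<close> that is the identity on \<open>?Y\<close>. The function
  \<open>u\<close> measures how far \<open>R\<close> shifts time. If \<open>u z < 1\<close>, then
  \<open>R (z, 1)\<close> has nonzero time and therefore lies over the diagonal: the first
  coordinate leads from x to some point, and the second coordinate, run backwards, leads from the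
  same point to y.\<close>

lemma locally_equiconnected_imp_equiconnection:
  assumes "locally_equiconnected X"
  obtains u L where "equiconnection X u L"
proof -
  let ?XX = "prod_topology X X"
  let ?S = "{(z :: 'a \<times> 'a, t :: real). t = 0 \<or> fst z = snd z}"
  let ?Y = "subtopology (prod_topology ?XX unit_interval) ?S"
  have cof: "cofibration X ?XX (\<lambda>x. (x, x))"
    and clo: "closedin ?XX ((\<lambda>x. (x, x)) ` topspace X)"
    using assms by (auto simp: locally_equiconnected_def closed_cofibration_def)
  have "continuous_map ?XX ?Y (\<lambda>z. (z, 0))"
    by (auto simp: continuous_map_in_subtopology continuous_map_pairwise o_def)
  moreover have "continuous_map (prod_topology X unit_interval) ?Y (\<lambda>z. ((fst z, fst z), snd z))"
    by (auto simp: continuous_map_in_subtopology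
        intro!: continuous_map_pairedI continuous_map_fst continuous_map_snd)
  moreover have "\<forall>x\<in>topspace X. ((fst (x, 0), fst (x, 0)), snd (x, 0)) = ((x, x), 0)" by simp
  ultimately have "\<exists>R. continuous_map (prod_topology ?XX unit_interval) ?Y R \<and>
      (\<forall>z\<in>topspace ?XX. R (z, 0) = (z, 0)) \<and>
      (\<forall>x\<in>topspace X. \<forall>t\<in>{0..1}. R ((x, x), t) = ((fst (x, t), fst (x, t)), snd (x, t)))"
    by (intro cofibration_extension[OF cof, of ?Y, unfolded homotopy_extension_def, rule_format]) auto
  then obtain R where R: "continuous_map (prod_topology ?XX unit_interval) ?Y R"
    and R0: "\<And>z. z \<in> topspace ?XX \<Longrightarrow> R (z, 0) = (z, 0)"
    and Rd: "\<And>x t. x \<in> topspace X \<Longrightarrow> t \<in> {0..1} \<Longrightarrow> R ((x, x), t) = ((x, x), t)"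
    by auto
  have R': "continuous_map (prod_topology ?XX unit_interval) (prod_topology ?XX unit_interval) R"
    and RS': "R \<in> topspace (prod_topology ?XX unit_interval) \<rightarrow> ?S"
    using R by (auto simp: continuous_map_in_subtopology simp del: topspace_prod_topology)
  have RS: "\<And>z. z \<in> topspace (prod_topology ?XX unit_interval) \<Longrightarrow> R z \<in> ?S"
    by (rule funcset_mem[OF RS'])
  have R1: "continuous_map (prod_topology ?XX unit_interval) ?XX (\<lambda>z. fst (R z))"
    and R2: "continuous_map (prod_topology ?XX unit_interval) euclideanreal (\<lambda>z. snd (R z))"
    using continuous_map_fst_of[OF R'] continuous_map_unit_interval_real[OF continuous_map_snd_of[OF R']]
    by (simp_all add: o_def)
  define g where "g z = \<bar>snd z - snd (R z)\<bar>" for z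
  define u where "u z = (SUP t\<in>{0..1}. g (z, t))" for z
  have g: "continuous_map (prod_topology ?XX unit_interval) euclideanreal g"
    unfolding g_def
    by (intro continuous_map_real_abs continuous_map_diff R2
        continuous_map_unit_interval_real[OF continuous_map_snd])
  have u: "continuous_map ?XX euclideanreal u"
    unfolding u_def by (rule continuous_map_SUP_unit_interval[OF g])
  define a where "a z = fst (fst (R z))" for z
  define b where "b z = snd (fst (R (fst z, 1 - snd z)))" for z
  have a: "continuous_map (prod_topology ?XX unit_interval) X a"
    using continuous_map_fst_of[OF R1] by (simp add: a_def[abs_def] o_def)
  have flip: "continuous_map (prod_topology ?XX unit_interval) unit_interval (\<lambda>z. 1 - snd z)"
    by (auto simp: continuous_map_unit_interval_iff
        intro!: continuous_map_diff continuous_map_unit_interval_real[OF continuous_map_snd])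
  have b: "continuous_map (prod_topology ?XX unit_interval) X b"
    using continuous_map_snd_of[OF continuous_map_prod_apply[OF R1 continuous_map_fst flip]]
    by (simp add: b_def[abs_def] o_def)
  have g_less: "g (z, t) < 1" if "u z < 1" "z \<in> topspace ?XX" "t \<in> {0..1}" for z t
    using SUP_unit_interval_less_iff[OF g] that by (auto simp: u_def)
  have ab: "a (z, 1) = b (z, 0)" if z: "z \<in> topspace ?XX" "u z < 1" for z
  proof -
    have "g (z, 1) < 1" using g_less that by auto
    then have "snd (R (z, 1)) \<noteq> 0" by (auto simp: g_def)
    then show ?thesis using RS[of "(z, 1)"] z by (auto simp: a_def b_def case_prod_unfold)
  qed
  have u_diag: "u (x, y) = 0 \<longleftrightarrow> x = y" if xy: "x \<in> topspace X" "y \<in> topspace X" for x y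
  proof
    assume "x = y"
    then have "g ((x, y), t) = 0" if "t \<in> {0..1}" for t
      using that Rd xy by (simp add: g_def)
    then show "u (x, y) = 0" by (simp add: u_def)
  next
    assume "u (x, y) = 0"
    then have g0: "g ((x, y), t) = 0" if "t \<in> {0..1}" for t
      using SUP_unit_interval_eq_0_iff[OF g, of "(x, y)"] xy that by (auto simp: u_def g_def)
    have c: "continuous_map unit_interval ?XX (\<lambda>t. fst (R ((x, y), t)))"
      using xy by (intro continuous_map_prod_apply[OF R1]) auto
    \<comment> \<open>If \<open>u (x, y) = 0\<close>, then \<open>R\<close> preserves time, so at
      positive times it lies over the diagonal. Closedness of the diagonal extends this to time 0,
      where the point over which \<open>R\<close> lies is (x, y) itself.\<close>
    let ?D = "{t \<in> topspace unit_interval. fst (R ((x, y), t)) \<in> (\<lambda>x. (x, x)) ` topspace X}"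
    have "closedin unit_interval ?D" by (rule closedin_continuous_map_preimage[OF c clo])
    then have "closed ?D" by (rule closedin_closed_trans) auto
    have "t \<in> ?D" if t: "t \<in> {0<..<1}" for t
    proof -
      have "snd (R ((x, y), t)) = t" using g0[of t] t by (simp add: g_def)
      then have "fst (fst (R ((x, y), t))) = snd (fst (R ((x, y), t)))"
        using RS[of "((x, y), t)"] t xy by (auto simp: case_prod_unfold)
      moreover have "fst (R ((x, y), t)) \<in> topspace ?XX"
        using continuous_map_funspace[OF c] t by (auto simp: Pi_iff)
      ultimately show ?thesis using t by (auto simp: image_iff prod_eq_iff)
    qed
    then have "closure {0<..<1} \<subseteq> ?D"
      using \<open>closed ?D\<close> by (intro closure_minimal) auto
    then have "0 \<in> ?D" by (rule subsetD) simp
    then show "x = y" using R0[of "(x, y)"] xy by auto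
  qed
  have "equiconnection X (\<lambda>z. 3 * u z) (damped_join u a b)"
    unfolding equiconnection_def
  proof (intro conjI ballI impI)
    show "continuous_map ?XX euclideanreal (\<lambda>z. 3 * u z)"
      by (intro continuous_map_real_mult u) auto
    show "continuous_map (prod_topology ?XX unit_interval) X (damped_join u a b)"
      by (rule continuous_map_damped_join[OF u a b ab])
  next
    fix x y assume xy: "x \<in> topspace X" "y \<in> topspace X"
    show "0 \<le> 3 * u (x, y)"
      using SUP_unit_interval_nonneg[OF g, of "(x, y)"] xy by (simp add: u_def g_def)
    show "3 * u (x, y) = 0 \<longleftrightarrow> x = y" using u_diag[OF xy] by simp
    show "damped_join u a b ((x, y), 0) = x" using R0[of "(x, y)"] xy by (simp add: damped_join_0 a_def)
    assume "3 * u (x, y) < 1"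
    then show "damped_join u a b ((x, y), 1) = y"
      using R0[of "(x, y)"] xy by (simp add: damped_join_1 b_def)
  next
    fix x and t :: real assume x: "x \<in> topspace X" and t: "t \<in> {0..1}"
    show "damped_join u a b ((x, x), t) = x"
      by (rule damped_join_cases[OF t, of u a b "(x, x)"]) (use Rd[OF x] in \<open>auto simp: a_def b_def\<close>)
  qed
  then show thesis by (rule that)
qed

lemma equiconnectionD:
  assumes "equiconnection X u L"
  shows "continuous_map (prod_topology X X) euclideanreal u"
    and "continuous_map (prod_topology (prod_topology X X) unit_interval) X L"
    and "\<And>x y. x \<in> topspace X \<Longrightarrow> y \<in> topspace X \<Longrightarrow> 0 \<le> u (x, y)"
    and "\<And>x y. x \<in> topspace X \<Longrightarrow> y \<in> topspace X \<Longrightarrow> u (x, y) = 0 \<longleftrightarrow> x = y"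
    and "\<And>x y. x \<in> topspace X \<Longrightarrow> y \<in> topspace X \<Longrightarrow> L ((x, y), 0) = x"
    and "\<And>x y. x \<in> topspace X \<Longrightarrow> y \<in> topspace X \<Longrightarrow> u (x, y) < 1 \<Longrightarrow> L ((x, y), 1) = y"
    and "\<And>x t. x \<in> topspace X \<Longrightarrow> t \<in> {0..1} \<Longrightarrow> L ((x, x), t) = x"
  using assms unfolding equiconnection_def by blast+

section \<open>Retracts and closed cofibrations\<close>

text \<open>Used with \<open>id2\<close> and \<open>id1\<close> as sections of the source maps, and
  to pass from an iterated pullback to the nerve.\<close>

lemma equiconnection_retract:
  assumes uL: "equiconnection X u L"
    and i: "continuous_map A X i" and r: "continuous_map X A r"
    and ri: "\<And>a. a \<in> topspace A \<Longrightarrow> r (i a) = a"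
  shows "equiconnection A (\<lambda>(a, b). u (i a, i b)) (\<lambda>((a, b), t). r (L ((i a, i b), t)))"
proof -
  note uLD = equiconnectionD[OF uL]
  have iX: "i a \<in> topspace X" if "a \<in> topspace A" for a
    using i that by (auto simp: continuous_map_def)
  have inj: "i a = i b \<longleftrightarrow> a = b" if "a \<in> topspace A" "b \<in> topspace A" for a b
    using ri that by metis
  have ii: "continuous_map (prod_topology A A) (prod_topology X X) (\<lambda>z. (i (fst z), i (snd z)))"
    by (intro continuous_map_pairedI continuous_map_compose[OF _ i, unfolded o_def]
        continuous_map_fst continuous_map_snd)
  have ii': "continuous_map (prod_topology (prod_topology A A) unit_interval) (prod_topology X X)
      (\<lambda>z. (i (fst (fst z)), i (snd (fst z))))"
    using continuous_map_compose[OF continuous_map_fst ii] by (simp add: o_def)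
  have "continuous_map (prod_topology A A) euclideanreal (\<lambda>(a, b). u (i a, i b))"
    using continuous_map_compose[OF ii uLD(1)] by (simp add: o_def case_prod_unfold)
  moreover have "continuous_map (prod_topology (prod_topology A A) unit_interval) A
      (\<lambda>((a, b), t). r (L ((i a, i b), t)))"
    using continuous_map_compose[OF continuous_map_prod_apply[OF uLD(2) ii' continuous_map_snd] r]
    by (simp add: o_def case_prod_unfold)
  ultimately show ?thesis
    unfolding equiconnection_def by (simp add: iX uLD inj ri)
qed

text \<open>The path \<open>c (x, _)\<close> leads from x to \<open>s (r x)\<close> when
  \<open>w x\<close> is small. A homotopy is extended by following \<open>f\<close> along this path
  during the time \<open>w x\<close>, and then the given homotopy at \<open>r x\<close> for the
  remaining time. The image of \<open>s\<close> is the zero set of \<open>w\<close>, hence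
  closed.\<close>

lemma equiconnection_retract_closed_cofibration:
  fixes A :: "'a topology" and X :: "'x topology"
  assumes uL: "equiconnection X u L"
    and s: "continuous_map A X s" and r: "continuous_map X A r"
    and rs: "\<And>a. a \<in> topspace A \<Longrightarrow> r (s a) = a"
  shows "closed_cofibration A X s"
proof -
  note uLD = equiconnectionD[OF uL]
  have sX: "s a \<in> topspace X" if "a \<in> topspace A" for a
    using s that by (auto simp: continuous_map_def)
  have rA: "r x \<in> topspace A" if "x \<in> topspace X" for x
    using r that by (auto simp: continuous_map_def)
  \<comment> \<open>The factor 2 leaves room: the switch occurs at a time \<open>w x\<close> \<le>
    1, so there \<open>u (x, s (r x))\<close> \<le> 1/2 and the path has indeed arrived at
    \<open>s (r x)\<close>.\<close>
  define w where "w x = 2 * u (x, s (r x))" for x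
  define c where "c z = L ((fst z, s (r (fst z))), snd z)" for z
  have sr: "continuous_map X X (\<lambda>x. s (r x))"
    using continuous_map_compose[OF r s] by (simp add: o_def)
  have w: "continuous_map X euclideanreal w"
    unfolding w_def
    by (intro continuous_map_real_mult continuous_map_prod_apply[OF uLD(1)] sr) auto
  have "continuous_map (prod_topology X unit_interval) (prod_topology X X) (\<lambda>z. (fst z, s (r (fst z))))"
    by (intro continuous_map_pairedI continuous_map_fst
        continuous_map_compose[OF continuous_map_fst sr, unfolded o_def])
  from continuous_map_prod_apply[OF uLD(2) this continuous_map_snd]
  have c: "continuous_map (prod_topology X unit_interval) X c" by (simp add: c_def[abs_def])
  have w_nonneg: "0 \<le> w x" if "x \<in> topspace X" for x
    using uLD(3) sX rA that by (simp add: w_def)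
  have w_0: "w x = 0 \<longleftrightarrow> x = s (r x)" if "x \<in> topspace X" for x
    using uLD(4)[OF that sX[OF rA[OF that]]] by (simp add: w_def)
  have c_0: "c (x, 0) = x" if "x \<in> topspace X" for x
    using uLD(5) sX rA that by (simp add: c_def)
  have c_1: "c (x, 1) = s (r x)" if "x \<in> topspace X" "w x < 2" for x
    using uLD(6) sX rA that by (simp add: w_def c_def)
  have c_const: "c (x, t) = x" if "x \<in> topspace X" "w x = 0" "t \<in> {0..1}" for x t
    using that w_0[OF that(1)] uLD(7) by (simp add: c_def)
  have image: "s ` topspace A = {x \<in> topspace X. w x \<in> {0}}"
  proof (intro set_eqI iffI)
    fix x assume "x \<in> {x \<in> topspace X. w x \<in> {0}}"
    then have "x = s (r x)" "r x \<in> topspace A" using w_0 rA by auto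
    then show "x \<in> s ` topspace A" by (rule image_eqI)
  qed (use sX rs w_0 in auto)
  have "closedin X (s ` topspace A)"
    unfolding image by (rule closedin_continuous_map_preimage[OF w]) auto
  moreover have "homotopy_extension A X s Y" for Y :: "('x + 'a \<times> real) topology"
    unfolding homotopy_extension_def
  proof (intro allI impI, elim conjE)
    fix f H
    assume f: "continuous_map X Y f" and H: "continuous_map (prod_topology A unit_interval) Y H"
      and H0: "\<forall>a\<in>topspace A. H (a, 0) = f (s a)"
    let ?P = "prod_topology X unit_interval"
    define K where "K z = (if snd z \<le> w (fst z) then f (c (fst z, min 1 (snd z / w (fst z))))
        else H (r (fst z), max 0 (snd z - w (fst z))))" for z
    have ct: "continuous_map ?P euclideanreal snd"
      by (rule continuous_map_unit_interval_real[OF continuous_map_snd])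
    have wf: "continuous_map ?P euclideanreal (\<lambda>z. w (fst z))"
      using continuous_map_compose[OF continuous_map_fst w] by (simp add: o_def)
    have rf: "continuous_map ?P A (\<lambda>z. r (fst z))"
      using continuous_map_compose[OF continuous_map_fst r] by (simp add: o_def)
    have m: "continuous_map ?P unit_interval (\<lambda>z. max 0 (snd z - w (fst z)))"
      using w_nonneg unfolding continuous_map_unit_interval_iff
      by (auto intro!: continuous_map_real_max continuous_map_diff ct wf
          simp: add_increasing2 diff_le_eq)
    have 1: "continuous_map ?P Y (\<lambda>z. f (c (fst z, min 1 (snd z / w (fst z)))))"
      using continuous_map_compose[OF continuous_map_reparametrization[OF c w w_nonneg] f] c_const
      by (simp add: o_def case_prod_unfold)
    have 2: "continuous_map ?P Y (\<lambda>z. H (r (fst z), max 0 (snd z - w (fst z))))"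
      by (rule continuous_map_prod_apply[OF H rf m])
    have glue: "f (c (fst z, min 1 (snd z / w (fst z)))) = H (r (fst z), max 0 (snd z - w (fst z)))"
      if z: "z \<in> topspace ?P" and eq: "snd z = w (fst z)" for z
    proof -
      have x: "fst z \<in> topspace X" and "w (fst z) < 2" using z eq by auto
      then have "c (fst z, min 1 (snd z / w (fst z))) = s (r (fst z))"
        using c_1[OF x] c_0[OF x] w_0[OF x] eq by (cases "w (fst z) = 0") auto
      then show ?thesis using H0 rA[OF x] eq by simp
    qed
    have "continuous_map ?P Y K"
      unfolding K_def
      by (rule continuous_map_cases_le[OF ct wf continuous_map_from_subtopology[OF 1]
            continuous_map_from_subtopology[OF 2] glue])
    moreover have "\<forall>x\<in>topspace X. K (x, 0) = f x"
      using w_nonneg c_0 by (simp add: K_def)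
    moreover have "K (s a, t) = H (a, t)" if a: "a \<in> topspace A" and t: "t \<in> {0..1}" for a t
    proof -
      have "w (s a) = 0" using w_0[OF sX[OF a]] rs[OF a] by simp
      then show ?thesis
        using a t H0 rs[OF a] c_0[OF sX[OF a]] by (cases "t = 0") (auto simp: K_def)
    qed
    ultimately show "\<exists>K. continuous_map ?P Y K \<and> (\<forall>x\<in>topspace X. K (x, 0) = f x) \<and>
            (\<forall>a\<in>topspace A. \<forall>t\<in>{0..1}. K (s a, t) = H (a, t))"
      by blast
  qed
  ultimately show ?thesis
    unfolding closed_cofibration_def cofibration_def using s by blast
qed

text \<open>
  Hurewicz's argument: a function vanishing exactly on the diagonal of the base measures how far a
  path is from being constant, and reparametrizing paths by it makes the lifts of constant paths
  constant.
\<close>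

lemma regular_homotopy_lifting:
  fixes X :: "'x topology"
  assumes p: "hurewicz_fibration E B p" and uL: "equiconnection B u L"
    and f: "continuous_map X E f" and H: "continuous_map (prod_topology X unit_interval) B H"
    and H0: "\<And>x. x \<in> topspace X \<Longrightarrow> H (x, 0) = p (f x)"
  obtains K where "continuous_map (prod_topology X unit_interval) E K"
    "\<And>x. x \<in> topspace X \<Longrightarrow> K (x, 0) = f x"
    "\<And>x t. x \<in> topspace X \<Longrightarrow> t \<in> {0..1} \<Longrightarrow> p (K (x, t)) = H (x, t)"
    "\<And>x t. x \<in> topspace X \<Longrightarrow> (\<And>t. t \<in> {0..1} \<Longrightarrow> H (x, t) = H (x, 0)) \<Longrightarrow> t \<in> {0..1} \<Longrightarrow> K (x, t) = f x"
proof -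
  note uLD = equiconnectionD[OF uL]
  let ?P = "prod_topology X unit_interval"
  have HB: "H (x, t) \<in> topspace B" if "x \<in> topspace X" "t \<in> {0..1}" for x t
    using continuous_map_funspace[OF H] that by (auto simp: Pi_iff)
  define g where "g z = u (H (fst z, 0), H z)" for z
  \<comment> \<open>Vanishes exactly where \<open>H (x, _)\<close> is constant; the bound by 1 keeps
    the slowed-down time \<open>t * d x\<close> inside the unit interval.\<close>
  define d where "d x = min 1 (SUP t\<in>{0..1}. g (x, t))" for x
  have "continuous_map ?P B (\<lambda>z. H (fst z, 0))"
    by (rule continuous_map_prod_apply[OF H continuous_map_fst]) auto
  from continuous_map_prod_apply[OF uLD(1) this H]
  have g: "continuous_map ?P euclideanreal g" by (simp add: g_def[abs_def])
  have d: "continuous_map X euclideanreal d"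
    unfolding d_def by (intro continuous_map_real_min continuous_map_SUP_unit_interval g) auto
  have g_nonneg: "0 \<le> g (x, t)" if "x \<in> topspace X" "t \<in> {0..1}" for x t
    using that HB uLD(3) by (simp add: g_def)
  have d_range: "0 \<le> d x" "d x \<le> 1" if "x \<in> topspace X" for x
    using SUP_unit_interval_nonneg[OF g that g_nonneg[OF that]] by (auto simp: d_def)
  have d_0: "d x = 0 \<longleftrightarrow> (\<forall>t\<in>{0..1}. H (x, t) = H (x, 0))" if x: "x \<in> topspace X" for x
  proof -
    have "d x = 0 \<longleftrightarrow> (\<forall>t\<in>{0..1}. g (x, t) = 0)"
      using SUP_unit_interval_eq_0_iff[OF g x g_nonneg[OF x]] by (auto simp: d_def min_def)
    also have "\<dots> \<longleftrightarrow> (\<forall>t\<in>{0..1}. H (x, t) = H (x, 0))"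
      using uLD(4) HB[OF x] by (intro ball_cong) (auto simp: g_def)
    finally show ?thesis .
  qed
  \<comment> \<open>Runs through \<open>H (x, _)\<close> in time \<open>d x\<close> and then rests.
    A lift of it, read at time \<open>t * d x\<close>, lies over \<open>H (x, t)\<close>; where
    \<open>d x = 0\<close> it is read at time 0 only, hence constant.\<close>
  let ?H = "\<lambda>(x, t). H (x, min 1 (t / d x))"
  have "continuous_map ?P B ?H"
    using d_0 by (intro continuous_map_reparametrization[OF H d d_range(1)]) blast+
  moreover have "\<forall>x\<in>topspace X. ?H (x, 0) = p (f x)" using H0 by simp
  ultimately have "\<exists>K. continuous_map ?P E K \<and> (\<forall>x\<in>topspace X. K (x, 0) = f x) \<and>
      (\<forall>x\<in>topspace X. \<forall>t\<in>{0..1}. p (K (x, t)) = ?H (x, t))"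
    using f
    by (intro hurewicz_fibration_lifting[OF p, unfolded homotopy_lifting_def, rule_format] conjI) auto
  then obtain K where K: "continuous_map ?P E K"
    and K0: "\<And>x. x \<in> topspace X \<Longrightarrow> K (x, 0) = f x"
    and pK: "\<And>x t. x \<in> topspace X \<Longrightarrow> t \<in> {0..1} \<Longrightarrow> p (K (x, t)) = ?H (x, t)"
    by blast
  have td: "t * d x \<in> {0..1}" if "x \<in> topspace X" "t \<in> {0..1}" for x t
    using d_range that by (auto intro!: mult_le_one)
  have "continuous_map ?P euclideanreal (\<lambda>z. snd z * d (fst z))"
    using continuous_map_compose[OF continuous_map_fst d, of unit_interval]
    by (intro continuous_map_real_mult continuous_map_unit_interval_real[OF continuous_map_snd])
      (simp add: o_def)
  then have "continuous_map ?P unit_interval (\<lambda>z. snd z * d (fst z))"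
    using td by (auto simp: continuous_map_unit_interval_iff)
  from continuous_map_prod_apply[OF K continuous_map_fst this]
  show thesis
  proof (rule that)
    fix x assume x: "x \<in> topspace X"
    then show "K (fst (x, 0), snd (x, 0) * d (fst (x, 0))) = f x" using K0 by simp
    fix t :: real assume t: "t \<in> {0..1}"
    show "p (K (fst (x, t), snd (x, t) * d (fst (x, t)))) = H (x, t)"
    proof (cases "d x = 0")
      case True
      then have "H (x, t) = H (x, 0)" using d_0[OF x] t by blast
      then show ?thesis using pK[OF x td[OF x t]] True by simp
    next
      case False
      then show ?thesis using pK[OF x td[OF x t]] t by simp
    qed
    assume "\<And>t. t \<in> {0..1} \<Longrightarrow> H (x, t) = H (x, 0)"
    then have "d x = 0" using d_0[OF x] by blast
    then show "K (fst (x, t), snd (x, t) * d (fst (x, t))) = f x"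
      using K0[OF x] by simp
  qed
qed

text \<open>
  To connect \<open>(x, e)\<close> with \<open>(x', e')\<close>, move \<open>x\<close> to \<open>x'\<close> and transport \<open>e\<close> along a lift \<open>l\<close> of the image
  of this path. The path from the result to \<open>e'\<close> given by the equiconnection of \<open>E\<close> need not stay in
  the fibre; \<open>m\<close> lifts the contraction in \<open>B\<close> of its image to the point \<open>p e'\<close>. Regularity of the
  lifts keeps both ends of the path fixed.
\<close>

lemma equiconnection_pullback:
  assumes X: "equiconnection X uX LX" and E: "equiconnection E uE LE" and B: "equiconnection B uB LB"
    and p: "hurewicz_fibration E B p" and f: "continuous_map X B f"
  obtains u L where "equiconnection (subtopology (prod_topology X E) {(x, e). f x = p e}) u L"
proof -
  note XD = equiconnectionD[OF X] and ED = equiconnectionD[OF E] and BD = equiconnectionD[OF B]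
  define P where "P = subtopology (prod_topology X E) {(x, e). f x = p e}"
  let ?Q = "prod_topology P P"
  let ?QI = "prod_topology ?Q unit_interval"
  have cp: "continuous_map E B p" using p by (simp add: hurewicz_fibration_def)
  have P_iff: "(x, e) \<in> topspace P \<longleftrightarrow> x \<in> topspace X \<and> e \<in> topspace E \<and> f x = p e" for x e
    by (auto simp: P_def)
  have P1: "continuous_map P X fst" and P2: "continuous_map P E snd"
    by (auto simp: P_def intro!: continuous_map_from_subtopology continuous_map_fst continuous_map_snd)
  have Qx: "continuous_map ?Q X (\<lambda>z. fst (fst z))" and Qx': "continuous_map ?Q X (\<lambda>z. fst (snd z))"
    and Qe: "continuous_map ?Q E (\<lambda>z. snd (fst z))" and Qe': "continuous_map ?Q E (\<lambda>z. snd (snd z))"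
    using continuous_map_compose[OF continuous_map_fst P1] continuous_map_compose[OF continuous_map_snd P1]
      continuous_map_compose[OF continuous_map_fst P2] continuous_map_compose[OF continuous_map_snd P2]
    by (simp_all add: o_def)
  define g where "g z = LX ((fst (fst (fst z)), fst (snd (fst z))), snd z)"
    for z :: "(('a \<times> 'b) \<times> 'a \<times> 'b) \<times> real"
  have g: "continuous_map ?QI X g"
    unfolding g_def[abs_def]
    by (rule continuous_map_prod_apply[OF XD(2) continuous_map_compose[OF continuous_map_fst
          continuous_map_pairedI[OF Qx Qx'], unfolded o_def] continuous_map_snd])
  obtain l where l: "continuous_map ?QI E l"
    and l_0: "\<And>z. z \<in> topspace ?Q \<Longrightarrow> l (z, 0) = snd (fst z)"
    and pl: "\<And>z t. z \<in> topspace ?Q \<Longrightarrow> t \<in> {0..1} \<Longrightarrow> p (l (z, t)) = f (g (z, t))"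
    and l_const: "\<And>z t. z \<in> topspace ?Q \<Longrightarrow> (\<And>t. t \<in> {0..1} \<Longrightarrow> f (g (z, t)) = f (g (z, 0))) \<Longrightarrow>
      t \<in> {0..1} \<Longrightarrow> l (z, t) = snd (fst z)"
  proof (rule regular_homotopy_lifting[OF p B Qe continuous_map_compose[OF g f]])
    fix z assume "z \<in> topspace ?Q"
    then show "(f \<circ> g) (z, 0) = p (snd (fst z))" using XD(5) by (auto simp: P_iff g_def)
  qed (unfold o_def, blast)
  have l1: "continuous_map ?Q E (\<lambda>z. l (z, 1))"
    by (rule continuous_map_prod_apply[OF l continuous_map_id[unfolded id_def]]) auto
  define m0 where "m0 w = LE ((l (fst w, 1), snd (snd (fst w))), snd w)" for w
  have m0: "continuous_map ?QI E m0"
    unfolding m0_def[abs_def]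
    by (rule continuous_map_prod_apply[OF ED(2) continuous_map_compose[OF continuous_map_fst
          continuous_map_pairedI[OF l1 Qe'], unfolded o_def] continuous_map_snd])
  define h where "h = (\<lambda>w :: ((('a \<times> 'b) \<times> 'a \<times> 'b) \<times> real). (p (m0 w), p (snd (snd (fst w)))))"
  have h: "continuous_map ?QI (prod_topology B B) h"
    unfolding h_def
    by (intro continuous_map_pairedI continuous_map_compose[OF m0 cp, unfolded o_def]
        continuous_map_compose[OF continuous_map_compose[OF continuous_map_fst Qe', unfolded o_def]
          cp, unfolded o_def])
  define H where "H w = LB (h (fst w), snd w)" for w
  have H: "continuous_map (prod_topology ?QI unit_interval) B H"
    unfolding H_def[abs_def]
    by (rule continuous_map_prod_apply[OF BD(2) continuous_map_compose[OF continuous_map_fst h,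
          unfolded o_def] continuous_map_snd])
  have h_B: "p (m0 w) \<in> topspace B" "p (snd (snd (fst w))) \<in> topspace B" if "w \<in> topspace ?QI" for w
    using funcset_mem[OF continuous_map_funspace[OF h] that] by (simp_all add: h_def)
  obtain m where m: "continuous_map (prod_topology ?QI unit_interval) E m"
    and m_0: "\<And>w. w \<in> topspace ?QI \<Longrightarrow> m (w, 0) = m0 w"
    and pm: "\<And>w t. w \<in> topspace ?QI \<Longrightarrow> t \<in> {0..1} \<Longrightarrow> p (m (w, t)) = H (w, t)"
    and m_const: "\<And>w t. w \<in> topspace ?QI \<Longrightarrow> (\<And>t. t \<in> {0..1} \<Longrightarrow> H (w, t) = H (w, 0)) \<Longrightarrow>
      t \<in> {0..1} \<Longrightarrow> m (w, t) = m0 w"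
  proof (rule regular_homotopy_lifting[OF p B m0 H])
    fix w assume "w \<in> topspace ?QI"
    then show "H (w, 0) = p (m0 w)" using h_B BD(5) by (simp add: H_def h_def)
  qed blast
  define k where "k w = uB (h w)" for w
  have k: "continuous_map ?QI euclideanreal k"
    using continuous_map_compose[OF h BD(1)] by (simp add: k_def[abs_def] o_def)
  have k_nonneg: "0 \<le> k w" if "w \<in> topspace ?QI" for w
    using h_B[OF that] BD(3) by (simp add: k_def h_def)
  have m_1: "m (w, t) = m0 w"
    if "w \<in> topspace ?QI" "p (m0 w) = p (snd (snd (fst w)))" "t \<in> {0..1}" for w t
    by (rule m_const[OF that(1) _ that(3)]) (use that(2) h_B[OF that(1)] BD(5,7) in \<open>simp add: H_def h_def\<close>)
  \<comment> \<open>Each term secures one arrival when it is below 1: the path in X reaches x', the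
    path \<open>m0\<close> reaches e', and for every parameter the contraction in B reaches
    \<open>p e'\<close>, which puts the second leg of the join into the pullback.\<close>
  define u where "u z = max (max (uX (fst (fst z), fst (snd z))) (uE (l (z, 1), snd (snd z))))
    (SUP t\<in>{0..1}. k (z, t))" for z
  have u: "continuous_map ?Q euclideanreal u"
    unfolding u_def[abs_def]
    by (intro continuous_map_real_max continuous_map_prod_apply[OF XD(1) Qx Qx']
        continuous_map_prod_apply[OF ED(1) l1 Qe'] continuous_map_SUP_unit_interval[OF k])
  define a where "a w = (g w, l w)" for w
  define b where "b w = (fst (snd (fst w)), m (w, 1))" for w :: "(('a \<times> 'b) \<times> 'a \<times> 'b) \<times> real"
  let ?L = "damped_join u a b"
  have a: "continuous_map ?QI (prod_topology X E) a"
    unfolding a_def[abs_def] by (rule continuous_map_pairedI[OF g l])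
  have "continuous_map ?QI E (\<lambda>w. m (w, 1))"
    by (rule continuous_map_prod_apply[OF m continuous_map_id[unfolded id_def]]) auto
  then have b: "continuous_map ?QI (prod_topology X E) b"
    unfolding b_def[abs_def]
    by (intro continuous_map_pairedI continuous_map_compose[OF continuous_map_fst Qx', unfolded o_def])
  have u_less: "uX (x, x') < 1" "uE (l (((x, e), (x', e')), 1), e') < 1"
      "t \<in> {0..1} \<Longrightarrow> k (((x, e), (x', e')), t) < 1"
    if "u ((x, e), (x', e')) < 1" "(x, e) \<in> topspace P" "(x', e') \<in> topspace P" for x e x' e' t
    using that SUP_unit_interval_less_iff[OF k, of "((x, e), (x', e'))"] by (auto simp: u_def)
  have l_E: "l (z, t) \<in> topspace E" if "z \<in> topspace ?Q" "t \<in> {0..1}" for z t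
    using continuous_map_funspace[OF l] that by (auto simp: Pi_iff)
  have m0_0: "m0 (z, 0) = l (z, 1)" if "z \<in> topspace ?Q" for z
    using that l_E[OF that, of 1] ED(5) by (auto simp: m0_def P_iff)
  have pl_1: "p (l (z, 1)) = p (snd (snd z))" if "z \<in> topspace ?Q" "u z < 1" for z
    using that pl[OF that(1), of 1] XD(6) u_less(1) by (auto simp: g_def P_iff)
  have ab: "a (z, 1) = b (z, 0)" if z: "z \<in> topspace ?Q" "u z < 1" for z
    using z m_1[of "(z, 0)" 1] m0_0[OF z(1)] pl_1[OF z] XD(6) u_less(1)
    by (auto simp: a_def b_def g_def P_iff)
  have cL: "continuous_map ?QI (prod_topology X E) ?L"
    by (rule continuous_map_damped_join[OF u a b ab])
  have L_P: "f (fst (?L (z, t))) = p (snd (?L (z, t)))" if z: "z \<in> topspace ?Q" and t: "t \<in> {0..1}" for z t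
  proof (rule damped_join_cases[OF t, of u a b z])
    fix s assume "s \<in> {0..1::real}" "?L (z, t) = a (z, s)"
    then show ?thesis using pl[OF z] by (simp add: a_def)
  next
    fix s assume s: "s \<in> {0..1::real}" "u z < 1" and L: "?L (z, t) = b (z, s)"
    obtain x e x' e' where z': "z = ((x, e), (x', e'))" "(x, e) \<in> topspace P" "(x', e') \<in> topspace P"
      using z by auto
    have w: "(z, s) \<in> topspace ?QI" using z s by auto
    have "k (z, s) < 1" using u_less(3) s z' by blast
    then have "p (m ((z, s), 1)) = p e'"
      using pm[OF w, of 1] h_B[OF w] BD(6) z' by (simp add: H_def k_def h_def)
    then show ?thesis using L z' by (simp add: b_def P_iff)
  qed
  have "?L \<in> topspace ?QI \<rightarrow> {(x, e). f x = p e}"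
    using L_P by (force simp: case_prod_unfold simp del: topspace_subtopology)
  with cL have "continuous_map ?QI (subtopology (prod_topology X E) {(x, e). f x = p e}) ?L"
    by (simp only: continuous_map_in_subtopology simp_thms)
  then have cL': "continuous_map ?QI P ?L" by (simp only: P_def[symmetric])
  have diag: "l (((x, e), (x, e)), t) = e" "m0 (((x, e), (x, e)), t) = e"
      "m ((((x, e), (x, e)), t), 1) = e" "k (((x, e), (x, e)), t) = 0"
    if P: "(x, e) \<in> topspace P" and t: "t \<in> {0..1}" for x e t
  proof -
    have xe: "x \<in> topspace X" "e \<in> topspace E" using P by (auto simp: P_iff)
    have l': "l (((x, e), (x, e)), s) = e" if "s \<in> {0..1}" for s
      by (subst l_const) (use P that XD(7)[OF xe(1)] in \<open>auto simp: g_def\<close>)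
    then show "l (((x, e), (x, e)), t) = e" using t by blast
    show m': "m0 (((x, e), (x, e)), t) = e"
      using l'[of 1] ED(7)[OF xe(2) t] by (simp add: m0_def)
    have w: "(((x, e), (x, e)), t) \<in> topspace ?QI" using P t by auto
    show "m ((((x, e), (x, e)), t), 1) = e"
      using m_1[OF w] m' by simp
    show "k (((x, e), (x, e)), t) = 0"
      using m' h_B[OF w] BD(4) by (simp add: k_def h_def)
  qed
  have u_0: "u ((x, e), (x', e')) = 0 \<longleftrightarrow> (x, e) = (x', e')"
    if P: "(x, e) \<in> topspace P" "(x', e') \<in> topspace P" for x e x' e'
  proof
    assume "(x, e) = (x', e')"
    moreover have "uX (x, x) = 0" "uE (e, e) = 0"
      using P XD(4)[of x x] ED(4)[of e e] by (auto simp: P_iff)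
    ultimately show "u ((x, e), (x', e')) = 0"
      using diag[OF P(1)] by (simp add: u_def)
  next
    assume *: "u ((x, e), (x', e')) = 0"
    have z: "((x, e), (x', e')) \<in> topspace ?Q" using P by auto
    have "uX (x, x') \<le> 0" "uE (l (((x, e), (x', e')), 1), e') \<le> 0"
      using * by (auto simp: u_def max_def split: if_splits)
    moreover have "x \<in> topspace X" "x' \<in> topspace X" "e' \<in> topspace E"
        "l (((x, e), (x', e')), 1) \<in> topspace E"
      using P l_E[OF z, of 1] by (auto simp: P_iff)
    ultimately have "x = x'" and e': "l (((x, e), (x', e')), 1) = e'"
      using XD(3,4) ED(3,4) order_antisym by metis+
    \<comment> \<open>As x = x', the path in X is constant, and so is its regular lift. The endpoint
      of the lift is therefore both e and e'.\<close>
    have "l (((x, e), (x', e')), 1) = e"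
      by (subst l_const) (use z P XD(7) \<open>x = x'\<close> in \<open>auto simp: g_def P_iff\<close>)
    with e' \<open>x = x'\<close> show "(x, e) = (x', e')" by simp
  qed
  have "equiconnection P (\<lambda>z. 3 * u z) ?L"
    unfolding equiconnection_def
  proof (intro conjI ballI impI)
    show "continuous_map ?Q euclideanreal (\<lambda>z. 3 * u z)"
      by (intro continuous_map_real_mult u) auto
    show "continuous_map ?QI P ?L" by (rule cL')
  next
    fix v w assume vw: "v \<in> topspace P" "w \<in> topspace P"
    obtain x e x' e' where *: "v = (x, e)" "w = (x', e')" by fastforce
    have z: "(v, w) \<in> topspace ?Q" using vw by auto
    have xe: "x \<in> topspace X" "e \<in> topspace E" "x' \<in> topspace X" "e' \<in> topspace E" "f x' = p e'"
      using vw * by (auto simp: P_iff)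
    show "0 \<le> 3 * u (v, w)"
      using XD(3)[OF xe(1,3)] by (simp add: u_def * le_max_iff_disj)
    show "3 * u (v, w) = 0 \<longleftrightarrow> v = w" using u_0 vw * by auto
    show "?L ((v, w), 0) = v"
      using l_0[OF z] XD(5) xe by (simp add: damped_join_0 a_def g_def *)
    assume "3 * u (v, w) < 1"
    then have u': "u (v, w) < 1" "u (v, w) \<le> 1 / 3" by auto
    have "m0 ((v, w), 1) = e'"
      using u_less(2) u'(1) vw l_E[OF z, of 1] xe ED(6) by (auto simp: m0_def *)
    then have "m (((v, w), 1), 1) = e'"
      using m_1[of "((v, w), 1)" 1] z * by simp
    then show "?L ((v, w), 1) = w"
      using u'(2) by (simp add: damped_join_1 b_def *)
  next
    fix v and t :: real assume v: "v \<in> topspace P" and t: "t \<in> {0..1}"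
    obtain x e where *: "v = (x, e)" by fastforce
    show "?L ((v, v), t) = v"
      by (rule damped_join_cases[OF t, of u a b "(v, v)"])
        (use v XD(7) diag in \<open>auto simp: a_def b_def g_def * P_iff\<close>)
  qed
  then show thesis unfolding P_def by (rule that)
qed

section \<open>Powers of equiconnected spaces and of fibrations\<close>

text \<open>A finite sum of nonnegative terms vanishes only if every term does, and is below 1 only
  if every term is.\<close>

lemma equiconnection_product:
  assumes uL: "equiconnection X u L" and I: "finite I"
  shows "equiconnection (product_topology (\<lambda>_. X) I) (\<lambda>(v, w). \<Sum>i\<in>I. u (v i, w i))
    (\<lambda>((v, w), t). \<lambda>i\<in>I. L ((v i, w i), t))"
    (is "equiconnection ?V ?u ?L")
proof -
  note D = equiconnectionD[OF uL]
  have c1: "continuous_map (prod_topology ?V ?V) X (\<lambda>z. fst z i)"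
    and c2: "continuous_map (prod_topology ?V ?V) X (\<lambda>z. snd z i)" if "i \<in> I" for i
    using continuous_map_compose[OF continuous_map_fst continuous_map_product_projection[OF that]]
      continuous_map_compose[OF continuous_map_snd continuous_map_product_projection[OF that]]
    by (simp_all add: o_def)
  have V: "v i \<in> topspace X" if "v \<in> topspace ?V" "i \<in> I" for v i
    using that by auto
  have nonneg: "0 \<le> u (v i, w i)" if "v \<in> topspace ?V" "w \<in> topspace ?V" "i \<in> I" for v w i
    using D(3) V that by blast
  show ?thesis
    unfolding equiconnection_def
  proof (intro conjI ballI impI)
    show "continuous_map (prod_topology ?V ?V) euclideanreal (\<lambda>(v, w). \<Sum>i\<in>I. u (v i, w i))"
      unfolding case_prod_unfold
      by (intro continuous_map_sum I continuous_map_prod_apply[OF D(1) c1 c2])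
    show "continuous_map (prod_topology (prod_topology ?V ?V) unit_interval) ?V
        (\<lambda>((v, w), t). \<lambda>i\<in>I. L ((v i, w i), t))"
      unfolding continuous_map_componentwise case_prod_unfold
      by (auto intro!: continuous_map_prod_apply[OF D(2)] continuous_map_snd
          continuous_map_compose[OF continuous_map_fst continuous_map_pairedI[OF c1 c2], unfolded o_def])
  next
    fix v w assume vw: "v \<in> topspace ?V" "w \<in> topspace ?V"
    show "0 \<le> ?u (v, w)"
      using nonneg[OF vw] by (simp add: sum_nonneg)
    have ext: "v = w \<longleftrightarrow> (\<forall>i\<in>I. v i = w i)"
      using vw PiE_ext[of v I "\<lambda>_. topspace X" w] by auto
    have "(\<Sum>i\<in>I. u (v i, w i)) = 0 \<longleftrightarrow> (\<forall>i\<in>I. u (v i, w i) = 0)"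
      using nonneg[OF vw] I by (simp add: sum_nonneg_eq_0_iff)
    also have "\<dots> \<longleftrightarrow> v = w" unfolding ext using D(4) V[OF vw(1)] V[OF vw(2)] by auto
    finally show "?u (v, w) = 0 \<longleftrightarrow> v = w" by simp
    show "?L ((v, w), 0) = v"
      using vw D(5) V[OF vw(1)] V[OF vw(2)] by (auto simp: PiE_def extensional_def intro!: ext)
    assume "?u (v, w) < 1"
    then have "(\<Sum>i\<in>I. u (v i, w i)) < 1" by simp
    then have "u (v i, w i) < 1" if "i \<in> I" for i
      using member_le_sum[of i I "\<lambda>i. u (v i, w i)"] nonneg[OF vw] I that by force
    then show "?L ((v, w), 1) = w"
      using vw D(6) V[OF vw(1)] V[OF vw(2)] by (auto simp: PiE_def extensional_def intro!: ext)
  next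
    fix v and t :: real assume "v \<in> topspace ?V" "t \<in> {0..1}"
    then show "?L ((v, v), t) = v"
      using D(7) by (auto simp: PiE_def Pi_iff extensional_def fun_eq_iff intro!: ext)
  qed
qed

text \<open>The coordinates are lifted independently. The test spaces for the power live on another
  type than those in the definition for \<open>p\<close>, so the coordinates are lifted with
  \<open>hurewicz_fibration_lifting\<close>.\<close>

lemma hurewicz_fibration_product:
  assumes p: "hurewicz_fibration E B p"
  shows "hurewicz_fibration (product_topology (\<lambda>_. E) I) (product_topology (\<lambda>_. B) I)
    (\<lambda>v. \<lambda>i\<in>I. p (v i))"
  unfolding hurewicz_fibration_def homotopy_lifting_def
proof (intro conjI allI impI, goal_cases)
  case 1
  have "continuous_map E B p" using p by (simp add: hurewicz_fibration_def)
  then show ?case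
    unfolding continuous_map_componentwise
    using continuous_map_compose[OF continuous_map_product_projection, of _ I "\<lambda>_. E" B p]
    by (auto simp: o_def)
next
  case (2 X f H)
  let ?P = "prod_topology X unit_interval"
  have fi: "continuous_map X E (\<lambda>x. f x i)" and Hi: "continuous_map ?P B (\<lambda>z. H z i)" if "i \<in> I" for i
    using 2 that by (auto simp: continuous_map_componentwise)
  have "\<exists>K. continuous_map ?P E K \<and> (\<forall>x\<in>topspace X. K (x, 0) = f x i) \<and>
      (\<forall>x\<in>topspace X. \<forall>t\<in>{0..1}. p (K (x, t)) = H (x, t) i)" if "i \<in> I" for i
    using 2 fi[OF that] Hi[OF that] that
    by (intro hurewicz_fibration_lifting[OF p, of X, unfolded homotopy_lifting_def, rule_format]) auto
  then obtain K where K: "\<And>i. i \<in> I \<Longrightarrow> continuous_map ?P E (K i)"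
    "\<And>i x. i \<in> I \<Longrightarrow> x \<in> topspace X \<Longrightarrow> K i (x, 0) = f x i"
    "\<And>i x t. i \<in> I \<Longrightarrow> x \<in> topspace X \<Longrightarrow> t \<in> {0..1} \<Longrightarrow> p (K i (x, t)) = H (x, t) i"
    by metis
  have "f x \<in> extensional I" if "x \<in> topspace X" for x
    using 2 that by (auto simp: continuous_map_componentwise)
  moreover have "H (x, t) \<in> extensional I" if "x \<in> topspace X" "t \<in> {0..1}" for x t
    using 2 that by (auto simp: continuous_map_componentwise image_subset_iff)
  ultimately show ?case
    using K by (intro exI[of _ "\<lambda>z. \<lambda>i\<in>I. K i z"])
      (auto simp: continuous_map_componentwise extensional_def)
qed

section \<open>Coherence in bicategories\<close>

context bicategory
begin

declare src1 [simp] tgt1 [simp] src2 [simp] tgt2 [simp] globular_src [simp] globular_tgt [simp]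
  id1 [simp] id2 [simp] vcomp [simp] hcomp1 [simp] hcomp2 [simp] associator [simp] lunitor [simp]
  runitor [simp]

section \<open>Vertical inverses and whiskering\<close>

lemma vcomp_id_simps [simp]:
  "\<lbrakk>a \<in> topspace (Cell C); f = tgt2 C a\<rbrakk> \<Longrightarrow> id2 C f \<cdot> a = a"
  "\<lbrakk>a \<in> topspace (Cell C); f = src2 C a\<rbrakk> \<Longrightarrow> a \<cdot> id2 C f = a"
  using vcomp_id_left vcomp_id_right by auto

lemma vcomp_rewrite:
  assumes "b \<cdot> a = e" "a \<in> topspace (Cell C)" "b \<in> topspace (Cell C)" "src2 C b = tgt2 C a"
    and "c \<in> topspace (Cell C)" "src2 C a = tgt2 C c"
  shows "b \<cdot> (a \<cdot> c) = e \<cdot> c"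
  using vcomp_assoc[of c a b] assms by simp

lemma is_vinverse_unique:
  assumes "a \<in> topspace (Cell C)" "is_vinverse C a b" "is_vinverse C a c"
  shows "b = c"
proof -
  have "b = b \<cdot> (a \<cdot> c)" using assms by (simp add: is_vinverse_def)
  also have "\<dots> = (b \<cdot> a) \<cdot> c" using assms by (intro vcomp_assoc[symmetric]) (auto simp: is_vinverse_def)
  also have "\<dots> = c" using assms by (simp add: is_vinverse_def)
  finally show ?thesis .
qed

lemma vinv_eqI:
  assumes "a \<in> topspace (Cell C)" "is_vinverse C a b"
  shows "vinv C a = b"
  unfolding vinv_def using assms is_vinverse_unique by blast

lemma is_vinverse_vinv:
  assumes "a \<in> topspace (Cell C)" "vinvertible C a"
  shows "is_vinverse C a (vinv C a)"
  using assms vinv_eqI unfolding vinvertible_def by blast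

lemma vinv_simps [simp]:
  assumes "a \<in> topspace (Cell C)" "vinvertible C a"
  shows "vinv C a \<in> topspace (Cell C)" "src2 C (vinv C a) = tgt2 C a" "tgt2 C (vinv C a) = src2 C a"
    "vinv C a \<cdot> a = id2 C (src2 C a)" "a \<cdot> vinv C a = id2 C (tgt2 C a)"
  using is_vinverse_vinv[OF assms] by (auto simp: is_vinverse_def)

lemma vcomp_left_cancel:
  assumes "c \<in> topspace (Cell C)" "vinvertible C c" "a \<in> topspace (Cell C)" "b \<in> topspace (Cell C)"
    and "tgt2 C a = src2 C c" "tgt2 C b = src2 C c" and eq: "c \<cdot> a = c \<cdot> b"
  shows "a = b"
proof -
  have "vinv C c \<cdot> (c \<cdot> a) = a" "vinv C c \<cdot> (c \<cdot> b) = b"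
    using assms(1-6) by (simp_all flip: vcomp_assoc)
  with eq show ?thesis by metis
qed

lemma vcomp_right_cancel:
  assumes "c \<in> topspace (Cell C)" "vinvertible C c" "a \<in> topspace (Cell C)" "b \<in> topspace (Cell C)"
    and "src2 C a = tgt2 C c" "src2 C b = tgt2 C c" and eq: "a \<cdot> c = b \<cdot> c"
  shows "a = b"
proof -
  have "(a \<cdot> c) \<cdot> vinv C c = a" "(b \<cdot> c) \<cdot> vinv C c = b"
    using assms(1-6) by (simp_all add: vcomp_assoc)
  with eq show ?thesis by metis
qed

lemma vinvertible_vcomp:
  assumes "a \<in> topspace (Cell C)" "b \<in> topspace (Cell C)" "src2 C b = tgt2 C a"
    and "vinvertible C a" "vinvertible C b"
  shows "vinvertible C (b \<cdot> a)"
proof -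
  have "vinv C b \<cdot> (b \<cdot> a) = a" "a \<cdot> (vinv C a \<cdot> vinv C b) = vinv C b"
    using assms by (simp_all flip: vcomp_assoc)
  then have "is_vinverse C (b \<cdot> a) (vinv C a \<cdot> vinv C b)"
    using assms by (simp add: is_vinverse_def vcomp_assoc)
  then show ?thesis unfolding vinvertible_def by blast
qed

lemma vinvertible_id2: "f \<in> topspace (Mor C) \<Longrightarrow> vinvertible C (id2 C f)"
  unfolding vinvertible_def is_vinverse_def by (rule exI[of _ "id2 C f"]) simp

lemma vinvertible_hcomp:
  assumes "a \<in> topspace (Cell C)" "b \<in> topspace (Cell C)" "src1 C (src2 C b) = tgt1 C (src2 C a)"
    and "vinvertible C a" "vinvertible C b"
  shows "vinvertible C (b \<diamondop> a)"
proof -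
  have "(vinv C b \<diamondop> vinv C a) \<cdot> (b \<diamondop> a) = id2 C (src2 C b \<star> src2 C a)"
    "(b \<diamondop> a) \<cdot> (vinv C b \<diamondop> vinv C a) = id2 C (tgt2 C b \<star> tgt2 C a)"
    using assms by (simp_all flip: interchange add: hcomp_id)
  then have "is_vinverse C (b \<diamondop> a) (vinv C b \<diamondop> vinv C a)"
    using assms by (simp add: is_vinverse_def)
  then show ?thesis unfolding vinvertible_def by blast
qed

lemma whisker_left_vcomp:
  assumes "a \<in> topspace (Cell C)" "b \<in> topspace (Cell C)" "src2 C b = tgt2 C a"
    and "g \<in> topspace (Mor C)" "src1 C g = tgt1 C (src2 C a)"
  shows "id2 C g \<diamondop> (b \<cdot> a) = (id2 C g \<diamondop> b) \<cdot> (id2 C g \<diamondop> a)"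
  using interchange[of a b "id2 C g" "id2 C g"] assms by simp

lemma whisker_right_vcomp:
  assumes "a \<in> topspace (Cell C)" "b \<in> topspace (Cell C)" "src2 C b = tgt2 C a"
    and "f \<in> topspace (Mor C)" "src1 C (src2 C a) = tgt1 C f"
  shows "(b \<cdot> a) \<diamondop> id2 C f = (b \<diamondop> id2 C f) \<cdot> (a \<diamondop> id2 C f)"
  using interchange[of "id2 C f" "id2 C f" a b] assms by simp

text \<open>By the interchange law both sides equal \<open>b \<diamondop> a\<close>.\<close>

lemma whisker_exchange:
  assumes "a \<in> topspace (Cell C)" "b \<in> topspace (Cell C)" "src1 C (src2 C b) = tgt1 C (src2 C a)"
  shows "(b \<diamondop> id2 C (tgt2 C a)) \<cdot> (id2 C (src2 C b) \<diamondop> a) =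
    (id2 C (tgt2 C b) \<diamondop> a) \<cdot> (b \<diamondop> id2 C (src2 C a))"
proof -
  have "(b \<diamondop> id2 C (tgt2 C a)) \<cdot> (id2 C (src2 C b) \<diamondop> a) = b \<diamondop> a"
    using interchange[of a "id2 C (tgt2 C a)" "id2 C (src2 C b)" b] assms by simp
  moreover have "(id2 C (tgt2 C b) \<diamondop> a) \<cdot> (b \<diamondop> id2 C (src2 C a)) = b \<diamondop> a"
    using interchange[of "id2 C (src2 C a)" a b "id2 C (tgt2 C b)"] assms by simp
  ultimately show ?thesis by simp
qed

lemma associator_whisker_left:
  assumes "a \<in> topspace (Cell C)" "g \<in> topspace (Mor C)" "h \<in> topspace (Mor C)"
    and "src1 C g = tgt1 C (src2 C a)" "src1 C h = tgt1 C g"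
  shows "associator C h g (tgt2 C a) \<cdot> (id2 C h \<diamondop> (id2 C g \<diamondop> a)) =
    (id2 C (h \<star> g) \<diamondop> a) \<cdot> associator C h g (src2 C a)"
  using associator_natural[of a "id2 C g" "id2 C h"] assms by (simp add: hcomp_id)

lemma associator_whisker_middle:
  assumes "b \<in> topspace (Cell C)" "f \<in> topspace (Mor C)" "h \<in> topspace (Mor C)"
    and "src1 C (src2 C b) = tgt1 C f" "src1 C h = tgt1 C (src2 C b)"
  shows "associator C h (tgt2 C b) f \<cdot> (id2 C h \<diamondop> (b \<diamondop> id2 C f)) =
    ((id2 C h \<diamondop> b) \<diamondop> id2 C f) \<cdot> associator C h (src2 C b) f"
  using associator_natural[of "id2 C f" b "id2 C h"] assms by simp

lemma associator_whisker_right: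
  assumes "c \<in> topspace (Cell C)" "f \<in> topspace (Mor C)" "g \<in> topspace (Mor C)"
    and "src1 C g = tgt1 C f" "src1 C (src2 C c) = tgt1 C g"
  shows "associator C (tgt2 C c) g f \<cdot> (c \<diamondop> id2 C (g \<star> f)) =
    ((c \<diamondop> id2 C g) \<diamondop> id2 C f) \<cdot> associator C (src2 C c) g f"
  using associator_natural[of "id2 C f" "id2 C g" c] assms by (simp add: hcomp_id)

text \<open>By naturality of \<open>lunitor\<close>, the whiskered cell determines the composite of
  the cell with an invertible one.\<close>

lemma whisker_left_id1_cancel:
  assumes "a \<in> topspace (Cell C)" "b \<in> topspace (Cell C)" "src2 C a = src2 C b" "tgt2 C a = tgt2 C b"
    and eq: "id2 C (id1 C (tgt1 C (src2 C a))) \<diamondop> a = id2 C (id1 C (tgt1 C (src2 C a))) \<diamondop> b"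
  shows "a = b"
proof (rule vcomp_right_cancel[of "lunitor C (src2 C a)"])
  show "a \<cdot> lunitor C (src2 C a) = b \<cdot> lunitor C (src2 C a)"
    using lunitor_natural[of a] lunitor_natural[of b] assms by simp
qed (use assms in simp_all)

lemma whisker_right_id1_cancel:
  assumes "a \<in> topspace (Cell C)" "b \<in> topspace (Cell C)" "src2 C a = src2 C b" "tgt2 C a = tgt2 C b"
    and eq: "a \<diamondop> id2 C (id1 C (src1 C (src2 C a))) = b \<diamondop> id2 C (id1 C (src1 C (src2 C a)))"
  shows "a = b"
proof (rule vcomp_right_cancel[of "runitor C (src2 C a)"])
  show "a \<cdot> runitor C (src2 C a) = b \<cdot> runitor C (src2 C a)"
    using runitor_natural[of a] runitor_natural[of b] assms by simp
qed (use assms in simp_all)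

text \<open>
  Kelly's argument for the unit coherences: two 2-morphisms agree once they agree after whiskering
  with an identity 1-morphism, and there the pentagon and the triangle apply.
\<close>

lemma lunitor_hcomp:
  assumes f: "f \<in> topspace (Mor C)" and g: "g \<in> topspace (Mor C)" and gf: "src1 C g = tgt1 C f"
  shows "(lunitor C g \<diamondop> id2 C f) \<cdot> associator C (id1 C (tgt1 C g)) g f = lunitor C (g \<star> f)"
proof (rule whisker_left_id1_cancel)
  define i where "i = id1 C (tgt1 C g)"
  have i: "i \<in> topspace (Mor C)" "src1 C i = tgt1 C g" "tgt1 C i = tgt1 C g"
    using g by (simp_all add: i_def)
  note ty = f g gf i
  let ?a = "associator C" and ?l = "lunitor C" and ?r = "runitor C"
  have tri: "(?r i \<diamondop> id2 C (g \<star> f)) \<cdot> ?a i i (g \<star> f) = id2 C i \<diamondop> ?l (g \<star> f)"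
    "(?r i \<diamondop> id2 C g) \<cdot> ?a i i g = id2 C i \<diamondop> ?l g"
    using triangle[of "g \<star> f" i] triangle[of g i] ty by (simp_all add: i_def)
  have r: "src2 C (?r i) = i \<star> i" using ty by (simp add: i_def)
  \<comment> \<open>The pentagon for \<open>i, i, g, f\<close>; the triangle identities
    \<open>tri\<close> absorb the repeated identity at either end, and \<open>?a i g f\<close> is
    cancelled at the close.\<close>
  have "?a i g f \<cdot> (id2 C i \<diamondop> ?l (g \<star> f)) =
      (?a i g f \<cdot> (?r i \<diamondop> id2 C (g \<star> f))) \<cdot> ?a i i (g \<star> f)"
    unfolding tri(1)[symmetric] using ty r by (simp add: vcomp_assoc)
  also have "?a i g f \<cdot> (?r i \<diamondop> id2 C (g \<star> f)) = ((?r i \<diamondop> id2 C g) \<diamondop> id2 C f) \<cdot> ?a (i \<star> i) g f"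
    using associator_whisker_right[of "?r i" f g] ty r by simp
  also have "((?r i \<diamondop> id2 C g) \<diamondop> id2 C f) \<cdot> ?a (i \<star> i) g f \<cdot> ?a i i (g \<star> f) =
      ((?r i \<diamondop> id2 C g) \<diamondop> id2 C f) \<cdot> (?a (i \<star> i) g f \<cdot> ?a i i (g \<star> f))"
    using ty r by (simp add: vcomp_assoc)
  also have "?a (i \<star> i) g f \<cdot> ?a i i (g \<star> f) =
      (?a i i g \<diamondop> id2 C f) \<cdot> ?a i (i \<star> g) f \<cdot> (id2 C i \<diamondop> ?a i g f)"
    using pentagon[of f g i i] ty by simp
  also have "((?r i \<diamondop> id2 C g) \<diamondop> id2 C f) \<cdot> ((?a i i g \<diamondop> id2 C f) \<cdot> ?a i (i \<star> g) f \<cdot> (id2 C i \<diamondop> ?a i g f)) =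
      (((?r i \<diamondop> id2 C g) \<cdot> ?a i i g) \<diamondop> id2 C f) \<cdot> ?a i (i \<star> g) f \<cdot> (id2 C i \<diamondop> ?a i g f)"
    using ty r by (simp add: whisker_right_vcomp vcomp_assoc)
  also have "(((?r i \<diamondop> id2 C g) \<cdot> ?a i i g) \<diamondop> id2 C f) \<cdot> ?a i (i \<star> g) f =
      ?a i g f \<cdot> (id2 C i \<diamondop> (?l g \<diamondop> id2 C f))"
    unfolding tri(2) using associator_whisker_middle[of "?l g" f i] ty by (simp add: i_def)
  also have "?a i g f \<cdot> (id2 C i \<diamondop> (?l g \<diamondop> id2 C f)) \<cdot> (id2 C i \<diamondop> ?a i g f) =
      ?a i g f \<cdot> (id2 C i \<diamondop> ((?l g \<diamondop> id2 C f) \<cdot> ?a i g f))"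
    using ty by (simp add: whisker_left_vcomp vcomp_assoc i_def)
  finally have eq: "?a i g f \<cdot> (id2 C i \<diamondop> ?l (g \<star> f)) = ?a i g f \<cdot> (id2 C i \<diamondop> ((?l g \<diamondop> id2 C f) \<cdot> ?a i g f))" .
  have "id2 C i \<diamondop> ?l (g \<star> f) = id2 C i \<diamondop> ((?l g \<diamondop> id2 C f) \<cdot> ?a i g f)"
    by (rule vcomp_left_cancel[OF _ _ _ _ _ _ eq]) (use ty in \<open>simp_all add: i_def\<close>)
  then show "id2 C (id1 C (tgt1 C (src2 C ((?l g \<diamondop> id2 C f) \<cdot> ?a (id1 C (tgt1 C g)) g f)))) \<diamondop>
      ((?l g \<diamondop> id2 C f) \<cdot> ?a (id1 C (tgt1 C g)) g f) =
    id2 C (id1 C (tgt1 C (src2 C ((?l g \<diamondop> id2 C f) \<cdot> ?a (id1 C (tgt1 C g)) g f)))) \<diamondop> ?l (g \<star> f)"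
    using ty by (simp add: i_def)
qed (use assms in simp_all)

text \<open>The mirror image of \<open>lunitor_hcomp\<close>: whiskering with the identity on the
  right brings in the pentagon for \<open>g, f, i, i\<close>. Both sides are compared after
  composing with the invertible cell \<open>?X\<close>.\<close>

lemma runitor_hcomp:
  assumes f: "f \<in> topspace (Mor C)" and g: "g \<in> topspace (Mor C)" and gf: "src1 C g = tgt1 C f"
  shows "runitor C (g \<star> f) \<cdot> associator C g f (id1 C (src1 C f)) = id2 C g \<diamondop> runitor C f"
proof (rule whisker_right_id1_cancel)
  define i where "i = id1 C (src1 C f)"
  have i: "i \<in> topspace (Mor C)" "src1 C i = src1 C f" "tgt1 C i = src1 C f"
    using f by (simp_all add: i_def)
  note ty = f g gf i i_def[symmetric]
  let ?a = "associator C" and ?l = "lunitor C" and ?r = "runitor C"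
  have tri: "(?r (g \<star> f) \<diamondop> id2 C i) \<cdot> ?a (g \<star> f) i i = id2 C (g \<star> f) \<diamondop> ?l i"
    "(?r f \<diamondop> id2 C i) \<cdot> ?a f i i = id2 C f \<diamondop> ?l i"
    using triangle[of i "g \<star> f"] triangle[of i f] ty by simp_all
  have r: "src2 C (?r f) = f \<star> i" "src2 C (?r (g \<star> f)) = (g \<star> f) \<star> i" "src2 C (?l i) = i \<star> i"
    using ty by simp_all
  let ?X = "?a g (f \<star> i) i \<cdot> (id2 C g \<diamondop> ?a f i i)"
  have "((?r (g \<star> f) \<cdot> ?a g f i) \<diamondop> id2 C i) \<cdot> ?X =
      (?r (g \<star> f) \<diamondop> id2 C i) \<cdot> ((?a g f i \<diamondop> id2 C i) \<cdot> ?a g (f \<star> i) i \<cdot> (id2 C g \<diamondop> ?a f i i))"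
    using ty r by (simp add: whisker_right_vcomp vcomp_assoc)
  also have "(?a g f i \<diamondop> id2 C i) \<cdot> ?a g (f \<star> i) i \<cdot> (id2 C g \<diamondop> ?a f i i) =
      ?a (g \<star> f) i i \<cdot> ?a g f (i \<star> i)"
    by (rule pentagon[symmetric]) (use ty in simp_all)
  also have "(?r (g \<star> f) \<diamondop> id2 C i) \<cdot> (?a (g \<star> f) i i \<cdot> ?a g f (i \<star> i)) =
      (id2 C (g \<star> f) \<diamondop> ?l i) \<cdot> ?a g f (i \<star> i)"
    by (rule vcomp_rewrite[OF tri(1)]) (use ty r in simp_all)
  also have "\<dots> = ?a g f i \<cdot> (id2 C g \<diamondop> (id2 C f \<diamondop> ?l i))"
    using associator_whisker_left[of "?l i" f g] ty r by simp
  also have "\<dots> = ?a g f i \<cdot> (id2 C g \<diamondop> (?r f \<diamondop> id2 C i)) \<cdot> (id2 C g \<diamondop> ?a f i i)"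
    unfolding tri(2)[symmetric] using ty r by (simp add: whisker_left_vcomp vcomp_assoc)
  also have "?a g f i \<cdot> (id2 C g \<diamondop> (?r f \<diamondop> id2 C i)) =
      ((id2 C g \<diamondop> ?r f) \<diamondop> id2 C i) \<cdot> ?a g (f \<star> i) i"
    using associator_whisker_middle[of "?r f" i g] ty r by simp
  also have "((id2 C g \<diamondop> ?r f) \<diamondop> id2 C i) \<cdot> ?a g (f \<star> i) i \<cdot> (id2 C g \<diamondop> ?a f i i) =
      ((id2 C g \<diamondop> ?r f) \<diamondop> id2 C i) \<cdot> ?X"
    using ty r by (simp add: vcomp_assoc)
  finally have eq: "((?r (g \<star> f) \<cdot> ?a g f i) \<diamondop> id2 C i) \<cdot> ?X = ((id2 C g \<diamondop> ?r f) \<diamondop> id2 C i) \<cdot> ?X" .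
  have "vinvertible C ?X"
    using ty by (intro vinvertible_vcomp vinvertible_hcomp vinvertible_id2) simp_all
  then have "(?r (g \<star> f) \<cdot> ?a g f i) \<diamondop> id2 C i = (id2 C g \<diamondop> ?r f) \<diamondop> id2 C i"
    by (intro vcomp_right_cancel[OF _ _ _ _ _ _ eq]) (use ty r in simp_all)
  then show "(?r (g \<star> f) \<cdot> ?a g f (id1 C (src1 C f))) \<diamondop>
      id2 C (id1 C (src1 C (src2 C (?r (g \<star> f) \<cdot> ?a g f (id1 C (src1 C f)))))) =
    (id2 C g \<diamondop> ?r f) \<diamondop>
      id2 C (id1 C (src1 C (src2 C (?r (g \<star> f) \<cdot> ?a g f (id1 C (src1 C f))))))"
    using ty by simp
qed (use assms in simp_all)

text \<open>Naturality of \<open>lunitor\<close> at its own component, \<open>lunitor_hcomp\<close>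
  and the triangle identity show that the two unit isomorphisms agree after whiskering with i. The
  equality is what makes degenerate triangles compatible with composites of simplicial
  operators.\<close>

lemma lunitor_id1_eq_runitor_id1:
  assumes x: "x \<in> topspace (Obj C)"
  shows "lunitor C (id1 C x) = runitor C (id1 C x)"
proof -
  define i where "i = id1 C x"
  have ty: "i \<in> topspace (Mor C)" "src1 C i = x" "tgt1 C i = x" "id1 C x = i" using x by (simp_all add: i_def)
  have s: "src2 C (lunitor C i) = i \<star> i" "src2 C (runitor C i) = i \<star> i"
    using ty by simp_all
  have "lunitor C i \<cdot> (id2 C i \<diamondop> lunitor C i) = lunitor C i \<cdot> lunitor C (i \<star> i)"
    using lunitor_natural[of "lunitor C i"] ty s by simp
  then have "id2 C i \<diamondop> lunitor C i = lunitor C (i \<star> i)"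
    by (rule vcomp_left_cancel[rotated -1]) (use ty s in simp_all)
  moreover have "(lunitor C i \<diamondop> id2 C i) \<cdot> associator C i i i = lunitor C (i \<star> i)"
    using lunitor_hcomp[of i i] ty by simp
  moreover have "(runitor C i \<diamondop> id2 C i) \<cdot> associator C i i i = id2 C i \<diamondop> lunitor C i"
    using triangle[of i i] ty by simp
  ultimately have "(lunitor C i \<diamondop> id2 C i) \<cdot> associator C i i i = (runitor C i \<diamondop> id2 C i) \<cdot> associator C i i i"
    by metis
  then have eq: "lunitor C i \<diamondop> id2 C i = runitor C i \<diamondop> id2 C i"
    by (rule vcomp_right_cancel[rotated -1]) (use ty s in simp_all)
  have i: "id1 C (src1 C (src2 C (lunitor C i))) = i" using ty s by simp
  have "lunitor C i = runitor C i"
  proof (rule whisker_right_id1_cancel)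
    show "lunitor C i \<diamondop> id2 C (id1 C (src1 C (src2 C (lunitor C i)))) =
        runitor C i \<diamondop> id2 C (id1 C (src1 C (src2 C (lunitor C i))))"
      unfolding i by (rule eq)
  qed (use ty s in simp_all)
  then show ?thesis by (simp add: i_def)
qed

section \<open>Tetrahedron equations with two equal vertices\<close>

text \<open>The case i = j of the equation on i, j, k, l. After composing with a right unit
  isomorphism both sides become \<open>z\<close>, the left one by \<open>runitor_hcomp\<close> and
  the right one by naturality.\<close>

lemma tetrahedron_runitor:
  assumes ty: "f \<in> topspace (Mor C)" "g \<in> topspace (Mor C)" "src1 C g = tgt1 C f"
    and z: "z \<in> topspace (Cell C)" "src2 C z = h" "tgt2 C z = g \<star> f"
  shows "associator C g f (id1 C (src1 C f)) \<cdot> (id2 C g \<diamondop> vinv C (runitor C f)) \<cdot> z =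
    (z \<diamondop> id2 C (id1 C (src1 C f))) \<cdot> vinv C (runitor C h)"
proof (rule vcomp_left_cancel[of "runitor C (g \<star> f)"])
  let ?i = "id1 C (src1 C f)" and ?r = "runitor C"
  have h: "h \<in> topspace (Mor C)" "src1 C h = src1 C f" "tgt1 C h = tgt1 C g"
    using z ty globular_src[OF z(1)] globular_tgt[OF z(1)] src2[OF z(1)] by auto
  note ty = ty z h
  have "?r (g \<star> f) \<cdot> (associator C g f ?i \<cdot> (id2 C g \<diamondop> vinv C (?r f)) \<cdot> z) =
      (?r (g \<star> f) \<cdot> associator C g f ?i) \<cdot> ((id2 C g \<diamondop> vinv C (?r f)) \<cdot> z)"
    using ty by (simp add: vcomp_assoc)
  also have "\<dots> = ((id2 C g \<diamondop> ?r f) \<cdot> (id2 C g \<diamondop> vinv C (?r f))) \<cdot> z"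
    using ty by (simp add: runitor_hcomp vcomp_assoc)
  also have "\<dots> = z"
    using ty by (simp flip: whisker_left_vcomp) (simp add: hcomp_id)
  also have "\<dots> = (z \<cdot> ?r h) \<cdot> vinv C (?r h)"
    using ty by (simp add: vcomp_assoc)
  also have "z \<cdot> ?r h = ?r (g \<star> f) \<cdot> (z \<diamondop> id2 C ?i)"
    using runitor_natural[of z] ty by simp
  also have "\<dots> \<cdot> vinv C (?r h) = ?r (g \<star> f) \<cdot> ((z \<diamondop> id2 C ?i) \<cdot> vinv C (?r h))"
    using ty by (simp add: vcomp_assoc)
  finally show "?r (g \<star> f) \<cdot> (associator C g f ?i \<cdot> (id2 C g \<diamondop> vinv C (?r f)) \<cdot> z) =
    ?r (g \<star> f) \<cdot> ((z \<diamondop> id2 C ?i) \<cdot> vinv C (?r h))" .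
  show "?r (g \<star> f) \<in> topspace (Cell C)" "vinvertible C (?r (g \<star> f))"
    "associator C g f ?i \<cdot> (id2 C g \<diamondop> vinv C (?r f)) \<cdot> z \<in> topspace (Cell C)"
    "(z \<diamondop> id2 C ?i) \<cdot> vinv C (?r h) \<in> topspace (Cell C)"
    "tgt2 C (associator C g f ?i \<cdot> (id2 C g \<diamondop> vinv C (?r f)) \<cdot> z) = src2 C (?r (g \<star> f))"
    "tgt2 C ((z \<diamondop> id2 C ?i) \<cdot> vinv C (?r h)) = src2 C (?r (g \<star> f))"
    using ty by simp_all
qed

text \<open>The case j = k. This is the triangle identity with its unit isomorphisms inverted,
  composed with \<open>z\<close>.\<close>

lemma tetrahedron_lunitor_runitor:
  assumes ty: "f \<in> topspace (Mor C)" "g \<in> topspace (Mor C)" "src1 C g = tgt1 C f"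
    and z: "z \<in> topspace (Cell C)" "tgt2 C z = g \<star> f"
  shows "associator C g (id1 C (tgt1 C f)) f \<cdot> (id2 C g \<diamondop> vinv C (lunitor C f)) \<cdot> z =
    (vinv C (runitor C g) \<diamondop> id2 C f) \<cdot> z"
proof -
  let ?i = "id1 C (tgt1 C f)"
  have "associator C g ?i f \<cdot> (id2 C g \<diamondop> vinv C (lunitor C f)) = vinv C (runitor C g) \<diamondop> id2 C f"
  proof (rule vcomp_left_cancel[of "runitor C g \<diamondop> id2 C f"])
    have "(runitor C g \<diamondop> id2 C f) \<cdot> (associator C g ?i f \<cdot> (id2 C g \<diamondop> vinv C (lunitor C f))) =
        (id2 C g \<diamondop> lunitor C f) \<cdot> (id2 C g \<diamondop> vinv C (lunitor C f))"
      by (rule vcomp_rewrite[OF triangle]) (use ty in simp_all)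
    also have "\<dots> = (runitor C g \<diamondop> id2 C f) \<cdot> (vinv C (runitor C g) \<diamondop> id2 C f)"
      using ty by (simp flip: whisker_left_vcomp whisker_right_vcomp)
    finally show "(runitor C g \<diamondop> id2 C f) \<cdot> (associator C g ?i f \<cdot> (id2 C g \<diamondop> vinv C (lunitor C f))) =
        (runitor C g \<diamondop> id2 C f) \<cdot> (vinv C (runitor C g) \<diamondop> id2 C f)" .
    show "vinvertible C (runitor C g \<diamondop> id2 C f)"
      using ty by (intro vinvertible_hcomp vinvertible_id2) simp_all
  qed (use ty in simp_all)
  then show ?thesis by simp
qed

text \<open>The case k = l. After composing with a whiskered left unit isomorphism both sides become
  \<open>z\<close>, the left one by \<open>lunitor_hcomp\<close> and naturality.\<close>

lemma tetrahedron_lunitor: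
  assumes ty: "f \<in> topspace (Mor C)" "g \<in> topspace (Mor C)" "src1 C g = tgt1 C f"
    and z: "z \<in> topspace (Cell C)" "src2 C z = h" "tgt2 C z = g \<star> f"
  shows "associator C (id1 C (tgt1 C g)) g f \<cdot> (id2 C (id1 C (tgt1 C g)) \<diamondop> z) \<cdot> vinv C (lunitor C h) =
    (vinv C (lunitor C g) \<diamondop> id2 C f) \<cdot> z"
proof (rule vcomp_left_cancel[of "lunitor C g \<diamondop> id2 C f"])
  let ?i = "id1 C (tgt1 C g)" and ?l = "lunitor C"
  have h: "h \<in> topspace (Mor C)" "src1 C h = src1 C f" "tgt1 C h = tgt1 C g"
    using z ty globular_src[OF z(1)] globular_tgt[OF z(1)] src2[OF z(1)] by auto
  note ty = ty z h
  have "(?l g \<diamondop> id2 C f) \<cdot> (associator C ?i g f \<cdot> (id2 C ?i \<diamondop> z) \<cdot> vinv C (?l h)) =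
      ((?l g \<diamondop> id2 C f) \<cdot> associator C ?i g f) \<cdot> ((id2 C ?i \<diamondop> z) \<cdot> vinv C (?l h))"
    using ty by (simp add: vcomp_assoc)
  also have "\<dots> = (?l (g \<star> f) \<cdot> (id2 C ?i \<diamondop> z)) \<cdot> vinv C (?l h)"
    using ty by (simp add: lunitor_hcomp vcomp_assoc)
  also have "?l (g \<star> f) \<cdot> (id2 C ?i \<diamondop> z) = z \<cdot> ?l h"
    using lunitor_natural[of z] ty by simp
  also have "z \<cdot> ?l h \<cdot> vinv C (?l h) = z"
    using ty by (simp add: vcomp_assoc)
  also have "z = ((?l g \<diamondop> id2 C f) \<cdot> (vinv C (?l g) \<diamondop> id2 C f)) \<cdot> z"
    using ty by (simp flip: whisker_right_vcomp) (simp add: hcomp_id)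
  also have "\<dots> = (?l g \<diamondop> id2 C f) \<cdot> ((vinv C (?l g) \<diamondop> id2 C f) \<cdot> z)"
    using ty by (simp add: vcomp_assoc)
  finally show "(?l g \<diamondop> id2 C f) \<cdot> (associator C ?i g f \<cdot> (id2 C ?i \<diamondop> z) \<cdot> vinv C (?l h)) =
    (?l g \<diamondop> id2 C f) \<cdot> ((vinv C (?l g) \<diamondop> id2 C f) \<cdot> z)" .
  show "vinvertible C (?l g \<diamondop> id2 C f)"
    using ty by (intro vinvertible_hcomp vinvertible_id2) simp_all
  show "?l g \<diamondop> id2 C f \<in> topspace (Cell C)"
    "associator C ?i g f \<cdot> (id2 C ?i \<diamondop> z) \<cdot> vinv C (?l h) \<in> topspace (Cell C)"
    "(vinv C (?l g) \<diamondop> id2 C f) \<cdot> z \<in> topspace (Cell C)"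
    "tgt2 C (associator C ?i g f \<cdot> (id2 C ?i \<diamondop> z) \<cdot> vinv C (?l h)) = src2 C (?l g \<diamondop> id2 C f)"
    "tgt2 C ((vinv C (?l g) \<diamondop> id2 C f) \<cdot> z) = src2 C (?l g \<diamondop> id2 C f)"
    using ty by simp_all
qed

text \<open>The faces of a 4-simplex on \<open>i, j, k, m, n\<close>: four of its five tetrahedra imply the remaining one.\<close>

lemma tetrahedron_from_pentagon:
  fixes yij yik yim yin yjk yjm yjn ykm ykn ymn :: 'm
  assumes mor: "yij \<in> topspace (Mor C)" "yik \<in> topspace (Mor C)" "yim \<in> topspace (Mor C)"
      "yin \<in> topspace (Mor C)" "yjk \<in> topspace (Mor C)" "yjm \<in> topspace (Mor C)"
      "yjn \<in> topspace (Mor C)" "ykm \<in> topspace (Mor C)" "ykn \<in> topspace (Mor C)"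
      "ymn \<in> topspace (Mor C)"
    and src: "src1 C yij = xi" "src1 C yik = xi" "src1 C yim = xi" "src1 C yin = xi"
      "src1 C yjk = xj" "src1 C yjm = xj" "src1 C yjn = xj" "src1 C ykm = xk" "src1 C ykn = xk"
      "src1 C ymn = xm"
    and tgt: "tgt1 C yij = xj" "tgt1 C yik = xk" "tgt1 C yim = xm" "tgt1 C yin = xn"
      "tgt1 C yjk = xk" "tgt1 C yjm = xm" "tgt1 C yjn = xn" "tgt1 C ykm = xm" "tgt1 C ykn = xn"
      "tgt1 C ymn = xn"
    and cell: "zijk \<in> topspace (Cell C)" "zijm \<in> topspace (Cell C)" "zijn \<in> topspace (Cell C)"
      "zikm \<in> topspace (Cell C)" "zikn \<in> topspace (Cell C)" "zimn \<in> topspace (Cell C)"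
      "zjkm \<in> topspace (Cell C)" "zjkn \<in> topspace (Cell C)" "zjmn \<in> topspace (Cell C)"
      "zkmn \<in> topspace (Cell C)"
    and s2: "src2 C zijk = yik" "src2 C zijm = yim" "src2 C zijn = yin" "src2 C zikm = yim"
      "src2 C zikn = yin" "src2 C zimn = yin" "src2 C zjkm = yjm" "src2 C zjkn = yjn"
      "src2 C zjmn = yjn" "src2 C zkmn = ykn"
    and t2: "tgt2 C zijk = yjk \<star> yij" "tgt2 C zijm = yjm \<star> yij" "tgt2 C zijn = yjn \<star> yij"
      "tgt2 C zikm = ykm \<star> yik" "tgt2 C zikn = ykn \<star> yik" "tgt2 C zimn = ymn \<star> yim"
      "tgt2 C zjkm = ykm \<star> yjk" "tgt2 C zjkn = ykn \<star> yjk" "tgt2 C zjmn = ymn \<star> yjm"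
      "tgt2 C zkmn = ymn \<star> ykm"
    and invertible: "vinvertible C zkmn"
    and ijkm: "associator C ykm yjk yij \<cdot> (id2 C ykm \<diamondop> zijk) \<cdot> zikm = (zjkm \<diamondop> id2 C yij) \<cdot> zijm"
    and ijmn: "associator C ymn yjm yij \<cdot> (id2 C ymn \<diamondop> zijm) \<cdot> zimn = (zjmn \<diamondop> id2 C yij) \<cdot> zijn"
    and ikmn: "associator C ymn ykm yik \<cdot> (id2 C ymn \<diamondop> zikm) \<cdot> zimn = (zkmn \<diamondop> id2 C yik) \<cdot> zikn"
    and jkmn: "associator C ymn ykm yjk \<cdot> (id2 C ymn \<diamondop> zjkm) \<cdot> zjmn = (zkmn \<diamondop> id2 C yjk) \<cdot> zjkn"
  shows "associator C ykn yjk yij \<cdot> (id2 C ykn \<diamondop> zijk) \<cdot> zikn = (zjkn \<diamondop> id2 C yij) \<cdot> zijn"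
proof (rule vcomp_left_cancel[of "(zkmn \<diamondop> id2 C yjk) \<diamondop> id2 C yij"])
  note ty [simp] = mor src tgt cell s2 t2
  let ?a = "associator C" and ?i = "id2 C"
  \<comment> \<open>Composition with the invertible cell \<open>?T\<close> makes the pentagon
    applicable: both sides turn into \<open>(?A \<cdot> ?B) \<cdot> ?w\<close>. The left side gets
    there by \<open>ikmn\<close>, the right side by \<open>jkmn\<close>, \<open>ijmn\<close>,
    \<open>ijkm\<close> and the pentagon for the edges ij, jk, km, mn.\<close>
  let ?T = "(zkmn \<diamondop> ?i yjk) \<diamondop> ?i yij"
  let ?A = "?a (ymn \<star> ykm) yjk yij" and ?B = "?a ymn ykm (yjk \<star> yij)"
  let ?w = "(?i ymn \<diamondop> (?i ykm \<diamondop> zijk)) \<cdot> ((?i ymn \<diamondop> zikm) \<cdot> zimn)"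
  have "?T \<cdot> (?a ykn yjk yij \<cdot> (?i ykn \<diamondop> zijk) \<cdot> zikn) =
      (?T \<cdot> ?a ykn yjk yij) \<cdot> ((?i ykn \<diamondop> zijk) \<cdot> zikn)"
    by (simp add: vcomp_assoc)
  also have "?T \<cdot> ?a ykn yjk yij = ?A \<cdot> (zkmn \<diamondop> ?i (yjk \<star> yij))"
    using associator_whisker_right[of zkmn yij yjk] by simp
  also have "?A \<cdot> (zkmn \<diamondop> ?i (yjk \<star> yij)) \<cdot> ((?i ykn \<diamondop> zijk) \<cdot> zikn) =
      ?A \<cdot> (((zkmn \<diamondop> ?i (yjk \<star> yij)) \<cdot> (?i ykn \<diamondop> zijk)) \<cdot> zikn)"
    by (simp add: vcomp_assoc)
  also have "(zkmn \<diamondop> ?i (yjk \<star> yij)) \<cdot> (?i ykn \<diamondop> zijk) =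
      (?i (ymn \<star> ykm) \<diamondop> zijk) \<cdot> (zkmn \<diamondop> ?i yik)"
    using whisker_exchange[of zijk zkmn] by simp
  also have "(?i (ymn \<star> ykm) \<diamondop> zijk) \<cdot> (zkmn \<diamondop> ?i yik) \<cdot> zikn =
      (?i (ymn \<star> ykm) \<diamondop> zijk) \<cdot> (?a ymn ykm yik \<cdot> (?i ymn \<diamondop> zikm) \<cdot> zimn)"
    unfolding ikmn by (simp add: vcomp_assoc)
  also have "\<dots> = ((?i (ymn \<star> ykm) \<diamondop> zijk) \<cdot> ?a ymn ykm yik) \<cdot> ((?i ymn \<diamondop> zikm) \<cdot> zimn)"
    by (simp add: vcomp_assoc)
  also have "(?i (ymn \<star> ykm) \<diamondop> zijk) \<cdot> ?a ymn ykm yik = ?B \<cdot> (?i ymn \<diamondop> (?i ykm \<diamondop> zijk))"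
    using associator_whisker_left[of zijk ykm ymn] by simp
  also have "?A \<cdot> (?B \<cdot> (?i ymn \<diamondop> (?i ykm \<diamondop> zijk)) \<cdot> ((?i ymn \<diamondop> zikm) \<cdot> zimn)) = (?A \<cdot> ?B) \<cdot> ?w"
    by (simp add: vcomp_assoc)
  finally have left: "?T \<cdot> (?a ykn yjk yij \<cdot> (?i ykn \<diamondop> zijk) \<cdot> zikn) = (?A \<cdot> ?B) \<cdot> ?w" .
  have "?T \<cdot> ((zjkn \<diamondop> ?i yij) \<cdot> zijn) = (((zkmn \<diamondop> ?i yjk) \<cdot> zjkn) \<diamondop> ?i yij) \<cdot> zijn"
    by (simp add: whisker_right_vcomp vcomp_assoc)
  also have "\<dots> = ((?a ymn ykm yjk \<diamondop> ?i yij) \<cdot> ((?i ymn \<diamondop> zjkm) \<diamondop> ?i yij)) \<cdot> ((zjmn \<diamondop> ?i yij) \<cdot> zijn)"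
    unfolding jkmn[symmetric] by (simp add: whisker_right_vcomp vcomp_assoc)
  also have "\<dots> = (?a ymn ykm yjk \<diamondop> ?i yij) \<cdot>
      ((((?i ymn \<diamondop> zjkm) \<diamondop> ?i yij) \<cdot> ?a ymn yjm yij) \<cdot> ((?i ymn \<diamondop> zijm) \<cdot> zimn))"
    unfolding ijmn[symmetric] by (simp add: vcomp_assoc)
  also have "((?i ymn \<diamondop> zjkm) \<diamondop> ?i yij) \<cdot> ?a ymn yjm yij =
      ?a ymn (ykm \<star> yjk) yij \<cdot> (?i ymn \<diamondop> (zjkm \<diamondop> ?i yij))"
    using associator_whisker_middle[of zjkm yij ymn] by simp
  also have "?a ymn (ykm \<star> yjk) yij \<cdot> (?i ymn \<diamondop> (zjkm \<diamondop> ?i yij)) \<cdot> ((?i ymn \<diamondop> zijm) \<cdot> zimn) =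
      ?a ymn (ykm \<star> yjk) yij \<cdot> ((?i ymn \<diamondop> ((zjkm \<diamondop> ?i yij) \<cdot> zijm)) \<cdot> zimn)"
    by (simp add: whisker_left_vcomp vcomp_assoc)
  also have "(?i ymn \<diamondop> ((zjkm \<diamondop> ?i yij) \<cdot> zijm)) \<cdot> zimn = (?i ymn \<diamondop> ?a ykm yjk yij) \<cdot> ?w"
    unfolding ijkm[symmetric] by (simp add: whisker_left_vcomp vcomp_assoc)
  also have "(?a ymn ykm yjk \<diamondop> ?i yij) \<cdot> (?a ymn (ykm \<star> yjk) yij \<cdot> ((?i ymn \<diamondop> ?a ykm yjk yij) \<cdot> ?w)) =
      ((?a ymn ykm yjk \<diamondop> ?i yij) \<cdot> ?a ymn (ykm \<star> yjk) yij \<cdot> (?i ymn \<diamondop> ?a ykm yjk yij)) \<cdot> ?w"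
    by (simp add: vcomp_assoc)
  also have "(?a ymn ykm yjk \<diamondop> ?i yij) \<cdot> ?a ymn (ykm \<star> yjk) yij \<cdot> (?i ymn \<diamondop> ?a ykm yjk yij) = ?A \<cdot> ?B"
    using pentagon[of yij yjk ykm ymn] by simp
  finally show "?T \<cdot> (?a ykn yjk yij \<cdot> (?i ykn \<diamondop> zijk) \<cdot> zikn) = ?T \<cdot> ((zjkn \<diamondop> ?i yij) \<cdot> zijn)"
    using left by simp
  show "vinvertible C ?T"
    using invertible by (intro vinvertible_hcomp vinvertible_id2) simp_all
qed (use mor src tgt cell s2 t2 in simp_all)

end

section \<open>The nerve\<close>

lemma nerve_map_simps:
  "fst (nerve_map C m n \<phi> s) = (\<lambda>i\<in>{..m}. fst s (\<phi> i))"
  "fst (snd (nerve_map C m n \<phi> s)) = (\<lambda>(i, j)\<in>edges m. edge_at C s (\<phi> i) (\<phi> j))"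
  "snd (snd (nerve_map C m n \<phi> s)) = (\<lambda>(i, j, k)\<in>triangles m. triangle_at C s (\<phi> i) (\<phi> j) (\<phi> k))"
  by (simp_all add: nerve_map_def)

lemma edge_at_simps:
  "edge_at C s i i = id1 C (fst s i)"
  "i < j \<Longrightarrow> edge_at C s i j = fst (snd s) (i, j)"
  by (simp_all add: edge_at_def case_prod_unfold)

lemma triangle_at_simps:
  "triangle_at C s i i k = vinv C (runitor C (edge_at C s i k))"
  "i < j \<Longrightarrow> triangle_at C s i j j = vinv C (lunitor C (edge_at C s i j))"
  "i < j \<Longrightarrow> j < k \<Longrightarrow> triangle_at C s i j k = snd (snd s) (i, j, k)"
  by (simp_all add: triangle_at_def case_prod_unfold)

lemma topspace_nerve:
  "s \<in> topspace (nerve C n) \<longleftrightarrow>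
    fst s \<in> {..n} \<rightarrow>\<^sub>E topspace (Obj C) \<and> fst (snd s) \<in> edges n \<rightarrow>\<^sub>E topspace (Mor C) \<and>
    snd (snd s) \<in> triangles n \<rightarrow>\<^sub>E topspace (Cell C) \<and> s \<in> nerve_simplices C n"
  by (cases s) (auto simp: nerve_def)

context bicategory
begin

lemma nerve_simplexD:
  assumes "s \<in> topspace (nerve C n)"
  shows nerve_vertex: "i \<le> n \<Longrightarrow> fst s i \<in> topspace (Obj C)"
    and nerve_edge: "i < j \<Longrightarrow> j \<le> n \<Longrightarrow> fst (snd s) (i, j) \<in> topspace (Mor C)"
    and nerve_edge_src1: "i < j \<Longrightarrow> j \<le> n \<Longrightarrow> src1 C (fst (snd s) (i, j)) = fst s i"
    and nerve_edge_tgt1: "i < j \<Longrightarrow> j \<le> n \<Longrightarrow> tgt1 C (fst (snd s) (i, j)) = fst s j"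
    and nerve_triangle: "i < j \<Longrightarrow> j < k \<Longrightarrow> k \<le> n \<Longrightarrow> snd (snd s) (i, j, k) \<in> topspace (Cell C)"
    and nerve_triangle_src2: "i < j \<Longrightarrow> j < k \<Longrightarrow> k \<le> n \<Longrightarrow>
      src2 C (snd (snd s) (i, j, k)) = fst (snd s) (i, k)"
    and nerve_triangle_tgt2: "i < j \<Longrightarrow> j < k \<Longrightarrow> k \<le> n \<Longrightarrow>
      tgt2 C (snd (snd s) (i, j, k)) = fst (snd s) (j, k) \<star> fst (snd s) (i, j)"
    and nerve_tetrahedron: "i < j \<Longrightarrow> j < k \<Longrightarrow> k < l \<Longrightarrow> l \<le> n \<Longrightarrow>
      associator C (fst (snd s) (k, l)) (fst (snd s) (j, k)) (fst (snd s) (i, j)) \<cdot>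
        (id2 C (fst (snd s) (k, l)) \<diamondop> snd (snd s) (i, j, k)) \<cdot> snd (snd s) (i, k, l) =
      (snd (snd s) (j, k, l) \<diamondop> id2 C (fst (snd s) (i, j))) \<cdot> snd (snd s) (i, j, l)"
proof -
  have "fst s \<in> {..n} \<rightarrow> topspace (Obj C)" "fst (snd s) \<in> edges n \<rightarrow> topspace (Mor C)"
    "snd (snd s) \<in> triangles n \<rightarrow> topspace (Cell C)"
    using assms by (auto simp: topspace_nerve)
  then show "i \<le> n \<Longrightarrow> fst s i \<in> topspace (Obj C)"
    "i < j \<Longrightarrow> j \<le> n \<Longrightarrow> fst (snd s) (i, j) \<in> topspace (Mor C)"
    "i < j \<Longrightarrow> j < k \<Longrightarrow> k \<le> n \<Longrightarrow> snd (snd s) (i, j, k) \<in> topspace (Cell C)"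
    by (auto simp: edges_def triangles_def Pi_iff)
  show "i < j \<Longrightarrow> j \<le> n \<Longrightarrow> src1 C (fst (snd s) (i, j)) = fst s i"
    "i < j \<Longrightarrow> j \<le> n \<Longrightarrow> tgt1 C (fst (snd s) (i, j)) = fst s j"
    "i < j \<Longrightarrow> j < k \<Longrightarrow> k \<le> n \<Longrightarrow> src2 C (snd (snd s) (i, j, k)) = fst (snd s) (i, k)"
    "i < j \<Longrightarrow> j < k \<Longrightarrow> k \<le> n \<Longrightarrow>
      tgt2 C (snd (snd s) (i, j, k)) = fst (snd s) (j, k) \<star> fst (snd s) (i, j)"
    "i < j \<Longrightarrow> j < k \<Longrightarrow> k < l \<Longrightarrow> l \<le> n \<Longrightarrow>
      associator C (fst (snd s) (k, l)) (fst (snd s) (j, k)) (fst (snd s) (i, j)) \<cdot>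
        (id2 C (fst (snd s) (k, l)) \<diamondop> snd (snd s) (i, j, k)) \<cdot> snd (snd s) (i, k, l) =
      (snd (snd s) (j, k, l) \<diamondop> id2 C (fst (snd s) (i, j))) \<cdot> snd (snd s) (i, j, l)"
    using assms unfolding topspace_nerve nerve_simplices_def case_prod_unfold by simp_all
qed

lemma nerve_simplexI:
  assumes "x \<in> {..n} \<rightarrow>\<^sub>E topspace (Obj C)"
    and "y \<in> edges n \<rightarrow>\<^sub>E topspace (Mor C)"
    and "z \<in> triangles n \<rightarrow>\<^sub>E topspace (Cell C)"
    and "\<And>i j. i < j \<Longrightarrow> j \<le> n \<Longrightarrow> src1 C (y (i, j)) = x i"
    and "\<And>i j. i < j \<Longrightarrow> j \<le> n \<Longrightarrow> tgt1 C (y (i, j)) = x j"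
    and "\<And>i j k. i < j \<Longrightarrow> j < k \<Longrightarrow> k \<le> n \<Longrightarrow> src2 C (z (i, j, k)) = y (i, k)"
    and "\<And>i j k. i < j \<Longrightarrow> j < k \<Longrightarrow> k \<le> n \<Longrightarrow> tgt2 C (z (i, j, k)) = y (j, k) \<star> y (i, j)"
    and "\<And>i j k l. i < j \<Longrightarrow> j < k \<Longrightarrow> k < l \<Longrightarrow> l \<le> n \<Longrightarrow>
      associator C (y (k, l)) (y (j, k)) (y (i, j)) \<cdot> (id2 C (y (k, l)) \<diamondop> z (i, j, k)) \<cdot> z (i, k, l) =
      (z (j, k, l) \<diamondop> id2 C (y (i, j))) \<cdot> z (i, j, l)"
  shows "(x, y, z) \<in> topspace (nerve C n)"
  using assms unfolding topspace_nerve nerve_simplices_def by simp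

section \<open>Simplex data at weakly increasing indices\<close>

lemma edge_at:
  assumes s: "s \<in> topspace (nerve C n)" and "i \<le> j" "j \<le> n"
  shows "edge_at C s i j \<in> topspace (Mor C)" "src1 C (edge_at C s i j) = fst s i"
    "tgt1 C (edge_at C s i j) = fst s j"
  using nerve_vertex[OF s, of i] nerve_edge[OF s, of i j] nerve_edge_src1[OF s, of i j]
    nerve_edge_tgt1[OF s, of i j] assms(2,3)
  by (cases "i = j"; simp add: edge_at_simps)+

lemma triangle_at:
  assumes s: "s \<in> topspace (nerve C n)" and le: "i \<le> j" "j \<le> k" "k \<le> n"
  shows "triangle_at C s i j k \<in> topspace (Cell C)"
    and "src2 C (triangle_at C s i j k) = edge_at C s i k"
    and "tgt2 C (triangle_at C s i j k) = edge_at C s j k \<star> edge_at C s i j"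
proof -
  note e = edge_at[OF s]
  have "triangle_at C s i j k \<in> topspace (Cell C) \<and> src2 C (triangle_at C s i j k) = edge_at C s i k \<and>
      tgt2 C (triangle_at C s i j k) = edge_at C s j k \<star> edge_at C s i j"
  proof -
    consider "i = j" | "i < j" "j = k" | "i < j" "j < k" using le by linarith
    then show ?thesis
    proof cases
      case 1
      then show ?thesis using e[of i k] le by (simp add: triangle_at_simps edge_at_simps(1))
    next
      case 2
      then show ?thesis using e[of i j] le by (simp add: triangle_at_simps edge_at_simps(1))
    next
      case 3
      then show ?thesis
        using nerve_triangle[OF s 3] nerve_triangle_src2[OF s 3] nerve_triangle_tgt2[OF s 3] le
        by (simp add: triangle_at_simps edge_at_simps(2))
    qed
  qed
  then show "triangle_at C s i j k \<in> topspace (Cell C)"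
    and "src2 C (triangle_at C s i j k) = edge_at C s i k"
    and "tgt2 C (triangle_at C s i j k) = edge_at C s j k \<star> edge_at C s i j"
    by blast+
qed

text \<open>A simplicial operator may identify vertices, so closure of the nerve under it needs the
  equation for repeated indices too; these are the three degenerate cases above.\<close>

lemma tetrahedron_at:
  assumes s: "s \<in> topspace (nerve C n)" and le: "i \<le> j" "j \<le> k" "k \<le> l" "l \<le> n"
  shows "associator C (edge_at C s k l) (edge_at C s j k) (edge_at C s i j) \<cdot>
      (id2 C (edge_at C s k l) \<diamondop> triangle_at C s i j k) \<cdot> triangle_at C s i k l =
    (triangle_at C s j k l \<diamondop> id2 C (edge_at C s i j)) \<cdot> triangle_at C s i j l"
proof -
  note e = edge_at[OF s] and t = triangle_at[OF s]
  consider "i = j" | "i < j" "j = k" | "i < j" "j < k" "k = l" | "i < j" "j < k" "k < l"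
    using le by linarith
  then show ?thesis
  proof cases
    case 1
    then show ?thesis
      using tetrahedron_runitor[of "edge_at C s j k" "edge_at C s k l" "triangle_at C s j k l" "edge_at C s j l"]
        e[of j k] e[of k l] t[of j k l] le by (simp add: triangle_at_simps(1) edge_at_simps(1))
  next
    case 2
    then show ?thesis
      using tetrahedron_lunitor_runitor[of "edge_at C s i j" "edge_at C s k l" "triangle_at C s i j l"]
        e[of i j] e[of k l] t[of i j l] le by (simp add: triangle_at_simps(1,2) edge_at_simps(1))
  next
    case 3
    then show ?thesis
      using tetrahedron_lunitor[of "edge_at C s i j" "edge_at C s j k" "triangle_at C s i j k" "edge_at C s i k"]
        e[of i j] e[of j k] t[of i j k] le by (simp add: triangle_at_simps(2) edge_at_simps(1))
  next
    case 4
    then show ?thesis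
      using nerve_tetrahedron[OF s 4 le(4)] by (simp add: triangle_at_simps edge_at_simps(2))
  qed
qed

lemma nerve_map_nerve:
  assumes \<phi>: "simplex_map m n \<phi>" and s: "s \<in> topspace (nerve C n)"
  shows "nerve_map C m n \<phi> s \<in> topspace (nerve C m)"
proof -
  have mono: "\<phi> i \<le> \<phi> j" if "i < j" "j \<le> m" for i j
    using \<phi> that by (auto simp: simplex_map_def mono_on_def)
  have range: "\<phi> i \<le> n" if "i \<le> m" for i
    using \<phi> that by (auto simp: simplex_map_def)
  note e = edge_at[OF s mono range] and t = triangle_at[OF s mono mono range]
  show ?thesis
    unfolding nerve_map_def
  proof (rule nerve_simplexI, goal_cases)
    case 1
    then show ?case using nerve_vertex[OF s] range by auto
  next
    case 2
    then show ?case using e by (auto simp: edges_def)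
  next
    case 3
    then show ?case using t by (auto simp: triangles_def)
  next
    case (8 i j k l)
    then show ?case
      using tetrahedron_at[OF s mono mono mono range, of i j k l]
      by (simp add: edges_def triangles_def)
  qed (use e t in \<open>simp_all add: edges_def triangles_def\<close>)
qed

lemma edge_at_nerve_map:
  assumes "i \<le> j" "j \<le> m"
  shows "edge_at C (nerve_map C m n \<phi> s) i j = edge_at C s (\<phi> i) (\<phi> j)"
  using assms by (cases "i = j") (simp_all add: edge_at_simps nerve_map_simps edges_def)

lemma triangle_at_nerve_map:
  assumes \<phi>: "simplex_map m n \<phi>" and s: "s \<in> topspace (nerve C n)" and le: "i \<le> j" "j \<le> k" "k \<le> m"
  shows "triangle_at C (nerve_map C m n \<phi> s) i j k = triangle_at C s (\<phi> i) (\<phi> j) (\<phi> k)"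
proof -
  consider "i = j" | "i < j" "j = k" | "i < j" "j < k" using le by linarith
  then show ?thesis
  proof cases
    case 1
    then show ?thesis using le by (simp add: triangle_at_simps(1) edge_at_nerve_map)
  next
    case 2
    \<comment> \<open>Here \<phi> may identify i and j although they differ. The left side then
      carries an inverse left unit isomorphism at an identity, the right side an inverse right
      one.\<close>
    have "\<phi> i \<le> \<phi> j" "\<phi> j \<le> n"
      using \<phi> 2 le by (auto simp: simplex_map_def mono_on_def)
    then show ?thesis
      using 2 le nerve_vertex[OF s, of "\<phi> j"]
      by (cases "\<phi> i = \<phi> j")
        (simp_all add: triangle_at_simps(1,2) edge_at_nerve_map edge_at_simps(1) lunitor_id1_eq_runitor_id1)
  next
    case 3
    then show ?thesis using le by (simp add: triangle_at_simps(3) nerve_map_simps triangles_def)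
  qed
qed

end

section \<open>Continuity of the simplicial operators\<close>

context topological_bicategory
begin

lemma continuous_map_vertex:
  assumes "i \<le> n"
  shows "continuous_map (nerve C n) (Obj C) (\<lambda>s. fst s i)"
  unfolding nerve_def using assms
  by (intro continuous_map_from_subtopology
      continuous_map_compose[OF continuous_map_fst continuous_map_product_projection, unfolded o_def]) simp

lemma continuous_map_edge:
  assumes "i < j" "j \<le> n"
  shows "continuous_map (nerve C n) (Mor C) (\<lambda>s. fst (snd s) (i, j))"
  unfolding nerve_def using assms
  by (intro continuous_map_from_subtopology
      continuous_map_compose[OF continuous_map_compose[OF continuous_map_snd continuous_map_fst]
        continuous_map_product_projection, unfolded o_def]) (simp add: edges_def)

lemma continuous_map_triangle:
  assumes "i < j" "j < k" "k \<le> n"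
  shows "continuous_map (nerve C n) (Cell C) (\<lambda>s. snd (snd s) (i, j, k))"
  unfolding nerve_def using assms
  by (intro continuous_map_from_subtopology
      continuous_map_compose[OF continuous_map_compose[OF continuous_map_snd continuous_map_snd]
        continuous_map_product_projection, unfolded o_def]) (simp add: triangles_def)

lemma continuous_map_edge_at:
  assumes "i \<le> j" "j \<le> n"
  shows "continuous_map (nerve C n) (Mor C) (\<lambda>s. edge_at C s i j)"
proof (cases "i = j")
  case True
  then show ?thesis
    using continuous_map_compose[OF continuous_map_vertex continuous_id1, of i n] assms
    by (simp add: edge_at_simps o_def)
next
  case False
  then show ?thesis using continuous_map_edge[of i j n] assms by (simp add: edge_at_simps)
qed

lemma continuous_map_triangle_at:
  assumes "i \<le> j" "j \<le> k" "k \<le> n"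
  shows "continuous_map (nerve C n) (Cell C) (\<lambda>s. triangle_at C s i j k)"
proof -
  consider "i = j" | "i < j" "j = k" | "i < j" "j < k" using assms by linarith
  then show ?thesis
  proof cases
    case 1
    then show ?thesis
      using continuous_map_compose[OF continuous_map_edge_at continuous_runitor_inv, of i k n] assms
      by (simp add: triangle_at_simps o_def)
  next
    case 2
    then show ?thesis
      using continuous_map_compose[OF continuous_map_edge_at continuous_lunitor_inv, of i j n] assms
      by (simp add: triangle_at_simps o_def)
  next
    case 3
    then show ?thesis using continuous_map_triangle[of i j k n] assms by (simp add: triangle_at_simps)
  qed
qed

lemma continuous_map_into_nerve:
  assumes "\<And>i. i \<le> n \<Longrightarrow> continuous_map X (Obj C) (\<lambda>w. x w i)"
    and "\<And>i j. i < j \<Longrightarrow> j \<le> n \<Longrightarrow> continuous_map X (Mor C) (\<lambda>w. y w (i, j))"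
    and "\<And>i j k. i < j \<Longrightarrow> j < k \<Longrightarrow> k \<le> n \<Longrightarrow> continuous_map X (Cell C) (\<lambda>w. z w (i, j, k))"
    and nerve: "\<And>w. w \<in> topspace X \<Longrightarrow> (x w, y w, z w) \<in> topspace (nerve C n)"
  shows "continuous_map X (nerve C n) (\<lambda>w. (x w, y w, z w))"
proof -
  have "x w \<in> extensional {..n}" "y w \<in> extensional (edges n)" "z w \<in> extensional (triangles n)"
    "(x w, y w, z w) \<in> nerve_simplices C n" if "w \<in> topspace X" for w
    using nerve[OF that] by (auto simp: topspace_nerve PiE_def)
  with assms(1-3) show ?thesis
    unfolding nerve_def continuous_map_in_subtopology
    by (intro conjI continuous_map_pairedI; simp add: continuous_map_componentwise image_subset_iff)
      (auto simp: edges_def triangles_def)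
qed

lemma simplicial_space_nerve: "simplicial_space (nerve C) (nerve_map C)"
proof
  fix m n \<phi> assume \<phi>: "simplex_map m n \<phi>"
  have mono: "\<phi> i \<le> \<phi> j" if "i < j" "j \<le> m" for i j
    using \<phi> that by (auto simp: simplex_map_def mono_on_def)
  have range: "\<phi> i \<le> n" if "i \<le> m" for i
    using \<phi> that by (auto simp: simplex_map_def)
  show "continuous_map (nerve C n) (nerve C m) (nerve_map C m n \<phi>)"
    unfolding nerve_map_def[abs_def]
  proof (rule continuous_map_into_nerve, goal_cases)
    case (4 s)
    then show ?case using nerve_map_nerve[OF \<phi>] by (simp add: nerve_map_def)
  qed (use continuous_map_vertex[OF range] continuous_map_edge_at[OF mono range]
        continuous_map_triangle_at[OF mono mono range] in \<open>simp_all add: edges_def triangles_def\<close>)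
next
  fix m n :: nat and \<phi> \<psi> :: "nat \<Rightarrow> nat" and s :: "('a, 'b, 'c) nerve_simplex"
  assume "\<And>i. i \<le> m \<Longrightarrow> \<phi> i = \<psi> i"
  then show "nerve_map C m n \<phi> s = nerve_map C m n \<psi> s"
    by (auto simp: nerve_map_def edges_def triangles_def intro!: restrict_ext)
next
  fix n :: nat and s :: "('a, 'b, 'c) nerve_simplex"
  assume s: "s \<in> topspace (nerve C n)"
  then have "(\<lambda>i\<in>{..n}. fst s i) = fst s" "restrict (fst (snd s)) (edges n) = fst (snd s)"
    "restrict (snd (snd s)) (triangles n) = snd (snd s)"
    by (auto simp: topspace_nerve PiE_def extensional_restrict)
  moreover have "(\<lambda>(i, j)\<in>edges n. edge_at C s (id i) (id j)) = restrict (fst (snd s)) (edges n)"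
    by (auto simp: edges_def edge_at_simps intro!: restrict_ext)
  moreover have "(\<lambda>(i, j, k)\<in>triangles n. triangle_at C s (id i) (id j) (id k)) =
      restrict (snd (snd s)) (triangles n)"
    by (auto simp: triangles_def triangle_at_simps intro!: restrict_ext)
  ultimately show "nerve_map C n n id s = s"
    by (simp add: nerve_map_def)
next
  fix l m n :: nat and \<phi> \<psi> :: "nat \<Rightarrow> nat" and s :: "('a, 'b, 'c) nerve_simplex"
  assume \<psi>: "simplex_map l m \<psi>" and \<phi>: "simplex_map m n \<phi>" and s: "s \<in> topspace (nerve C n)"
  have mono: "\<psi> i \<le> \<psi> j" if "i < j" "j \<le> l" for i j
    using \<psi> that by (auto simp: simplex_map_def mono_on_def)
  have range: "\<psi> i \<le> m" if "i \<le> l" for i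
    using \<psi> that by (auto simp: simplex_map_def)
  have "(\<lambda>i\<in>{..l}. fst s ((\<phi> \<circ> \<psi>) i)) = (\<lambda>i\<in>{..l}. fst (nerve_map C m n \<phi> s) (\<psi> i))"
    using range by (auto simp: nerve_map_simps intro!: restrict_ext)
  moreover have "(\<lambda>(i, j)\<in>edges l. edge_at C s ((\<phi> \<circ> \<psi>) i) ((\<phi> \<circ> \<psi>) j)) =
      (\<lambda>(i, j)\<in>edges l. edge_at C (nerve_map C m n \<phi> s) (\<psi> i) (\<psi> j))"
    by (auto simp: edges_def edge_at_nerve_map[OF mono range] intro!: restrict_ext)
  moreover have "(\<lambda>(i, j, k)\<in>triangles l. triangle_at C s ((\<phi> \<circ> \<psi>) i) ((\<phi> \<circ> \<psi>) j) ((\<phi> \<circ> \<psi>) k)) =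
      (\<lambda>(i, j, k)\<in>triangles l. triangle_at C (nerve_map C m n \<phi> s) (\<psi> i) (\<psi> j) (\<psi> k))"
    by (auto simp: triangles_def triangle_at_nerve_map[OF \<phi> s mono mono range] intro!: restrict_ext)
  ultimately show "nerve_map C l n (\<phi> \<circ> \<psi>) s = nerve_map C l m \<psi> (nerve_map C m n \<phi> s)"
    unfolding nerve_map_def[of C l] by simp
qed

end

section \<open>Extending a simplex by one vertex\<close>

context bicategory
begin

text \<open>
  The solution \<open>d\<close> of the tetrahedron equation
  \<open>associator C h g f \<cdot> (id2 C h \<diamondop> a) \<cdot> b = (c \<diamondop> id2 C f) \<cdot> d\<close>.
\<close>

definition tetrahedron_face :: "'m \<Rightarrow> 'm \<Rightarrow> 'm \<Rightarrow> 'c \<Rightarrow> 'c \<Rightarrow> 'c \<Rightarrow> 'c"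
  where "tetrahedron_face f g h a b c =
    vinv C (c \<diamondop> id2 C f) \<cdot> (associator C h g f \<cdot> (id2 C h \<diamondop> a) \<cdot> b)"

lemma tetrahedron_face:
  assumes mor: "f \<in> topspace (Mor C)" "g \<in> topspace (Mor C)" "h \<in> topspace (Mor C)"
      "src1 C g = tgt1 C f" "src1 C h = tgt1 C g"
    and cell: "a \<in> topspace (Cell C)" "b \<in> topspace (Cell C)" "c \<in> topspace (Cell C)" "vinvertible C c"
    and "tgt2 C a = g \<star> f" "tgt2 C b = h \<star> src2 C a" "tgt2 C c = h \<star> g"
  shows "tetrahedron_face f g h a b c \<in> topspace (Cell C)"
    and "src2 C (tetrahedron_face f g h a b c) = src2 C b"
    and "tgt2 C (tetrahedron_face f g h a b c) = src2 C c \<star> f"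
    and "d \<in> topspace (Cell C) \<Longrightarrow> tgt2 C d = src2 C c \<star> f \<Longrightarrow>
      d = tetrahedron_face f g h a b c \<longleftrightarrow>
      associator C h g f \<cdot> (id2 C h \<diamondop> a) \<cdot> b = (c \<diamondop> id2 C f) \<cdot> d"
proof -
  have src: "src1 C (src2 C a) = src1 C f" "tgt1 C (src2 C a) = tgt1 C g"
      "src1 C (src2 C c) = src1 C g" "tgt1 C (src2 C c) = tgt1 C h"
    using globular_src[of a] globular_tgt[of a] globular_src[of c] globular_tgt[of c] assms by simp_all
  note ty = assms src
  have cf: "c \<diamondop> id2 C f \<in> topspace (Cell C)" "vinvertible C (c \<diamondop> id2 C f)"
    "src2 C (c \<diamondop> id2 C f) = src2 C c \<star> f" "tgt2 C (c \<diamondop> id2 C f) = (h \<star> g) \<star> f"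
    using ty by (auto intro!: vinvertible_hcomp vinvertible_id2)
  let ?e = "associator C h g f \<cdot> (id2 C h \<diamondop> a) \<cdot> b"
  have e: "?e \<in> topspace (Cell C)" "src2 C ?e = src2 C b" "tgt2 C ?e = (h \<star> g) \<star> f"
    using ty by simp_all
  show face: "tetrahedron_face f g h a b c \<in> topspace (Cell C)"
    "src2 C (tetrahedron_face f g h a b c) = src2 C b"
    "tgt2 C (tetrahedron_face f g h a b c) = src2 C c \<star> f"
    unfolding tetrahedron_face_def using cf e by simp_all
  have eq: "(c \<diamondop> id2 C f) \<cdot> tetrahedron_face f g h a b c = ?e"
    unfolding tetrahedron_face_def using cf e by (simp flip: vcomp_assoc[of ?e])
  assume d: "d \<in> topspace (Cell C)" "tgt2 C d = src2 C c \<star> f"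
  show "d = tetrahedron_face f g h a b c \<longleftrightarrow> ?e = (c \<diamondop> id2 C f) \<cdot> d"
    using eq vcomp_left_cancel[of "c \<diamondop> id2 C f" d "tetrahedron_face f g h a b c"] d face cf by auto
qed

text \<open>
  The extension of an \<open>n\<close>-simplex \<open>s\<close> by a vertex \<open>n + 1\<close>, where \<open>f\<close> becomes the edge from \<open>n\<close> to \<open>n + 1\<close>
  and \<open>w i\<close> the triangle on \<open>i, n, n + 1\<close>.
\<close>

definition extend_vertices :: "nat \<Rightarrow> ('o, 'm, 'c) nerve_simplex \<Rightarrow> 'm \<Rightarrow> nat \<Rightarrow> 'o"
  where "extend_vertices n s f = (\<lambda>i\<in>{..Suc n}. if i \<le> n then fst s i else tgt1 C f)"

definition extend_edges ::
    "nat \<Rightarrow> ('o, 'm, 'c) nerve_simplex \<Rightarrow> 'm \<Rightarrow> (nat \<Rightarrow> 'c) \<Rightarrow> nat \<times> nat \<Rightarrow> 'm"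
  where "extend_edges n s f w = (\<lambda>(i, j)\<in>edges (Suc n).
    if j \<le> n then fst (snd s) (i, j) else if i = n then f else src2 C (w i))"

definition extend_triangles ::
    "nat \<Rightarrow> ('o, 'm, 'c) nerve_simplex \<Rightarrow> 'm \<Rightarrow> (nat \<Rightarrow> 'c) \<Rightarrow> nat \<times> nat \<times> nat \<Rightarrow> 'c"
  where "extend_triangles n s f w = (\<lambda>(i, j, k)\<in>triangles (Suc n).
    if k \<le> n then snd (snd s) (i, j, k) else if j = n then w i
    else tetrahedron_face (fst (snd s) (i, j)) (fst (snd s) (j, n)) f (snd (snd s) (i, j, n)) (w i) (w j))"

lemma extend_simps:
  "i \<le> n \<Longrightarrow> extend_vertices n s f i = fst s i"
  "extend_vertices n s f (Suc n) = tgt1 C f"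
  "i < j \<Longrightarrow> j \<le> n \<Longrightarrow> extend_edges n s f w (i, j) = fst (snd s) (i, j)"
  "i < n \<Longrightarrow> extend_edges n s f w (i, Suc n) = src2 C (w i)"
  "extend_edges n s f w (n, Suc n) = f"
  "i < j \<Longrightarrow> j < k \<Longrightarrow> k \<le> n \<Longrightarrow> extend_triangles n s f w (i, j, k) = snd (snd s) (i, j, k)"
  "i < n \<Longrightarrow> extend_triangles n s f w (i, n, Suc n) = w i"
  "i < j \<Longrightarrow> j < n \<Longrightarrow> extend_triangles n s f w (i, j, Suc n) =
    tetrahedron_face (fst (snd s) (i, j)) (fst (snd s) (j, n)) f (snd (snd s) (i, j, n)) (w i) (w j)"
  by (simp_all add: extend_vertices_def extend_edges_def extend_triangles_def edges_def triangles_def)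

text \<open>Among the new tetrahedra, those containing both n and n+1 hold because
  \<open>tetrahedron_face\<close> solves exactly these equations. For i < j < k < n, the one on i,
  j, k, n+1 follows from the pentagon on i, j, k, n, n+1.\<close>

lemma extend_nerve:
  assumes inv: "\<forall>a\<in>topspace (Cell C). vinvertible C a"
    and s: "s \<in> topspace (nerve C n)" and f: "f \<in> topspace (Mor C)" "src1 C f = fst s n"
    and w: "\<And>i. i < n \<Longrightarrow> w i \<in> topspace (Cell C)"
      "\<And>i. i < n \<Longrightarrow> tgt2 C (w i) = f \<star> fst (snd s) (i, n)"
  shows "(extend_vertices n s f, extend_edges n s f w, extend_triangles n s f w) \<in> topspace (nerve C (Suc n))"
proof -
  let ?V = "extend_vertices n s f" and ?Y = "extend_edges n s f w" and ?Z = "extend_triangles n s f w"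
  note sD = nerve_simplexD[OF s]
  have w_src: "src2 C (w i) \<in> topspace (Mor C)" "src1 C (src2 C (w i)) = fst s i"
    "tgt1 C (src2 C (w i)) = tgt1 C f" if "i < n" for i
    using globular_src[OF w(1)[OF that]] globular_tgt[OF w(1)[OF that]] w[OF that] that f
      sD(2-4)[of i n] by auto
  have Y: "?Y (i, j) \<in> topspace (Mor C) \<and> src1 C (?Y (i, j)) = ?V i \<and> tgt1 C (?Y (i, j)) = ?V j"
    if ij: "i < j" "j \<le> Suc n" for i j
  proof -
    consider "j \<le> n" | "j = Suc n" "i < n" | "j = Suc n" "i = n" using ij by linarith
    then show ?thesis
    proof cases
      case 1
      then show ?thesis using ij sD(2-4)[of i j] by (simp add: extend_simps)
    next
      case 2
      then show ?thesis using w_src[of i] by (simp add: extend_simps)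
    next
      case 3
      show ?thesis unfolding 3 using f by (simp add: extend_simps)
    qed
  qed
  have face:
    "?Z (i, j, Suc n) \<in> topspace (Cell C) \<and> src2 C (?Z (i, j, Suc n)) = ?Y (i, Suc n) \<and>
      tgt2 C (?Z (i, j, Suc n)) = ?Y (j, Suc n) \<star> ?Y (i, j)"
    "associator C (?Y (n, Suc n)) (?Y (j, n)) (?Y (i, j)) \<cdot> (id2 C (?Y (n, Suc n)) \<diamondop> ?Z (i, j, n)) \<cdot>
      ?Z (i, n, Suc n) = (?Z (j, n, Suc n) \<diamondop> id2 C (?Y (i, j))) \<cdot> ?Z (i, j, Suc n)"
    if "i < j" "j < n" for i j
  proof -
    let ?face = "tetrahedron_face (fst (snd s) (i, j)) (fst (snd s) (j, n)) f (snd (snd s) (i, j, n)) (w i) (w j)"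
    have ij: "i < n" using that by simp
    have ty: "fst (snd s) (i, j) \<in> topspace (Mor C)" "fst (snd s) (j, n) \<in> topspace (Mor C)"
      "f \<in> topspace (Mor C)" "src1 C (fst (snd s) (j, n)) = tgt1 C (fst (snd s) (i, j))"
      "src1 C f = tgt1 C (fst (snd s) (j, n))" "snd (snd s) (i, j, n) \<in> topspace (Cell C)"
      "w i \<in> topspace (Cell C)" "w j \<in> topspace (Cell C)" "vinvertible C (w j)"
      "tgt2 C (snd (snd s) (i, j, n)) = fst (snd s) (j, n) \<star> fst (snd s) (i, j)"
      "tgt2 C (w i) = f \<star> src2 C (snd (snd s) (i, j, n))" "tgt2 C (w j) = f \<star> fst (snd s) (j, n)"
      using that ij w f inv sD(2-4)[of i j] sD(2-4)[of j n] sD(5-7)[of i j n] by auto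
    note F = tetrahedron_face[OF ty]
    show "?Z (i, j, Suc n) \<in> topspace (Cell C) \<and> src2 C (?Z (i, j, Suc n)) = ?Y (i, Suc n) \<and>
      tgt2 C (?Z (i, j, Suc n)) = ?Y (j, Suc n) \<star> ?Y (i, j)"
      using F(1-3) that ij by (simp add: extend_simps)
    show "associator C (?Y (n, Suc n)) (?Y (j, n)) (?Y (i, j)) \<cdot> (id2 C (?Y (n, Suc n)) \<diamondop> ?Z (i, j, n)) \<cdot>
      ?Z (i, n, Suc n) = (?Z (j, n, Suc n) \<diamondop> id2 C (?Y (i, j))) \<cdot> ?Z (i, j, Suc n)"
      using F(4)[OF F(1,3)] that ij by (simp add: extend_simps)
  qed
  have Z: "?Z (i, j, k) \<in> topspace (Cell C) \<and> src2 C (?Z (i, j, k)) = ?Y (i, k) \<and>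
      tgt2 C (?Z (i, j, k)) = ?Y (j, k) \<star> ?Y (i, j)"
    if ij: "i < j" "j < k" "k \<le> Suc n" for i j k
  proof -
    consider "k \<le> n" | "k = Suc n" "j < n" | "k = Suc n" "j = n" using ij by linarith
    then show ?thesis
    proof cases
      case 1
      then show ?thesis using ij sD(5-7)[of i j k] by (simp add: extend_simps)
    next
      case 2
      then show ?thesis using ij face(1)[of i j] by simp
    next
      case 3
      then have "i < n" using ij by simp
      then show ?thesis unfolding 3 using w[of i] by (simp add: extend_simps)
    qed
  qed
  have low: "associator C (?Y (k, l)) (?Y (j, k)) (?Y (i, j)) \<cdot> (id2 C (?Y (k, l)) \<diamondop> ?Z (i, j, k)) \<cdot>
      ?Z (i, k, l) = (?Z (j, k, l) \<diamondop> id2 C (?Y (i, j))) \<cdot> ?Z (i, j, l)"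
    if "i < j" "j < k" "k < l" "l \<le> n" for i j k l
    using sD(8)[OF that] that by (simp add: extend_simps)
  show ?thesis
  proof (rule nerve_simplexI)
    fix i j k l assume ij: "i < j" "j < k" "k < l" "l \<le> Suc n"
    consider "l \<le> n" | "l = Suc n" "k = n" | "l = Suc n" "k < n" using ij by linarith
    then show "associator C (?Y (k, l)) (?Y (j, k)) (?Y (i, j)) \<cdot> (id2 C (?Y (k, l)) \<diamondop> ?Z (i, j, k)) \<cdot>
      ?Z (i, k, l) = (?Z (j, k, l) \<diamondop> id2 C (?Y (i, j))) \<cdot> ?Z (i, j, l)"
    proof cases
      case 1
      then show ?thesis using low ij by blast
    next
      case 2
      then show ?thesis using face(2) ij by blast
    next
      case 3
      have lt: "i < k" "i < n" "j < n" "k < n" "n < l" "i < l" "j < l" "k < l" "n \<le> l"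
        "j \<le> l" "k \<le> l" "l \<le> l" using ij 3 by simp_all
      have Y': "?Y (a, b) \<in> topspace (Mor C)" "src1 C (?Y (a, b)) = ?V a" "tgt1 C (?Y (a, b)) = ?V b"
        if "a < b" "b \<le> l" for a b
        using Y[of a b] that 3 by simp_all
      have Z': "?Z (a, b, c) \<in> topspace (Cell C)" "src2 C (?Z (a, b, c)) = ?Y (a, c)"
        "tgt2 C (?Z (a, b, c)) = ?Y (b, c) \<star> ?Y (a, b)"
        if "a < b" "b < c" "c \<le> l" for a b c
        using Z[of a b c] that 3 by simp_all
      have inv': "vinvertible C (?Z (k, n, l))" using inv Z'(1)[of k n l] lt by simp
      \<comment> \<open>The four known tetrahedra: i, j, k, n in the given simplex, and those
        obtained by adding n, n+1 to the pairs i, j and i, k and j, k.\<close>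
      note T = low[OF ij(1,2) lt(4) order_refl]
        face(2)[OF ij(1) lt(3), folded 3(1)] face(2)[OF lt(1,4), folded 3(1)] face(2)[OF ij(2) lt(4), folded 3(1)]
      show ?thesis
        by (rule tetrahedron_from_pentagon[OF _ _ _ _ _ _ _ _ _ _ _ _ _ _ _ _ _ _ _ _ _ _ _ _ _ _ _ _ _ _
              _ _ _ _ _ _ _ _ _ _ _ _ _ _ _ _ _ _ _ _ _ _ _ _ _ _ _ _ _ _ _ T];
            (rule Y' Z' inv'; (rule ij lt)+)?)
    qed
  next
    show "?V \<in> {..Suc n} \<rightarrow>\<^sub>E topspace (Obj C)"
      using sD(1) f by (auto simp: extend_vertices_def)
    show "?Y \<in> edges (Suc n) \<rightarrow>\<^sub>E topspace (Mor C)"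
      using Y by (auto simp: extend_edges_def edges_def)
    show "?Z \<in> triangles (Suc n) \<rightarrow>\<^sub>E topspace (Cell C)"
      using Z by (auto simp: extend_triangles_def triangles_def)
  qed (use Y Z in simp_all)
qed

end

section \<open>Continuity of the extension\<close>

context topological_bicategory
begin

lemma continuous_map_vcomp:
  assumes "continuous_map X (Cell C) a" "continuous_map X (Cell C) b"
    and "\<And>x. x \<in> topspace X \<Longrightarrow> src2 C (b x) = tgt2 C (a x)"
  shows "continuous_map X (Cell C) (\<lambda>x. b x \<cdot> a x)"
proof -
  have "continuous_map X (vcomposable_cells C) (\<lambda>x. (b x, a x))"
    using assms by (auto simp: vcomposable_cells_def continuous_map_in_subtopology
        intro!: continuous_map_pairedI)
  from continuous_map_compose[OF this continuous_vcomp] show ?thesis by (simp add: o_def)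
qed

lemma continuous_map_hcomp1:
  assumes "continuous_map X (Mor C) f" "continuous_map X (Mor C) g"
    and "\<And>x. x \<in> topspace X \<Longrightarrow> src1 C (g x) = tgt1 C (f x)"
  shows "continuous_map X (Mor C) (\<lambda>x. g x \<star> f x)"
proof -
  have "continuous_map X (composable_mors C) (\<lambda>x. (g x, f x))"
    using assms by (auto simp: composable_mors_def continuous_map_in_subtopology
        intro!: continuous_map_pairedI)
  from continuous_map_compose[OF this continuous_hcomp1] show ?thesis by (simp add: o_def)
qed

lemma continuous_map_hcomp2:
  assumes "continuous_map X (Cell C) a" "continuous_map X (Cell C) b"
    and "\<And>x. x \<in> topspace X \<Longrightarrow> src1 C (src2 C (b x)) = tgt1 C (src2 C (a x))"
  shows "continuous_map X (Cell C) (\<lambda>x. b x \<diamondop> a x)"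
proof -
  have "continuous_map X (hcomposable_cells C) (\<lambda>x. (b x, a x))"
    using assms by (auto simp: hcomposable_cells_def continuous_map_in_subtopology
        intro!: continuous_map_pairedI)
  from continuous_map_compose[OF this continuous_hcomp2] show ?thesis by (simp add: o_def)
qed

lemma continuous_map_associator:
  assumes "continuous_map X (Mor C) f" "continuous_map X (Mor C) g" "continuous_map X (Mor C) h"
    and "\<And>x. x \<in> topspace X \<Longrightarrow> src1 C (g x) = tgt1 C (f x)"
    and "\<And>x. x \<in> topspace X \<Longrightarrow> src1 C (h x) = tgt1 C (g x)"
  shows "continuous_map X (Cell C) (\<lambda>x. associator C (h x) (g x) (f x))"
proof -
  have "continuous_map X (composable_mor_triples C) (\<lambda>x. (h x, g x, f x))"
    using assms by (auto simp: composable_mor_triples_def continuous_map_in_subtopology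
        intro!: continuous_map_pairedI)
  from continuous_map_compose[OF this continuous_associator] show ?thesis by (simp add: o_def)
qed

lemma continuous_map_id2:
  assumes "continuous_map X (Mor C) f"
  shows "continuous_map X (Cell C) (\<lambda>x. id2 C (f x))"
  using continuous_map_compose[OF assms continuous_id2] by (simp add: o_def)

text \<open>This is where continuity of vertical inversion enters: the inverted cell involves an
  arbitrary triangle, beyond the reach of the continuity axioms for the inverse coherence
  cells.\<close>

lemma continuous_map_tetrahedron_face:
  assumes vinv: "continuous_map (Cell C) (Cell C) (vinv C)"
    and mor: "continuous_map X (Mor C) f" "continuous_map X (Mor C) g" "continuous_map X (Mor C) h"
    and cell: "continuous_map X (Cell C) a" "continuous_map X (Cell C) b" "continuous_map X (Cell C) c"
    and ty: "\<And>x. x \<in> topspace X \<Longrightarrow> src1 C (g x) = tgt1 C (f x) \<and> src1 C (h x) = tgt1 C (g x) \<and>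
      vinvertible C (c x) \<and> tgt2 C (a x) = g x \<star> f x \<and> tgt2 C (b x) = h x \<star> src2 C (a x) \<and>
      tgt2 C (c x) = h x \<star> g x"
  shows "continuous_map X (Cell C) (\<lambda>x. tetrahedron_face (f x) (g x) (h x) (a x) (b x) (c x))"
proof -
  have mem: "f x \<in> topspace (Mor C)" "g x \<in> topspace (Mor C)" "h x \<in> topspace (Mor C)"
    "a x \<in> topspace (Cell C)" "b x \<in> topspace (Cell C)" "c x \<in> topspace (Cell C)"
    if "x \<in> topspace X" for x
    using that mor cell by (auto simp: continuous_map_def)
  have src: "src1 C (src2 C (a x)) = src1 C (f x)" "tgt1 C (src2 C (a x)) = tgt1 C (g x)"
      "src1 C (src2 C (c x)) = src1 C (g x)" "tgt1 C (src2 C (c x)) = tgt1 C (h x)"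
    if "x \<in> topspace X" for x
    using globular_src[of "a x"] globular_tgt[of "a x"] globular_src[of "c x"] globular_tgt[of "c x"]
      ty[OF that] mem[OF that] by simp_all
  have inv: "vinvertible C (c x \<diamondop> id2 C (f x))" if "x \<in> topspace X" for x
    using mem[OF that] src[OF that] ty[OF that] by (auto intro!: vinvertible_hcomp vinvertible_id2)
  have "continuous_map X (Cell C) (\<lambda>x. c x \<diamondop> id2 C (f x))"
    by (intro continuous_map_hcomp2 continuous_map_id2 mor cell) (use mem src ty in simp)
  from continuous_map_compose[OF this vinv]
  have cinv: "continuous_map X (Cell C) (\<lambda>x. vinv C (c x \<diamondop> id2 C (f x)))" by (simp add: o_def)
  show ?thesis
    unfolding tetrahedron_face_def
    by (intro continuous_map_vcomp continuous_map_hcomp2 continuous_map_id2 continuous_map_associator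
        cinv mor cell) (use mem src ty inv in simp_all)
qed

section \<open>Equiconnections on the nerve\<close>

lemma equiconnection_nerve_0:
  assumes "equiconnection (Obj C) u L"
  obtains u' L' where "equiconnection (nerve C 0) u' L'"
proof -
  \<comment> \<open>In dimension 0 there are no edges or triangles, and extensionality forces both
    families to be \<open>undefined\<close> everywhere. A simplex is thus its single vertex.\<close>
  define r :: "'a \<Rightarrow> ('a, 'b, 'c) nerve_simplex"
    where "r x = (\<lambda>i\<in>{..0}. x, \<lambda>e\<in>edges 0. undefined, \<lambda>t\<in>triangles 0. undefined)" for x
  have [simp]: "edges 0 = {}" "triangles 0 = {}" by (auto simp: edges_def triangles_def)
  have "continuous_map (Obj C) (nerve C 0) r"
    unfolding r_def[abs_def]
    by (rule continuous_map_into_nerve) (auto intro!: nerve_simplexI)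
  moreover have "r (fst s 0) = s" if "s \<in> topspace (nerve C 0)" for s
  proof -
    have "fst s \<in> extensional {..0}" "fst (snd s) = (\<lambda>e. undefined)" "snd (snd s) = (\<lambda>t. undefined)"
      using that by (auto simp: topspace_nerve PiE_def)
    then show ?thesis by (auto simp: r_def prod_eq_iff extensional_def fun_eq_iff)
  qed
  ultimately show thesis
    using equiconnection_retract[OF assms continuous_map_vertex[of 0 0]] that by blast
qed

text \<open>Since equiconnections pass to retracts, it suffices to have continuous maps
  \<open>e\<close> into the iterated pullback \<open>Q\<close> and \<open>r\<close> back with
  \<open>r (e t) = t\<close>: the map \<open>e\<close> forgets data, and \<open>r\<close>
  reconstructs them.\<close>

lemma equiconnection_nerve_Suc:
  assumes inv: "\<forall>a\<in>topspace (Cell C). vinvertible C a"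
    and vinv: "continuous_map (Cell C) (Cell C) (vinv C)"
    and src1_fib: "hurewicz_fibration (Mor C) (Obj C) (src1 C)"
    and tgt2_fib: "hurewicz_fibration (Cell C) (Mor C) (tgt2 C)"
    and Obj: "equiconnection (Obj C) uO LO" and Mor: "equiconnection (Mor C) uM LM"
    and Cell: "equiconnection (Cell C) uC LC" and nerve: "equiconnection (nerve C n) u L"
  obtains u' L' where "equiconnection (nerve C (Suc n)) u' L'"
proof -
  define P where "P = subtopology (prod_topology (nerve C n) (Mor C)) {(s, f). fst s n = src1 C f}"
  let ?W = "product_topology (\<lambda>_. Cell C) {..<n}"
  \<comment> \<open>The prescribed targets of the triangles on i, n, n+1. There are n of them, one
    for each i < n, so in the step from 0 to 1 the power is a point.\<close>
  define g where "g q = (\<lambda>i\<in>{..<n}. snd q \<star> fst (snd (fst q)) (i, n))"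
    for q :: "('a, 'b, 'c) nerve_simplex \<times> 'b"
  define Q where "Q = subtopology (prod_topology P ?W) {(q, w). g q = (\<lambda>i\<in>{..<n}. tgt2 C (w i))}"
  obtain uP LP where P: "equiconnection P uP LP"
    unfolding P_def
    by (rule equiconnection_pullback[OF nerve Mor Obj src1_fib continuous_map_vertex[OF order_refl]])
  have P_iff: "(s, f) \<in> topspace P \<longleftrightarrow> s \<in> topspace (nerve C n) \<and> f \<in> topspace (Mor C) \<and> fst s n = src1 C f"
    for s f by (auto simp: P_def)
  have P1: "continuous_map P (nerve C n) fst" and P2: "continuous_map P (Mor C) snd"
    by (auto simp: P_def intro!: continuous_map_from_subtopology continuous_map_fst continuous_map_snd)
  have "continuous_map P (Mor C) (\<lambda>q. snd q \<star> fst (snd (fst q)) (i, n))" if "i < n" for i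
  proof (rule continuous_map_hcomp1[OF _ P2])
    show "continuous_map P (Mor C) (\<lambda>q. fst (snd (fst q)) (i, n))"
      using continuous_map_compose[OF P1 continuous_map_edge[of i n n]] that by (simp add: o_def)
    show "src1 C (snd q) = tgt1 C (fst (snd (fst q)) (i, n))" if "q \<in> topspace P" for q
      using that \<open>i < n\<close> P_iff[of "fst q" "snd q"] nerve_edge_tgt1[of "fst q" n i n] by simp
  qed
  then have g: "continuous_map P (product_topology (\<lambda>_. Mor C) {..<n}) g"
    by (simp add: continuous_map_componentwise g_def image_subset_iff)
  obtain uQ LQ where Q: "equiconnection Q uQ LQ"
    unfolding Q_def
    by (rule equiconnection_pullback[OF P equiconnection_product[OF Cell] equiconnection_product[OF Mor]
          hurewicz_fibration_product[OF tgt2_fib] g]) auto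
  have Q1: "continuous_map Q P fst" and Q2: "continuous_map Q ?W snd"
    by (auto simp: Q_def intro!: continuous_map_from_subtopology continuous_map_fst continuous_map_snd)
  have Qs: "continuous_map Q (nerve C n) (\<lambda>q. fst (fst q))" and Qf: "continuous_map Q (Mor C) (\<lambda>q. snd (fst q))"
    using continuous_map_compose[OF Q1 P1] continuous_map_compose[OF Q1 P2] by (simp_all add: o_def)
  have Qw: "continuous_map Q (Cell C) (\<lambda>q. snd q i)" if "i < n" for i
    using continuous_map_compose[OF Q2 continuous_map_product_projection[of i]] that by (simp add: o_def)
  have QD: "fst (fst q) \<in> topspace (nerve C n)" "snd (fst q) \<in> topspace (Mor C)"
    "src1 C (snd (fst q)) = fst (fst (fst q)) n"
    "i < n \<Longrightarrow> snd q i \<in> topspace (Cell C)"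
    "i < n \<Longrightarrow> tgt2 C (snd q i) = snd (fst q) \<star> fst (snd (fst (fst q))) (i, n)"
    if q: "q \<in> topspace Q" for q i
  proof -
    obtain s f w where q_eq: "q = ((s, f), w)" by (metis prod.exhaust)
    have *: "(s, f) \<in> topspace P" "w \<in> {..<n} \<rightarrow>\<^sub>E topspace (Cell C)"
      "g (s, f) = (\<lambda>i\<in>{..<n}. tgt2 C (w i))"
      using q by (auto simp: Q_def q_eq)
    show "fst (fst q) \<in> topspace (nerve C n)" "snd (fst q) \<in> topspace (Mor C)"
      "src1 C (snd (fst q)) = fst (fst (fst q)) n"
      using *(1) by (simp_all add: q_eq P_iff)
    assume "i < n"
    then show "snd q i \<in> topspace (Cell C)" "tgt2 C (snd q i) = snd (fst q) \<star> fst (snd (fst (fst q))) (i, n)"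
      using *(2) fun_cong[OF *(3), of i] by (auto simp: q_eq g_def)
  qed
  define r where "r q = (extend_vertices n (fst (fst q)) (snd (fst q)),
      extend_edges n (fst (fst q)) (snd (fst q)) (snd q),
      extend_triangles n (fst (fst q)) (snd (fst q)) (snd q))" for q
  have r: "continuous_map Q (nerve C (Suc n)) r"
    unfolding r_def[abs_def]
  proof (rule continuous_map_into_nerve, goal_cases)
    case (1 i)
    show ?case
    proof (cases "i \<le> n")
      case True
      then show ?thesis
        using continuous_map_compose[OF Qs continuous_map_vertex[of i n]] by (simp add: o_def extend_simps)
    next
      case False
      then have "i = Suc n" using 1 by simp
      then show ?thesis
        using continuous_map_compose[OF Qf continuous_tgt1] by (simp add: o_def extend_simps)
    qed
  next
    case (2 i j)
    consider "j \<le> n" | "j = Suc n" "i < n" | "j = Suc n" "i = n" using 2 by linarith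
    then show ?case
    proof cases
      case 1
      then show ?thesis
        using continuous_map_compose[OF Qs continuous_map_edge[of i j n]] 2 by (simp add: o_def extend_simps)
    next
      case 2
      then show ?thesis
        using continuous_map_compose[OF Qw continuous_src2] by (simp add: o_def extend_simps)
    next
      case 3
      show ?thesis unfolding 3 using Qf by (simp add: extend_simps)
    qed
  next
    case (3 i j k)
    consider "k \<le> n" | "k = Suc n" "j < n" | "k = Suc n" "j = n" using 3 by linarith
    then show ?case
    proof cases
      case 1
      then show ?thesis
        using continuous_map_compose[OF Qs continuous_map_triangle[of i j k n]] 3
        by (simp add: o_def extend_simps)
    next
      case 2
      have i_n: "i < n" using 3 2 by simp
      have "continuous_map Q (Cell C) (\<lambda>q. tetrahedron_face (fst (snd (fst (fst q))) (i, j))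
          (fst (snd (fst (fst q))) (j, n)) (snd (fst q)) (snd (snd (fst (fst q))) (i, j, n)) (snd q i) (snd q j))"
      proof (rule continuous_map_tetrahedron_face[OF vinv])
        show "continuous_map Q (Mor C) (\<lambda>q. fst (snd (fst (fst q))) (i, j))"
          "continuous_map Q (Mor C) (\<lambda>q. fst (snd (fst (fst q))) (j, n))"
          "continuous_map Q (Cell C) (\<lambda>q. snd (snd (fst (fst q))) (i, j, n))"
          using continuous_map_compose[OF Qs continuous_map_edge[of i j n]]
            continuous_map_compose[OF Qs continuous_map_edge[of j n n]]
            continuous_map_compose[OF Qs continuous_map_triangle[of i j n n]] 3 2
          by (simp_all add: o_def)
        show "continuous_map Q (Mor C) (\<lambda>q. snd (fst q))" by (rule Qf)
        show "continuous_map Q (Cell C) (\<lambda>q. snd q i)" "continuous_map Q (Cell C) (\<lambda>q. snd q j)"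
          by (rule Qw[OF i_n] Qw[OF 2(2)])+
        fix q assume q: "q \<in> topspace Q"
        note sD = nerve_simplexD[OF QD(1)[OF q]]
        show "src1 C (fst (snd (fst (fst q))) (j, n)) = tgt1 C (fst (snd (fst (fst q))) (i, j)) \<and>
          src1 C (snd (fst q)) = tgt1 C (fst (snd (fst (fst q))) (j, n)) \<and> vinvertible C (snd q j) \<and>
          tgt2 C (snd (snd (fst (fst q))) (i, j, n)) =
            fst (snd (fst (fst q))) (j, n) \<star> fst (snd (fst (fst q))) (i, j) \<and>
          tgt2 C (snd q i) = snd (fst q) \<star> src2 C (snd (snd (fst (fst q))) (i, j, n)) \<and>
          tgt2 C (snd q j) = snd (fst q) \<star> fst (snd (fst (fst q))) (j, n)"
          using sD(3,4)[of i j] sD(3,4)[of j n] sD(6,7)[of i j n] QD(3)[OF q] QD(4,5)[OF q i_n]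
            QD(4,5)[OF q 2(2)] inv 3 2 by simp
      qed
      then show ?thesis using 2 3 by (simp add: extend_simps)
    next
      case 3
      then have "i < n" using \<open>i < j\<close> by simp
      then show ?thesis unfolding 3 using Qw by (simp add: extend_simps)
    qed
  next
    case (4 q)
    then show ?case using QD[OF 4] by (intro extend_nerve[OF inv]) auto
  qed
  define e where "e t = ((nerve_map C n (Suc n) id t, fst (snd t) (n, Suc n)),
      \<lambda>i\<in>{..<n}. snd (snd t) (i, n, Suc n))" for t
  \<comment> \<open>On \<open>{..n}\<close> the map \<open>id\<close> is the inclusion that omits
    n+1, so it induces the last face.\<close>
  have incl: "simplex_map n (Suc n) id" by (auto simp: simplex_map_def mono_on_def)
  have cd: "continuous_map (nerve C (Suc n)) (nerve C n) (nerve_map C n (Suc n) id)"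
    by (rule simplicial_space.continuous[OF simplicial_space_nerve incl])
  have face: "i \<le> n \<Longrightarrow> fst (nerve_map C n (Suc n) id t) i = fst t i"
    "i < j \<Longrightarrow> j \<le> n \<Longrightarrow> fst (snd (nerve_map C n (Suc n) id t)) (i, j) = fst (snd t) (i, j)"
    "i < j \<Longrightarrow> j < k \<Longrightarrow> k \<le> n \<Longrightarrow>
      snd (snd (nerve_map C n (Suc n) id t)) (i, j, k) = snd (snd t) (i, j, k)"
    for i j k and t :: "('a, 'b, 'c) nerve_simplex"
    by (simp_all add: nerve_map_simps edge_at_simps triangle_at_simps edges_def triangles_def)
  have e_Q: "e t \<in> topspace Q" if t: "t \<in> topspace (nerve C (Suc n))" for t
  proof -
    note tD = nerve_simplexD[OF t]
    have "fst (e t) \<in> topspace P"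
      using nerve_map_nerve[OF incl t] tD(2,3)[of n "Suc n"] by (simp add: e_def P_iff face)
    moreover have "snd (e t) \<in> {..<n} \<rightarrow>\<^sub>E topspace (Cell C)"
      using tD(5)[of _ n "Suc n"] by (auto simp: e_def)
    moreover have "g (fst (e t)) = (\<lambda>i\<in>{..<n}. tgt2 C (snd (e t) i))"
      unfolding g_def using tD(7)[of _ n "Suc n"] by (intro restrict_ext) (simp add: e_def face)
    ultimately show ?thesis by (simp add: Q_def mem_Times_iff case_prod_unfold)
  qed
  have e: "continuous_map (nerve C (Suc n)) Q e"
  proof -
    have "continuous_map (nerve C (Suc n)) ?W (\<lambda>t. \<lambda>i\<in>{..<n}. snd (snd t) (i, n, Suc n))"
      by (simp add: continuous_map_componentwise image_subset_iff continuous_map_triangle)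
    moreover have "fst (e t) \<in> topspace P" if "t \<in> topspace (nerve C (Suc n))" for t
      using e_Q[OF that] by (simp add: Q_def mem_Times_iff)
    then have "continuous_map (nerve C (Suc n)) P (\<lambda>t. (nerve_map C n (Suc n) id t, fst (snd t) (n, Suc n)))"
      unfolding P_def continuous_map_in_subtopology
      using continuous_map_pairedI[OF cd continuous_map_edge[of n "Suc n" "Suc n"]]
      by (simp add: e_def P_iff Pi_iff)
    ultimately have "continuous_map (nerve C (Suc n)) (prod_topology P ?W) e"
      unfolding e_def[abs_def] by (intro continuous_map_pairedI[of _ P _ ?W])
    moreover have "e \<in> topspace (nerve C (Suc n)) \<rightarrow> {(q, w). g q = (\<lambda>i\<in>{..<n}. tgt2 C (w i))}"
      using e_Q by (simp add: Q_def Pi_iff)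
    ultimately show ?thesis
      unfolding Q_def continuous_map_in_subtopology by (rule conjI)
  qed
  have re: "r (e t) = t" if t: "t \<in> topspace (nerve C (Suc n))" for t
  proof -
    note tD = nerve_simplexD[OF t]
    let ?s = "nerve_map C n (Suc n) id t" and ?f = "fst (snd t) (n, Suc n)"
      and ?w = "\<lambda>i\<in>{..<n}. snd (snd t) (i, n, Suc n)"
    have ext: "fst t \<in> extensional {..Suc n}" "fst (snd t) \<in> extensional (edges (Suc n))"
      "snd (snd t) \<in> extensional (triangles (Suc n))"
      using t by (auto simp: topspace_nerve PiE_def)
    have "extend_vertices n ?s ?f i = fst t i" if "i \<le> Suc n" for i
      using that tD(4)[of n "Suc n"] by (cases "i \<le> n") (auto simp: le_Suc_eq extend_simps face)
    then have 1: "extend_vertices n ?s ?f = fst t"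
      by (intro extensionalityI[OF _ ext(1)]) (auto simp: extend_vertices_def)
    have "extend_edges n ?s ?f ?w (i, j) = fst (snd t) (i, j)" if ij: "i < j" "j \<le> Suc n" for i j
    proof -
      consider "j \<le> n" | "j = Suc n" "i < n" | "j = Suc n" "i = n" using ij by linarith
      then show ?thesis
      proof cases
        case 1
        then show ?thesis using ij by (simp add: extend_simps face)
      next
        case 2
        then show ?thesis using tD(6)[of i n "Suc n"] by (simp add: extend_simps)
      next
        case 3
        show ?thesis unfolding 3 by (simp add: extend_simps)
      qed
    qed
    then have 2: "extend_edges n ?s ?f ?w = fst (snd t)"
      by (intro extensionalityI[OF _ ext(2)]) (auto simp: extend_edges_def edges_def)
    have "extend_triangles n ?s ?f ?w (i, j, k) = snd (snd t) (i, j, k)"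
      if ij: "i < j" "j < k" "k \<le> Suc n" for i j k
    proof -
      consider "k \<le> n" | "k = Suc n" "j < n" | "k = Suc n" "j = n" using ij by linarith
      then show ?thesis
      proof cases
        case 1
        then show ?thesis using ij by (simp add: extend_simps face)
      next
        case 2
        have i_n: "i < n" using ij 2 by simp
        have ty: "fst (snd t) (i, j) \<in> topspace (Mor C)" "fst (snd t) (j, n) \<in> topspace (Mor C)"
          "?f \<in> topspace (Mor C)" "src1 C (fst (snd t) (j, n)) = tgt1 C (fst (snd t) (i, j))"
          "src1 C ?f = tgt1 C (fst (snd t) (j, n))" "snd (snd t) (i, j, n) \<in> topspace (Cell C)"
          "snd (snd t) (i, n, Suc n) \<in> topspace (Cell C)" "snd (snd t) (j, n, Suc n) \<in> topspace (Cell C)"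
          "vinvertible C (snd (snd t) (j, n, Suc n))"
          "tgt2 C (snd (snd t) (i, j, n)) = fst (snd t) (j, n) \<star> fst (snd t) (i, j)"
          "tgt2 C (snd (snd t) (i, n, Suc n)) = ?f \<star> src2 C (snd (snd t) (i, j, n))"
          "tgt2 C (snd (snd t) (j, n, Suc n)) = ?f \<star> fst (snd t) (j, n)"
          using tD(2-4)[of i j] tD(2-4)[of j n] tD(2-4)[of n "Suc n"] tD(5-7)[of i j n]
            tD(5-7)[of i n "Suc n"] tD(5-7)[of j n "Suc n"] inv ij 2 i_n by auto
        \<comment> \<open>The triangle of \<open>t\<close> satisfies the tetrahedron equation on i,
          j, n, n+1, whose solution is unique because the triangle on j, n, n+1 is
          invertible.\<close>
        have "snd (snd t) (i, j, Suc n) = tetrahedron_face (fst (snd t) (i, j)) (fst (snd t) (j, n)) ?f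
            (snd (snd t) (i, j, n)) (snd (snd t) (i, n, Suc n)) (snd (snd t) (j, n, Suc n))"
          using tetrahedron_face(4)[OF ty, of "snd (snd t) (i, j, Suc n)"] tD(8)[of i j n "Suc n"]
            tD(5-7)[of i j "Suc n"] tD(6)[of j n "Suc n"] ij 2 by simp
        then show ?thesis using ij 2 i_n by (simp add: extend_simps face)
      next
        case 3
        then have "i < n" using ij by simp
        then show ?thesis unfolding 3 by (simp add: extend_simps)
      qed
    qed
    then have 3: "extend_triangles n ?s ?f ?w = snd (snd t)"
      by (intro extensionalityI[OF _ ext(3)]) (auto simp: extend_triangles_def triangles_def)
    show ?thesis unfolding r_def e_def using 1 2 3 by simp
  qed
  show thesis by (rule that[OF equiconnection_retract[OF Q e r re]])
qed

lemma equiconnection_nerve: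
  assumes inv: "\<forall>a\<in>topspace (Cell C). vinvertible C a"
    and vinv: "continuous_map (Cell C) (Cell C) (vinv C)"
    and src1_fib: "hurewicz_fibration (Mor C) (Obj C) (src1 C)"
    and tgt2_fib: "hurewicz_fibration (Cell C) (Mor C) (tgt2 C)"
    and Cell: "equiconnection (Cell C) u L"
  shows "\<exists>u' L'. equiconnection (nerve C n) u' L'"
proof -
  \<comment> \<open>Identities are continuous sections of the source maps, so \<open>Mor C\<close>
    is a retract of \<open>Cell C\<close>, and \<open>Obj C\<close> one of
    \<open>Mor C\<close>.\<close>
  have Mor: "equiconnection (Mor C) (\<lambda>(a, b). u (id2 C a, id2 C b))
      (\<lambda>((a, b), t). src2 C (L ((id2 C a, id2 C b), t)))" (is "equiconnection _ ?uM ?LM")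
    by (rule equiconnection_retract[OF Cell continuous_id2 continuous_src2]) simp
  have Obj: "equiconnection (Obj C) (\<lambda>(a, b). ?uM (id1 C a, id1 C b))
      (\<lambda>((a, b), t). src1 C (?LM ((id1 C a, id1 C b), t)))"
    by (rule equiconnection_retract[OF Mor continuous_id1 continuous_src1]) simp
  show ?thesis
  proof (induction n)
    case 0
    show ?case using equiconnection_nerve_0[OF Obj] by blast
  next
    case (Suc n)
    then show ?case using equiconnection_nerve_Suc[OF inv vinv src1_fib tgt2_fib Obj Mor Cell] by blast
  qed
qed

end

section \<open>Degeneracies as inclusions of retracts\<close>

lemma simplex_map_codegeneracy: "i \<le> n \<Longrightarrow> simplex_map (Suc n) n (codegeneracy i)"
  by (auto simp: simplex_map_def mono_on_def codegeneracy_def)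

lemma good_simplicial_space_if_equiconnection:
  assumes "simplicial_space X F" and "\<And>n. \<exists>u L. equiconnection (X n) u L"
  shows "good_simplicial_space X F"
  unfolding good_simplicial_space_def
proof (intro conjI allI impI)
  interpret simplicial_space X F by fact
  fix n i :: nat assume i: "i \<le> n"
  \<comment> \<open>The coface that omits i+1, a section of the codegeneracy that hits i twice.
    Contravariance turns it into a retraction of the degeneracy.\<close>
  define \<delta> where "\<delta> j = (if j \<le> i then j else Suc j)" for j :: nat
  have \<delta>: "simplex_map n (Suc n) \<delta>" by (auto simp: simplex_map_def mono_on_def \<delta>_def)
  note \<sigma> = simplex_map_codegeneracy[OF i]
  have "F n (Suc n) \<delta> (F (Suc n) n (codegeneracy i) x) = x" if x: "x \<in> topspace (X n)" for x
  proof -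
    have "codegeneracy i \<circ> \<delta> = id" by (auto simp: codegeneracy_def \<delta>_def)
    then show ?thesis using composite[OF \<delta> \<sigma> x] identity[OF x] by simp
  qed
  with assms(2)[of "Suc n"] show "closed_cofibration (X n) (X (Suc n)) (F (Suc n) n (codegeneracy i))"
    using equiconnection_retract_closed_cofibration[OF _ continuous[OF \<sigma>] continuous[OF \<delta>]] by blast
qed fact

theorem theorem5p6:
  fixes C :: "('o, 'm, 'c) bicat"
  assumes "topological_bicategory C"
    and "hurewicz_fibration (Mor C) (Obj C) (src1 C)"
    and "hurewicz_fibration (Cell C) (Mor C) (tgt2 C)"
    and "locally_equiconnected (Cell C)"
    and "\<forall>a\<in>topspace (Cell C). vinvertible C a"
    and "continuous_map (Cell C) (Cell C) (vinv C)"
  shows "good_topological_bicategory C"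
proof -
  interpret topological_bicategory C by fact
  obtain u L where "equiconnection (Cell C) u L"
    using assms(4) by (rule locally_equiconnected_imp_equiconnection)
  with assms show ?thesis
    unfolding good_topological_bicategory_def
    by (intro good_simplicial_space_if_equiconnection simplicial_space_nerve equiconnection_nerve) auto
qed

end
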